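(* Let $\Omega\subset\mathbb{R}^N$, $N\ge 2$, be a bounded $C^2$ domain whose anisotropic mean curvature satisfies $\mathcal H_F\ge 0$ on $\partial\Omega$. Then $$\lambda_F(p,\Omega)\ge\left(\frac{\pi_p}{2N}\right)^p h_F(\Omega)^p.$$
   Context: Let $1<p<+\infty$ and let $F:\mathbb{R}^N\to[0,+\infty)$ be a convex function with $F(t\xi)=|t|F(\xi)$ for all $t\in\mathbb R$, $\xi\in\mathbb{R}^N$, with $a|\xi|\le F(\xi)$ for some constant $a>0$, with $F\in C^{3,\beta}(\mathbb{R}^N\setminus\{0\})$, and such that the Hessian $[F^p]_{\xi\xi}(\xi)$ is positive definite for every $\xi\neq0$. The polar function is $F^o(v)=\sup_{\xi\ne0}\frac{\langle\xi,v\rangle}{F(\xi)}$. A domain is a connected open set. First Dirichlet eigenvalue of the anisotropic $p$-Laplacian: $\lambda_F(p,\Omega)=\min_{\varphi\in W_0^{1,p}(\Omega)\setminus\{0\}}\frac{\int_\Omega F^p(\nabla\varphi)\,dx}{\int_\Omega|\varphi|^p\,dx}$. Anisotropic perimeter: $P_F(K)=\sup\left\{\int_K\operatorname{div}\sigma\,dx:\ \sigma\in C_0^1(\mathbb{R}^N;\mathbb{R}^N),\ F^o(\sigma)\le1\right\}$. Anisotropic Cheeger constant: $h_F(\Omega)=\inf_{K\subset\Omega}\frac{P_F(K)}{|K|}$ (over measurable $K$ with $|K|>0$). $\pi_p:=2\int_0^{(p-1)^{1/p}}\frac{dt}{[1-t^p/(p-1)]^{1/p}}=2\pi\frac{(p-1)^{1/p}}{p\sin(\pi/p)}$.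 Anisotropic mean curvature: for a bounded $C^2$ domain $\Omega$ with Euclidean unit outer normal $n_{\mathcal E}$, the anisotropic outer normal is $n_F=F_\xi(n_{\mathcal E})$ and $\mathcal H_F=\operatorname{div}(n_F)$ on $\partial\Omega$; equivalently, $\mathcal H_F(x)=\operatorname{div}\left[\nabla_\xi F(-\nabla g(x))\right]$ for $x\in\partial\Omega$, for any $g\in C^2(\overline\Omega)$ with $\Omega=\{g>0\}$, $\partial\Omega=\{g=0\}$ and $\nabla g\ne0$ on $\partial\Omega$. *)

theory Defs
  imports "HOL-Analysis.Analysis"
begin

definition grad :: "(real^'n \<Rightarrow> real) \<Rightarrow> real^'n \<Rightarrow> real^'n" where
  "grad f x = (\<chi> i. frechet_derivative f (at x) (axis i 1))"

definition jacobian_mat :: "(real^'n \<Rightarrow> real^'n) \<Rightarrow> real^'n \<Rightarrow> real^'n^'n" where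
  "jacobian_mat \<sigma> x = matrix (frechet_derivative \<sigma> (at x))"

definition divergence :: "(real^'n \<Rightarrow> real^'n) \<Rightarrow> real^'n \<Rightarrow> real" where
  "divergence \<sigma> x = trace (jacobian_mat \<sigma> x)"

definition hessian :: "(real^'n \<Rightarrow> real) \<Rightarrow> real^'n \<Rightarrow> real^'n^'n" where
  "hessian f x = jacobian_mat (grad f) x"

definition pos_definite :: "real^'n^'n \<Rightarrow> bool" where
  "pos_definite A \<longleftrightarrow> transpose A = A \<and> (\<forall>v. v \<noteq> 0 \<longrightarrow> v \<bullet> (A *v v) > 0)"

text \<open>The class \<open>C\<^sup>k(S)\<close>; meaningful for open \<open>S\<close> only, since derivatives are taken at interior points.\<close>

fun Ck_on :: "nat \<Rightarrow> (real^'n) set \<Rightarrow> (real^'n \<Rightarrow> 'b::real_normed_vector) \<Rightarrow> bool" where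
  "Ck_on 0 S f \<longleftrightarrow> continuous_on S f"
| "Ck_on (Suc k) S f \<longleftrightarrow>
     (\<forall>x\<in>S. f differentiable (at x)) \<and>
     (\<forall>i. Ck_on k S (\<lambda>x. frechet_derivative f (at x) (axis i 1)))"

definition locally_Holder_on :: "real \<Rightarrow> 'a::metric_space set \<Rightarrow> ('a \<Rightarrow> 'b::metric_space) \<Rightarrow> bool" where
  "locally_Holder_on \<beta> S f \<longleftrightarrow>
     (\<forall>K. compact K \<and> K \<subseteq> S \<longrightarrow> (\<exists>C. \<forall>x\<in>K. \<forall>y\<in>K. dist (f x) (f y) \<le> C * dist x y powr \<beta>))"

text \<open>The class \<open>C\<^sup>k\<^sup>,\<^sup>\<beta>(S)\<close> for open \<open>S\<close>: all partial derivatives of order \<open>k\<close> exist and are Hoelder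
  continuous with exponent \<open>\<beta>\<close> on compact subsets of \<open>S\<close>.  A bound uniform on all of \<open>S\<close> would be
  too strong for a 1-homogeneous function on the punctured space, whose third derivatives
  are homogeneous of degree \<open>-2\<close>.\<close>

fun Ck_Holder_on :: "nat \<Rightarrow> real \<Rightarrow> (real^'n) set \<Rightarrow> (real^'n \<Rightarrow> 'b::real_normed_vector) \<Rightarrow> bool" where
  "Ck_Holder_on 0 \<beta> S f \<longleftrightarrow> locally_Holder_on \<beta> S f"
| "Ck_Holder_on (Suc k) \<beta> S f \<longleftrightarrow>
     (\<forall>x\<in>S. f differentiable (at x)) \<and>
     (\<forall>i. Ck_Holder_on k \<beta> S (\<lambda>x. frechet_derivative f (at x) (axis i 1)))"

definition supp :: "('a::topological_space \<Rightarrow> 'b::zero) \<Rightarrow> 'a set" where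
  "supp f = closure {x. f x \<noteq> 0}"

definition test_function :: "(real^'n) set \<Rightarrow> (real^'n \<Rightarrow> real) \<Rightarrow> bool" where
  "test_function \<Omega> \<psi> \<longleftrightarrow> (\<forall>k. Ck_on k UNIV \<psi>) \<and> compact (supp \<psi>) \<and> supp \<psi> \<subseteq> \<Omega>"

definition in_Lp :: "real \<Rightarrow> (real^'n) set \<Rightarrow> (real^'n \<Rightarrow> 'b::euclidean_space) \<Rightarrow> bool" where
  "in_Lp p \<Omega> f \<longleftrightarrow> f \<in> borel_measurable (lebesgue_on \<Omega>) \<and>
     integrable (lebesgue_on \<Omega>) (\<lambda>x. norm (f x) powr p)"

definition weak_gradient ::
  "(real^'n) set \<Rightarrow> (real^'n \<Rightarrow> real) \<Rightarrow> (real^'n \<Rightarrow> real^'n) \<Rightarrow> bool" where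
  "weak_gradient \<Omega> u G \<longleftrightarrow> (\<forall>\<psi> i. test_function \<Omega> \<psi> \<longrightarrow>
     (\<integral>x. u x * grad \<psi> x $ i \<partial>lebesgue_on \<Omega>) = - (\<integral>x. G x $ i * \<psi> x \<partial>lebesgue_on \<Omega>))"

definition W1p ::
  "real \<Rightarrow> (real^'n) set \<Rightarrow> (real^'n \<Rightarrow> real) \<Rightarrow> (real^'n \<Rightarrow> real^'n) \<Rightarrow> bool" where
  "W1p p \<Omega> u G \<longleftrightarrow> in_Lp p \<Omega> u \<and> in_Lp p \<Omega> G \<and> weak_gradient \<Omega> u G"

text \<open>\<open>W01p p \<Omega> u G\<close>: \<open>u\<close> lies in the closure of \<open>C\<^sub>c\<^sup>\<infinity>(\<Omega>)\<close> in the \<open>W\<^sup>1\<^sup>,\<^sup>p(\<Omega>)\<close>-norm and \<open>G\<close> is (a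
  representative of) its weak gradient.\<close>

definition W01p ::
  "real \<Rightarrow> (real^'n) set \<Rightarrow> (real^'n \<Rightarrow> real) \<Rightarrow> (real^'n \<Rightarrow> real^'n) \<Rightarrow> bool" where
  "W01p p \<Omega> u G \<longleftrightarrow> W1p p \<Omega> u G \<and>
     (\<exists>\<phi> :: nat \<Rightarrow> real^'n \<Rightarrow> real. (\<forall>k. test_function \<Omega> (\<phi> k)) \<and>
        (\<lambda>k. \<integral>x. \<bar>\<phi> k x - u x\<bar> powr p \<partial>lebesgue_on \<Omega>) \<longlonglongrightarrow> 0 \<and>
        (\<lambda>k. \<integral>x. norm (grad (\<phi> k) x - G x) powr p \<partial>lebesgue_on \<Omega>) \<longlonglongrightarrow> 0)"

text \<open>The infimum, taken in the extended reals, of the Rayleigh quotients over the nonzero elements of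
  \<open>W\<^sub>0\<^sup>1\<^sup>,\<^sup>p(\<Omega>)\<close>; it is the minimum whenever the latter exists.\<close>

definition lambda_F :: "(real^'n \<Rightarrow> real) \<Rightarrow> real \<Rightarrow> (real^'n) set \<Rightarrow> ereal" where
  "lambda_F F p \<Omega> = Inf {ereal ((\<integral>x. F (G x) powr p \<partial>lebesgue_on \<Omega>) / (\<integral>x. \<bar>u x\<bar> powr p \<partial>lebesgue_on \<Omega>)) | u G.
     W01p p \<Omega> u G \<and> \<not> (AE x in lebesgue_on \<Omega>. u x = 0)}"

definition polar :: "(real^'n \<Rightarrow> real) \<Rightarrow> real^'n \<Rightarrow> real" where
  "polar F v = (SUP \<xi>\<in>-{0}. (\<xi> \<bullet> v) / F \<xi>)"

definition perimeter_F :: "(real^'n \<Rightarrow> real) \<Rightarrow> (real^'n) set \<Rightarrow> ereal" where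
  "perimeter_F F K = Sup {ereal (\<integral>x. divergence \<sigma> x \<partial>lebesgue_on K) | \<sigma>.
     Ck_on 1 UNIV \<sigma> \<and> compact (supp \<sigma>) \<and> (\<forall>x. polar F (\<sigma> x) \<le> 1)}"

definition cheeger_F :: "(real^'n \<Rightarrow> real) \<Rightarrow> (real^'n) set \<Rightarrow> ereal" where
  "cheeger_F F \<Omega> = Inf {perimeter_F F K / ereal (measure lebesgue K) | K.
     K \<in> sets lebesgue \<and> K \<subseteq> \<Omega> \<and> measure lebesgue K > 0}"

text \<open>The power \<open>x\<^sup>p\<close> for \<open>x \<in> [0,\<infinity>]\<close> and \<open>p > 0\<close>, with \<open>\<infinity>\<^sup>p = \<infinity>\<close>.\<close>

definition ereal_powr :: "ereal \<Rightarrow> real \<Rightarrow> ereal" where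
  "ereal_powr x p = (if x = \<infinity> then \<infinity> else ereal (real_of_ereal x powr p))"

text \<open>The integrand is unbounded at the right end point, so this is an improper integral; the gauge integral covers it.\<close>

definition pi_p :: "real \<Rightarrow> real" where
  "pi_p p = 2 * integral {0..(p - 1) powr (1/p)} (\<lambda>t. 1 / (1 - t powr p / (p - 1)) powr (1/p))"

text \<open>\<open>\<Omega>\<close> has \<open>C\<^sup>k\<close> boundary: near each boundary point, after relabelling and reorienting the coordinate
  axes (\<open>i\<close>, \<open>s\<close>), \<open>\<Omega>\<close> is the region strictly above the graph of a \<open>C\<^sup>k\<close> function of the \<open>N - 1\<close> coordinates
  other than the \<open>i\<close>-th one.  That function is represented by \<open>\<gamma>\<close> on the hyperplane \<open>y\<^sub>i = 0\<close>.\<close>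

definition Ck_boundary :: "nat \<Rightarrow> (real^'n) set \<Rightarrow> bool" where
  "Ck_boundary k \<Omega> \<longleftrightarrow> (\<forall>x\<in>frontier \<Omega>. \<exists>r>0. \<exists>i. \<exists>s\<in>{-1, 1 :: real}. \<exists>\<gamma> :: real^'n \<Rightarrow> real.
     Ck_on k UNIV \<gamma> \<and>
     \<Omega> \<inter> ball x r = {y \<in> ball x r. s * (y $ i) > \<gamma> (y - (y $ i) *\<^sub>R axis i 1)})"

definition bounded_Ck_domain :: "nat \<Rightarrow> (real^'n) set \<Rightarrow> bool" where
  "bounded_Ck_domain k \<Omega> \<longleftrightarrow> open \<Omega> \<and> connected \<Omega> \<and> \<Omega> \<noteq> {} \<and> bounded \<Omega> \<and> Ck_boundary k \<Omega>"

definition tangent_vector :: "(real^'n) set \<Rightarrow> real^'n \<Rightarrow> real^'n \<Rightarrow> bool" where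
  "tangent_vector M x v \<longleftrightarrow>
     (\<exists>c :: real \<Rightarrow> real^'n. c 0 = x \<and> (\<forall>t. c t \<in> M) \<and> (c has_vector_derivative v) (at 0))"

definition outer_normal :: "(real^'n) set \<Rightarrow> real^'n \<Rightarrow> real^'n" where
  "outer_normal \<Omega> x = (THE \<nu>. norm \<nu> = 1 \<and> (\<forall>v. tangent_vector (frontier \<Omega>) x v \<longrightarrow> \<nu> \<bullet> v = 0) \<and>
     (\<forall>\<^sub>F t in at_right (0::real). x - t *\<^sub>R \<nu> \<in> \<Omega> \<and> x + t *\<^sub>R \<nu> \<notin> closure \<Omega>))"

text \<open>\<open>H\<^sub>F = div n\<^sub>F\<close> with \<open>n\<^sub>F = F\<^sub>\<xi>(n)\<close>, where the outer unit normal \<open>n\<close> is extended to a \<open>C\<^sup>1\<close> field \<open>\<nu>\<close> on a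
  neighbourhood of the boundary point.  The value does not depend on the extension:
  \<open>div F\<^sub>\<xi>(\<nu>) = tr(F\<^sub>\<xi>\<^sub>\<xi>(n) D\<nu>)\<close> at \<open>x\<close>, and \<open>F\<^sub>\<xi>\<^sub>\<xi>(n) n = 0\<close> by homogeneity, so only the tangential
  derivatives of \<open>\<nu>\<close> enter.  For \<open>\<nu> = -\<nabla>g/|\<nabla>g|\<close> with a defining function \<open>g\<close> of \<open>\<Omega>\<close> one obtains
  \<open>div [F\<^sub>\<xi>(-\<nabla>g)]\<close>, as \<open>F\<^sub>\<xi>\<close> is positively 0-homogeneous.\<close>

definition mean_curvature_F :: "(real^'n \<Rightarrow> real) \<Rightarrow> (real^'n) set \<Rightarrow> real^'n \<Rightarrow> real" where
  "mean_curvature_F F \<Omega> x = (SOME h. \<exists>\<nu> U. open U \<and> x \<in> U \<and> Ck_on 1 U \<nu> \<and>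
     (\<forall>y\<in>U \<inter> frontier \<Omega>. \<nu> y = outer_normal \<Omega> y) \<and>
     h = divergence (\<lambda>y. grad F (\<nu> y)) x)"

end

theory Submission
  imports Defs
begin

text \<open>
  Let \<open>d\<close> be the anisotropic distance to the complement of \<open>\<Omega>\<close> and \<open>R\<close> its maximum. The Wulff shape of radius \<open>R\<close>
  contained in \<open>\<Omega>\<close> gives \<open>h\<^sub>F \<le> N/R\<close>, so it remains to show \<open>\<lambda>\<^sub>F \<ge> (\<pi>\<^sub>p/2R)\<^sup>p\<close>. By Young's inequality and the divergence
  theorem it is enough to find, for every compact subset of \<open>\<Omega>\<close>, a \<open>C\<^sup>1\<close> field \<open>V\<close> around it with
  \<open>- div V - (p-1) F\<^sup>o(V)\<^sup>p\<^sup>/\<^sup>(\<^sup>p\<^sup>-\<^sup>1\<^sup>) \<ge> (\<pi>\<^sub>p/2R)\<^sup>p - \<epsilon>\<close>. If \<open>d\<close> were smooth, \<open>V = f(d) F\<^sub>\<xi>(\<nabla>d)\<close> would do, with \<open>f\<close> the decreasing solution of the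
  Riccati equation \<open>- f' - (p-1) f\<^sup>p\<^sup>/\<^sup>(\<^sup>p\<^sup>-\<^sup>1\<^sup>) = \<kappa>\<^sup>p\<close>, because \<open>div F\<^sub>\<xi>(\<nabla>d) \<le> 0\<close> on mean-convex domains.

  To avoid the cut locus, \<open>d\<close> is touched from above at each \<open>x \<in> \<Omega>\<close> by a \<open>C\<^sup>2\<close> function \<open>\<psi>\<close> with \<open>F(\<nabla>\<psi>) \<approx> 1\<close> and \<open>div F\<^sub>\<xi>(\<nabla>\<psi>) \<le> \<eta>\<close>:
  translating the boundary near a nearest point \<open>y\<close> by \<open>x - y\<close> produces points at distance at most \<open>d(x)\<close>, so
  \<open>\<psi>\<close> can be built from a defining function of \<open>\<Omega>\<close> near \<open>y\<close>, and the curvature assumption is only used at \<open>y\<close>. Finitely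
  many such functions are glued by the weights \<open>e\<^sup>-\<^sup>\<psi>\<^sup>/\<^sup>\<tau>\<close>; convexity of \<open>F\<close> gives the error terms the right sign.
\<close>

section \<open>Calculus of C1 maps and the divergence theorem\<close>

text \<open>The distance may fail to be differentiable, but a field only needs smooth functions
  touching it from above, and on a compact set finitely many are enough. Their minimum would have
  kinks, so it is replaced by D = - \<tau> ln S with S the sum of the weights, and the field is f(D)
  times the weighted mean of the fields \<open>grad F (grad \<psi>)\<close>. Differentiating the
  weights creates terms of order 1/\<tau>; they are not small, and only their sign saves the
  estimate.

  The solution f is a generalised cotangent: it blows up at 0 and reaches 0 where its argument
  equals \<open>pi_p p / (2 * \<kappa>)\<close>. This forces two reserves. The radius R is enlarged
  a little before \<kappa> is chosen, so that f stays positive on the values of D, and fields are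
  built only around compact sets, where the distance has a positive lower bound. Supports of test
  functions are compact and the resulting constant does not depend on the support, so a density
  argument finishes the estimate.

  The perimeter of the Wulff shape is treated in the same spirit: its indicator is replaced by
  cutoffs of a regularised \<open>polar F\<close>.\<close>

lemma Ck1I:
  fixes f :: "real^'n \<Rightarrow> 'b::real_normed_vector"
  assumes "\<And>z. z \<in> U \<Longrightarrow> (f has_derivative f' z) (at z)"
    and "\<And>i. continuous_on U (\<lambda>z. f' z (axis i 1))"
  shows "Ck_on 1 U f"
proof -
  have "f' z = frechet_derivative f (at z)" if "z \<in> U" for z
    using assms(1)[OF that] by (rule frechet_derivative_at)
  moreover have "continuous_on U (\<lambda>z. frechet_derivative f (at z) (axis i 1))
      \<longleftrightarrow> continuous_on U (\<lambda>z. f' z (axis i 1))" for i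
    by (rule continuous_on_cong) (simp_all add: calculation)
  ultimately show ?thesis
    using assms by (auto simp: differentiable_def)
qed

text \<open>\<open>Ck_on\<close> constrains derivatives along the axes only; this expansion
  transfers continuity to every direction.\<close>

lemma linear_axis_expansion:
  fixes L :: "real^'n \<Rightarrow> 'b::real_vector"
  assumes "linear L"
  shows "L h = (\<Sum>i\<in>UNIV. (h $ i) *\<^sub>R L (axis i 1))"
proof -
  have "h = (\<Sum>i\<in>UNIV. (h $ i) *\<^sub>R axis i 1)"
    using basis_expansion[of h] by (simp add: scalar_mult_eq_scaleR)
  then show ?thesis
    using linear_sum[OF assms] linear_cmul[OF assms] by (metis (no_types, lifting) sum.cong)
qed

lemma Ck1D:
  fixes f :: "real^'n \<Rightarrow> 'b::real_normed_vector"
  assumes "Ck_on 1 U f"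
  shows "z \<in> U \<Longrightarrow> (f has_derivative frechet_derivative f (at z)) (at z)"
    and "continuous_on U (\<lambda>z. frechet_derivative f (at z) h)"
    and "continuous_on U f"
proof -
  show *: "(f has_derivative frechet_derivative f (at z)) (at z)" if "z \<in> U" for z
    using assms that frechet_derivative_works by (auto simp: One_nat_def)
  show "continuous_on U f"
    by (meson * continuous_at_imp_continuous_on has_derivative_continuous)
  have "frechet_derivative f (at z) h = (\<Sum>i\<in>UNIV. (h $ i) *\<^sub>R frechet_derivative f (at z) (axis i 1))"
    if "z \<in> U" for z
    by (rule linear_axis_expansion[OF has_derivative_linear[OF *[OF that]]])
  moreover have "continuous_on U (\<lambda>z. \<Sum>i\<in>UNIV. (h $ i) *\<^sub>R frechet_derivative f (at z) (axis i 1))"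
    using assms by (auto simp: One_nat_def intro!: continuous_intros)
  ultimately show "continuous_on U (\<lambda>z. frechet_derivative f (at z) h)"
    by (simp cong: continuous_on_cong)
qed

lemma Ck1_E:
  fixes f :: "real^'n \<Rightarrow> 'b::real_normed_vector"
  assumes "Ck_on 1 U f"
  obtains f' where "\<And>z. z \<in> U \<Longrightarrow> (f has_derivative f' z) (at z)"
    and "\<And>h. continuous_on U (\<lambda>z. f' z h)"
  by (rule that[OF Ck1D(1,2)[OF assms]])

lemma Ck1_subset: "Ck_on 1 U f \<Longrightarrow> V \<subseteq> U \<Longrightarrow> Ck_on 1 V f"
  by (auto simp: One_nat_def intro: continuous_on_subset)

text \<open>Gluing principle: a field that is a product near a compact set and zero off that set is
  C^1, because both conditions hold on open sets that cover the space.\<close>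

lemma Ck1_open_Union:
  assumes "\<And>U. U \<in> \<U> \<Longrightarrow> open U" "\<And>U. U \<in> \<U> \<Longrightarrow> Ck_on 1 U f"
  shows "Ck_on 1 (\<Union>\<U>) f"
  using assms by (auto simp: One_nat_def intro!: continuous_on_open_Union)

lemma Ck1_cong:
  fixes f g :: "real^'n \<Rightarrow> 'b::real_normed_vector"
  assumes "Ck_on 1 U f" "open U" "\<And>z. z \<in> U \<Longrightarrow> f z = g z"
  shows "Ck_on 1 U g"
proof (rule Ck1_E[OF assms(1)])
  fix f' assume f': "\<And>z. z \<in> U \<Longrightarrow> (f has_derivative f' z) (at z)" "\<And>h. continuous_on U (\<lambda>z. f' z h)"
  show ?thesis
    using has_derivative_transform_within_open[OF f'(1) assms(2) _ assms(3)] f'(2)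
    by (intro Ck1I) auto
qed

lemma Ck1_const: "Ck_on 1 U (\<lambda>z. c)"
  by (rule Ck1I[where f' = "\<lambda>_ _. 0"]) auto

lemma Ck1_bounded_linear:
  fixes f :: "real^'n \<Rightarrow> 'b::real_normed_vector"
  assumes "bounded_linear L" "Ck_on 1 U f"
  shows "Ck_on 1 U (\<lambda>z. L (f z))"
proof (rule Ck1_E[OF assms(2)])
  fix f' assume f': "\<And>z. z \<in> U \<Longrightarrow> (f has_derivative f' z) (at z)" "\<And>h. continuous_on U (\<lambda>z. f' z h)"
  show ?thesis
    by (intro Ck1I[where f' = "\<lambda>z h. L (f' z h)"] bounded_linear.has_derivative[OF assms(1)]
        bounded_linear.continuous_on[OF assms(1)] f')
qed

lemma Ck1_ident: "Ck_on 1 U (\<lambda>z. z)"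
  by (rule Ck1I[where f' = "\<lambda>_ h. h"]) auto

lemma Ck1_bilinear:
  fixes f :: "real^'n \<Rightarrow> 'b::real_normed_vector" and g :: "real^'n \<Rightarrow> 'c::real_normed_vector"
  assumes B: "bounded_bilinear B" and "Ck_on 1 U f" "Ck_on 1 U g"
  shows "Ck_on 1 U (\<lambda>z. B (f z) (g z))"
proof (rule Ck1_E[OF assms(2)], rule Ck1_E[OF assms(3)])
  fix f' g' assume f': "\<And>z. z \<in> U \<Longrightarrow> (f has_derivative f' z) (at z)" "\<And>h. continuous_on U (\<lambda>z. f' z h)"
   and g': "\<And>z. z \<in> U \<Longrightarrow> (g has_derivative g' z) (at z)" "\<And>h. continuous_on U (\<lambda>z. g' z h)"
  show ?thesis
    by (rule Ck1I[where f' = "\<lambda>z h. B (f z) (g' z h) + B (f' z h) (g z)"])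
      (intro continuous_intros bounded_bilinear.FDERIV[OF B] bounded_bilinear.continuous_on[OF B]
       f' g' Ck1D(3)[OF assms(2)] Ck1D(3)[OF assms(3)]; assumption)+
qed

lemmas Ck1_scaleR = Ck1_bilinear[OF bounded_bilinear_scaleR]
lemmas Ck1_mult = Ck1_bilinear[OF bounded_bilinear_mult]
lemmas Ck1_inner = Ck1_bilinear[OF bounded_bilinear_inner]

lemma Ck1_add:
  fixes f g :: "real^'n \<Rightarrow> 'b::real_normed_vector"
  assumes "Ck_on 1 U f" "Ck_on 1 U g"
  shows "Ck_on 1 U (\<lambda>z. f z + g z)"
proof (rule Ck1_E[OF assms(1)], rule Ck1_E[OF assms(2)])
  fix f' g' assume f': "\<And>z. z \<in> U \<Longrightarrow> (f has_derivative f' z) (at z)" "\<And>h. continuous_on U (\<lambda>z. f' z h)"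
   and g': "\<And>z. z \<in> U \<Longrightarrow> (g has_derivative g' z) (at z)" "\<And>h. continuous_on U (\<lambda>z. g' z h)"
  show ?thesis
    by (rule Ck1I[where f' = "\<lambda>z h. f' z h + g' z h"])
      (intro continuous_intros derivative_intros f' g'; assumption)+
qed

lemma Ck1_sum:
  fixes f :: "'k \<Rightarrow> real^'n \<Rightarrow> 'b::real_normed_vector"
  assumes "\<And>k. k \<in> A \<Longrightarrow> Ck_on 1 U (f k)"
  shows "Ck_on 1 U (\<lambda>z. \<Sum>k\<in>A. f k z)"
  using assms by (induction A rule: infinite_finite_induct) (auto intro: Ck1_const Ck1_add simp del: Ck_on.simps One_nat_def)

lemma Ck1_minus:
  fixes f :: "real^'n \<Rightarrow> 'b::real_normed_vector"
  assumes "Ck_on 1 U f"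
  shows "Ck_on 1 U (\<lambda>z. - f z)"
  using Ck1_bounded_linear[OF bounded_linear_minus[OF bounded_linear_ident] assms] .

lemma Ck1_diff:
  fixes f g :: "real^'n \<Rightarrow> 'b::real_normed_vector"
  assumes "Ck_on 1 U f" "Ck_on 1 U g"
  shows "Ck_on 1 U (\<lambda>z. f z - g z)"
  using Ck1_add[OF assms(1) Ck1_minus[OF assms(2)]] by simp

lemma Ck1_real_comp:
  fixes f :: "real^'n \<Rightarrow> real" and q :: "real \<Rightarrow> real"
  assumes "Ck_on 1 U f" "\<And>z. z \<in> U \<Longrightarrow> f z \<in> T"
    "\<And>s. s \<in> T \<Longrightarrow> (q has_real_derivative q' s) (at s)" "continuous_on T q'"
  shows "Ck_on 1 U (\<lambda>z. q (f z))"
proof (rule Ck1_E[OF assms(1)])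
  fix f' assume f': "\<And>z. z \<in> U \<Longrightarrow> (f has_derivative f' z) (at z)" "\<And>h. continuous_on U (\<lambda>z. f' z h)"
  have "((\<lambda>z. q (f z)) has_derivative (\<lambda>h. q' (f z) * f' z h)) (at z)" if "z \<in> U" for z
    using has_derivative_compose[OF f'(1)[OF that], of q "\<lambda>h. q' (f z) * h"] assms(2,3) that
    by (auto simp: has_field_derivative_def)
  moreover have "continuous_on U (\<lambda>z. q' (f z))"
    using assms(2) by (intro continuous_on_compose2[OF assms(4) Ck1D(3)[OF assms(1)]]) auto
  ultimately show ?thesis
    using f' by (intro Ck1I[where f' = "\<lambda>z h. q' (f z) * f' z h"] continuous_intros) auto
qed

lemma Ck1_comp:
  fixes f :: "real^'n \<Rightarrow> real^'m" and g :: "real^'m \<Rightarrow> 'b::real_normed_vector"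
  assumes "Ck_on 1 U f" "Ck_on 1 T g" "\<And>z. z \<in> U \<Longrightarrow> f z \<in> T"
  shows "Ck_on 1 U (\<lambda>z. g (f z))"
proof (rule Ck1_E[OF assms(1)], rule Ck1_E[OF assms(2)])
  fix f' g' assume f': "\<And>z. z \<in> U \<Longrightarrow> (f has_derivative f' z) (at z)" "\<And>h. continuous_on U (\<lambda>z. f' z h)"
   and g': "\<And>z. z \<in> T \<Longrightarrow> (g has_derivative g' z) (at z)" "\<And>h. continuous_on T (\<lambda>z. g' z h)"
  have d: "((\<lambda>z. g (f z)) has_derivative (\<lambda>h. g' (f z) (f' z h))) (at z)" if "z \<in> U" for z
    using has_derivative_compose[OF f'(1)[OF that], of g "g' (f z)"] g' assms(3) that by auto
  have e: "g' (f z) v = (\<Sum>i\<in>UNIV. (v $ i) *\<^sub>R g' (f z) (axis i 1))" if "z \<in> U" for z v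
    using g'(1) assms(3) that has_derivative_linear by (blast intro: linear_axis_expansion)
  have "continuous_on U (\<lambda>z. g' (f z) h)" for h
    by (rule continuous_on_compose2[OF g'(2) Ck1D(3)[OF assms(1)]]) (use assms(3) in auto)
  then have "continuous_on U (\<lambda>z. \<Sum>i\<in>UNIV. (f' z h $ i) *\<^sub>R g' (f z) (axis i 1))" for h
    using f' by (intro continuous_intros) auto
  then have "continuous_on U (\<lambda>z. g' (f z) (f' z h))" for h
    using e by (simp cong: continuous_on_cong)
  then show ?thesis
    using d by (intro Ck1I[where f' = "\<lambda>z h. g' (f z) (f' z h)"])
qed

section \<open>Gradients and divergences\<close>

lemma grad_derivative:
  fixes f :: "real^'n \<Rightarrow> real"
  assumes "f differentiable (at x)"
  shows "(f has_derivative (\<lambda>h. grad f x \<bullet> h)) (at x)"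
proof -
  have D: "(f has_derivative frechet_derivative f (at x)) (at x)"
    using assms frechet_derivative_works by blast
  have "frechet_derivative f (at x) h = grad f x \<bullet> h" for h
    using linear_axis_expansion[OF has_derivative_linear[OF D], of h]
    by (simp add: inner_vec_def grad_def mult.commute)
  then have "frechet_derivative f (at x) = (\<lambda>h. grad f x \<bullet> h)" by auto
  then show ?thesis using D by simp
qed

lemma grad_eq:
  fixes f :: "real^'n \<Rightarrow> real"
  assumes "(f has_derivative (\<lambda>h. g \<bullet> h)) (at x)"
  shows "grad f x = g"
  using frechet_derivative_at[OF assms, symmetric]
  by (simp add: grad_def vec_eq_iff inner_axis)

lemma divergence_eq:
  assumes "(\<sigma> has_derivative \<sigma>') (at x)"
  shows "divergence \<sigma> x = (\<Sum>i\<in>UNIV. \<sigma>' (axis i 1) $ i)"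
  using frechet_derivative_at[OF assms, symmetric]
  by (simp add: divergence_def jacobian_mat_def trace_def matrix_def)

lemma divergence_scaleR:
  fixes a :: "real^'n \<Rightarrow> real" and X :: "real^'n \<Rightarrow> real^'n"
  assumes "(a has_derivative (\<lambda>h. P \<bullet> h)) (at z)" "X differentiable (at z)"
  shows "divergence (\<lambda>z. a z *\<^sub>R X z) z = P \<bullet> X z + a z * divergence X z"
proof -
  obtain X' where X': "(X has_derivative X') (at z)"
    using assms(2) by (auto simp: differentiable_def)
  have "((\<lambda>z. a z *\<^sub>R X z) has_derivative (\<lambda>h. a z *\<^sub>R X' h + (P \<bullet> h) *\<^sub>R X z)) (at z)"
    by (rule has_derivative_scaleR[OF assms(1) X'])
  from divergence_eq[OF this] show ?thesis
    by (simp add: divergence_eq[OF X'] inner_axis sum.distrib sum_distrib_left inner_vec_def[of P "X z"])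
qed

lemma divergence_sum:
  fixes X :: "'k \<Rightarrow> real^'n \<Rightarrow> real^'n"
  assumes "\<And>k. k \<in> A \<Longrightarrow> X k differentiable (at z)"
  shows "divergence (\<lambda>z. \<Sum>k\<in>A. X k z) z = (\<Sum>k\<in>A. divergence (X k) z)"
proof -
  have "(X k has_derivative frechet_derivative (X k) (at z)) (at z)" if "k \<in> A" for k
    using assms[OF that] frechet_derivative_works by blast
  note X' = this
  have "((\<lambda>z. \<Sum>k\<in>A. X k z) has_derivative (\<lambda>h. \<Sum>k\<in>A. frechet_derivative (X k) (at z) h)) (at z)"
    by (rule has_derivative_sum[OF X'])
  from divergence_eq[OF this] show ?thesis
    by (simp add: divergence_eq[OF X'] sum.swap[of _ A])
qed

lemma continuous_on_divergence:
  assumes "Ck_on 1 U \<sigma>"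
  shows "continuous_on U (divergence \<sigma>)"
proof -
  have "continuous_on U (\<lambda>z. \<Sum>i\<in>UNIV. frechet_derivative \<sigma> (at z) (axis i 1) $ i)"
    by (intro continuous_intros Ck1D(2)[OF assms])
  moreover have "divergence \<sigma> z = (\<Sum>i\<in>UNIV. frechet_derivative \<sigma> (at z) (axis i 1) $ i)" if "z \<in> U" for z
    using divergence_eq[OF Ck1D(1)[OF assms that]] .
  ultimately show ?thesis by (simp cong: continuous_on_cong)
qed

lemma continuous_on_grad:
  assumes "Ck_on 1 U f"
  shows "continuous_on U (grad f)"
  unfolding grad_def
  by (intro continuous_on_vec_lambda Ck1D(2)[OF assms])

lemma Ck1_differentiable: "Ck_on 1 U f \<Longrightarrow> z \<in> U \<Longrightarrow> f differentiable (at z)"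
  by (auto simp: One_nat_def)

section \<open>Integrals of compactly supported functions\<close>

lemma bounded_vanishing_outside:
  fixes f :: "real^'n \<Rightarrow> 'b::real_normed_vector"
  assumes "continuous_on UNIV f" "\<And>x. norm x \<ge> r \<Longrightarrow> f x = 0"
  obtains B where "B \<ge> 0" "\<And>x. norm (f x) \<le> B"
proof -
  have "compact (f ` cball 0 r)"
    by (intro compact_continuous_image continuous_on_subset[OF assms(1)]) auto
  then obtain B where B: "\<And>x. norm x \<le> r \<Longrightarrow> norm (f x) \<le> B"
    by (force dest!: compact_imp_bounded simp: bounded_iff)
  have "norm (f x) \<le> max B 0" for x
    using B[of x] assms(2)[of x] by (cases "norm x \<le> r") auto
  then show ?thesis using that[of "max B 0"] by auto
qed

lemma integrable_vanishing_outside: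
  fixes f :: "real^'n \<Rightarrow> 'b::euclidean_space"
  assumes "continuous_on UNIV f" "\<And>x. norm x \<ge> r \<Longrightarrow> f x = 0"
  shows "integrable lborel f"
proof -
  obtain B where B: "\<And>x. norm (f x) \<le> B"
    using bounded_vanishing_outside[OF assms] by metis
  have "integrable lborel (\<lambda>x. indicator (cball 0 r) x *\<^sub>R f x)"
    by (intro borel_integrable_compact continuous_on_subset[OF assms(1)]) auto
  moreover have "indicator (cball 0 r) x *\<^sub>R f x = f x" for x
    using assms(2)[of x] by (auto simp: indicator_def)
  ultimately show ?thesis by simp
qed

text \<open>By translation invariance every difference quotient of \<open>f\<close> has integral
  zero; dominated convergence passes this on to the derivative.\<close>

lemma partial_derivative_integral_zero:
  fixes f :: "real^'n \<Rightarrow> real"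
  assumes "\<And>z. (f has_derivative f' z) (at z)" "continuous_on UNIV (\<lambda>z. f' z e)" and norm_e: "norm e = 1"
    and supp: "\<And>x. norm x \<ge> r \<Longrightarrow> f x = 0"
  shows "has_bochner_integral lborel (\<lambda>z. f' z e) 0"
proof -
  have cf: "continuous_on UNIV f"
    by (meson assms(1) continuous_at_imp_continuous_on has_derivative_continuous)
  define h where "h m = 1 / real (Suc m)" for m
  have h: "0 < h m" "h m \<le> 1" for m by (auto simp: h_def field_simps)
  have h0: "h \<longlonglongrightarrow> 0" unfolding h_def by real_asymp
  define q where "q m x = (f (x + h m *\<^sub>R e) - f x) / h m" for m x
  have zero: "f' z e = 0" if "norm z > r" for z
  proof -
    have "((\<lambda>_. 0) has_derivative f' z) (at z)"
      by (rule has_derivative_transform_within_open[OF assms(1), where s = "- cball 0 r"])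
        (use that supp in auto)
    then have "f' z = (\<lambda>_. 0)"
      using has_derivative_unique has_derivative_const by blast
    then show ?thesis by simp
  qed
  have "\<And>z. norm z \<ge> r + 1 \<Longrightarrow> f' z e = 0" using zero by simp
  then obtain B where B: "B \<ge> 0" "\<And>z. norm (f' z e) \<le> B"
    using bounded_vanishing_outside[OF assms(2)] by metis
  have D: "((\<lambda>t. f (x + t *\<^sub>R e)) has_real_derivative f' (x + t *\<^sub>R e) e) (at t)" for x t
  proof -
    have "((\<lambda>t. x + t *\<^sub>R e) has_derivative (\<lambda>s. s *\<^sub>R e)) (at t)"
      by (auto intro!: derivative_eq_intros)
    from has_derivative_compose[OF this assms(1)]
    have "((\<lambda>t. f (x + t *\<^sub>R e)) has_derivative (\<lambda>s. f' (x + t *\<^sub>R e) (s *\<^sub>R e))) (at t)" .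
    moreover have "f' (x + t *\<^sub>R e) (s *\<^sub>R e) = f' (x + t *\<^sub>R e) e * s" for s
      using linear_cmul[OF has_derivative_linear[OF assms(1)]] by simp
    ultimately show ?thesis by (simp add: has_field_derivative_def)
  qed
  \<comment> \<open>The steps are at most 1, so a point beyond radius \<open>r + 1\<close> stays
    beyond \<open>r\<close> after the shift. Hence one indicator dominates all quotients, with the
    mean value theorem giving the bound inside.\<close>
  have qB: "norm (q m x) \<le> B * indicator (cball 0 (r + 1)) x" for m x
  proof (cases "norm x \<le> r + 1")
    case True
    obtain t where "0 < t" "t < h m" "f (x + h m *\<^sub>R e) - f (x + 0 *\<^sub>R e) = (h m - 0) * f' (x + t *\<^sub>R e) e"
      using MVT2[OF h(1) D] by blast
    then have "q m x = f' (x + t *\<^sub>R e) e"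
      using h(1)[of m] by (simp add: q_def field_simps)
    then show ?thesis using True B by simp
  next
    case False
    have "norm x \<le> norm (x + h m *\<^sub>R e) + norm (h m *\<^sub>R e)"
      using norm_triangle_ineq4[of "x + h m *\<^sub>R e" "h m *\<^sub>R e"] by simp
    then have "norm (x + h m *\<^sub>R e) \<ge> r"
      using False h[of m] norm_e by simp
    then show ?thesis using False supp by (simp add: q_def)
  qed
  have q_int: "integral\<^sup>L lborel (q m) = 0" for m
  proof -
    have fi: "integrable lborel f" by (rule integrable_vanishing_outside[OF cf supp])
    have fi2: "integrable lborel (\<lambda>x. f (h m *\<^sub>R e + x))"
      using integrable_distr_eq[of "(+) (h m *\<^sub>R e)" lborel borel f] fi lborel_distr_plus[of "h m *\<^sub>R e"]
        borel_measurable_continuous_onI[OF cf] by auto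
    have "integral\<^sup>L lborel (\<lambda>x. f (h m *\<^sub>R e + x)) = integral\<^sup>L lborel f"
      using integral_distr[of "(+) (h m *\<^sub>R e)" lborel borel f] lborel_distr_plus[of "h m *\<^sub>R e"]
        borel_measurable_continuous_onI[OF cf] by auto
    then show ?thesis
      using fi fi2 by (simp add: q_def[abs_def] add.commute)
  qed
  have lim: "(\<lambda>m. q m x) \<longlonglongrightarrow> f' x e" for x
  proof -
    have "((\<lambda>t. (f (x + t *\<^sub>R e) - f x) / t) \<longlongrightarrow> f' x e) (at 0)"
      using D[of x 0] by (simp add: DERIV_def)
    moreover have "filterlim h (at 0) sequentially"
      using h0 h by (auto simp: filterlim_at intro!: always_eventually) (metis less_irrefl)
    ultimately show ?thesis
      unfolding q_def by (rule filterlim_compose)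
  qed
  have meas: "(\<lambda>z. f' z e) \<in> borel_measurable lborel" "q m \<in> borel_measurable lborel" for m
  proof -
    show "(\<lambda>z. f' z e) \<in> borel_measurable lborel"
      using borel_measurable_continuous_onI[OF assms(2)] by simp
    have "continuous_on UNIV (q m)"
      unfolding q_def using h(1)[of m]
      by (intro continuous_intros continuous_on_compose2[OF cf]) auto
    then show "q m \<in> borel_measurable lborel"
      using borel_measurable_continuous_onI by simp
  qed
  have w: "integrable lborel (\<lambda>x::real^'n. B * indicator (cball 0 (r + 1)) x)"
    using emeasure_bounded_finite[of "cball (0::real^'n) (r + 1)"]
    by (intro integrable_mult_right integrable_real_indicator) auto
  have "integrable lborel (\<lambda>z. f' z e)"
    by (rule integrable_dominated_convergence[where s = q, OF meas(1) meas(2) w]) (use lim qB in auto)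
  moreover have "(\<lambda>m. integral\<^sup>L lborel (q m)) \<longlonglongrightarrow> integral\<^sup>L lborel (\<lambda>z. f' z e)"
    by (rule integral_dominated_convergence[where s = q, OF meas(1) meas(2) w]) (use lim qB in auto)
  ultimately show ?thesis
    using q_int LIMSEQ_unique[of "\<lambda>_. 0"] by (auto simp: has_bochner_integral_iff)
qed

lemma divergence_integral_zero:
  fixes Y :: "real^'n \<Rightarrow> real^'n"
  assumes "Ck_on 1 UNIV Y" and "\<And>x. norm x \<ge> r \<Longrightarrow> Y x = 0"
  shows "has_bochner_integral lborel (divergence Y) 0"
proof (rule Ck1_E[OF assms(1)])
  fix Y' assume Y': "\<And>z. z \<in> UNIV \<Longrightarrow> (Y has_derivative Y' z) (at z)"
    "\<And>h. continuous_on UNIV (\<lambda>z. Y' z h)"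
  have "has_bochner_integral lborel (\<lambda>z. Y' z (axis i 1) $ i) 0" for i
    by (rule partial_derivative_integral_zero[where f = "\<lambda>z. Y z $ i" and f' = "\<lambda>z h. Y' z h $ i" and r = r])
      (use Y' assms(2) in \<open>auto intro!: continuous_intros bounded_linear.has_derivative[OF bounded_linear_vec_nth]\<close>)
  then have "has_bochner_integral lborel (\<lambda>z. \<Sum>i\<in>UNIV. Y' z (axis i 1) $ i) (\<Sum>i\<in>(UNIV::'n set). 0)"
    by (intro has_bochner_integral_sum) auto
  moreover have "divergence Y = (\<lambda>z. \<Sum>i\<in>UNIV. Y' z (axis i 1) $ i)"
    using divergence_eq[OF Y'(1)] by auto
  ultimately show ?thesis by simp
qed

text \<open>It is enough that one factor vanishes far out, so \<open>X\<close> may be a position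
  field, as in the estimate for the Wulff shape.\<close>

lemma divergence_product_integral_zero:
  fixes g :: "real^'n \<Rightarrow> real" and X :: "real^'n \<Rightarrow> real^'n"
  assumes "Ck_on 1 UNIV g" "Ck_on 1 UNIV X" and "\<And>x. norm x \<ge> r \<Longrightarrow> g x = 0 \<or> X x = 0"
  shows "has_bochner_integral lborel (\<lambda>x. grad g x \<bullet> X x + g x * divergence X x) 0"
proof -
  have "divergence (\<lambda>x. g x *\<^sub>R X x) = (\<lambda>x. grad g x \<bullet> X x + g x * divergence X x)"
    by (intro ext divergence_scaleR grad_derivative Ck1_differentiable[OF assms(1)]
        Ck1_differentiable[OF assms(2)] UNIV_I)
  then show ?thesis
    using divergence_integral_zero[of "\<lambda>x. g x *\<^sub>R X x" r] Ck1_scaleR[OF assms(1,2)] assms(3) by auto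
qed

section \<open>The norm and its polar\<close>

lemma Ck1_vecI:
  fixes f :: "real^'n \<Rightarrow> real^'m"
  assumes "\<And>i. Ck_on 1 U (\<lambda>z. f z $ i)"
  shows "Ck_on 1 U f"
proof -
  have "Ck_on 1 U (\<lambda>z. \<Sum>i\<in>UNIV. (f z $ i) *\<^sub>R axis i (1::real))"
    by (intro Ck1_sum Ck1_scaleR Ck1_const assms)
  moreover have "(\<Sum>i\<in>UNIV. (f z $ i) *\<^sub>R axis i 1) = f z" for z
    using basis_expansion[of "f z"] by (simp add: scalar_mult_eq_scaleR)
  ultimately show ?thesis by simp
qed

text \<open>The second partial derivatives of \<open>f\<close> are still differentiable under this
  hypothesis, hence continuous.\<close>

lemma Ck_Holder_on_3_imp_Ck1_grad:
  fixes f :: "real^'n \<Rightarrow> real"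
  assumes "Ck_Holder_on 3 \<beta> S f"
  shows "Ck_on 1 S (grad f)"
proof (rule Ck1_vecI)
  fix i
  have "Ck_on 1 S (\<lambda>x. frechet_derivative f (at x) (axis i 1))"
    using assms by (auto simp: numeral_3_eq_3 One_nat_def
        intro!: continuous_at_imp_continuous_on differentiable_imp_continuous_within)
  then show "Ck_on 1 S (\<lambda>x. grad f x $ i)"
    by (simp add: grad_def)
qed

locale C2_norm =
  fixes F :: "real^'n \<Rightarrow> real" and a :: real
  assumes convex: "convex_on UNIV F"
    and hom: "F (t *\<^sub>R \<xi>) = \<bar>t\<bar> * F \<xi>"
    and a_pos: "0 < a" and lower: "a * norm \<xi> \<le> F \<xi>"
    and diff: "\<xi> \<noteq> 0 \<Longrightarrow> F differentiable (at \<xi>)"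
    and C2: "Ck_on 1 (-{0}) (grad F)"
begin

lemma F_zero: "F 0 = 0"
  using hom[of 0 0] by simp

lemma F_minus: "F (- \<xi>) = F \<xi>"
  using hom[of "-1" \<xi>] by simp

lemma F_nonneg: "0 \<le> F \<xi>"
  using lower[of \<xi>] a_pos by (meson mult_nonneg_nonneg norm_ge_zero order_less_imp_le order_trans)

lemma F_pos: "\<xi> \<noteq> 0 \<Longrightarrow> 0 < F \<xi>"
  using lower[of \<xi>] a_pos by (meson mult_pos_pos order_less_le_trans zero_less_norm_iff)

lemma F_triangle: "F (\<xi> + \<eta>) \<le> F \<xi> + F \<eta>"
proof -
  have "F ((1 - 1/2) *\<^sub>R (2 *\<^sub>R \<xi>) + (1/2) *\<^sub>R (2 *\<^sub>R \<eta>)) \<le> (1 - 1/2) * F (2 *\<^sub>R \<xi>) + 1/2 * F (2 *\<^sub>R \<eta>)"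
    by (rule convex_onD[OF convex]) auto
  then show ?thesis using hom[of 2] by simp
qed

text \<open>A crude bound for \<open>F\<close> on the Euclidean unit sphere, serving as Lipschitz
  constant; the summand 1 makes positivity immediate.\<close>

definition bnd :: real where "bnd = (\<Sum>i\<in>UNIV. F (axis i 1)) + 1"

lemma bnd_pos: "0 < bnd"
  unfolding bnd_def using F_nonneg by (simp add: add_nonneg_pos sum_nonneg)

lemma F_sum_le: "F (\<Sum>i\<in>A. f i) \<le> (\<Sum>i\<in>A. F (f i))"
  by (induction A rule: infinite_finite_induct)
    (auto simp: F_zero intro: order_trans[OF F_triangle add_left_mono])

lemma upper: "F \<xi> \<le> bnd * norm \<xi>"
proof -
  have "F \<xi> = F (\<Sum>i\<in>UNIV. (\<xi> $ i) *\<^sub>R axis i 1)"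
    using basis_expansion[of \<xi>] by (simp add: scalar_mult_eq_scaleR)
  also have "\<dots> \<le> (\<Sum>i\<in>UNIV. \<bar>\<xi> $ i\<bar> * F (axis i 1))"
    using F_sum_le[of "\<lambda>i. (\<xi> $ i) *\<^sub>R axis i 1" UNIV] by (simp add: hom)
  also have "\<dots> \<le> (\<Sum>i\<in>UNIV. norm \<xi> * F (axis i 1))"
    by (intro sum_mono mult_right_mono component_le_norm_cart F_nonneg)
  also have "\<dots> \<le> bnd * norm \<xi>"
    by (simp add: bnd_def sum_distrib_left[symmetric] algebra_simps)
  finally show ?thesis .
qed

lemma F_diff_le: "\<bar>F \<xi> - F \<eta>\<bar> \<le> bnd * norm (\<xi> - \<eta>)"
proof -
  have "F \<xi> \<le> F (\<xi> - \<eta>) + F \<eta>" "F \<eta> \<le> F (\<eta> - \<xi>) + F \<xi>"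
    using F_triangle[of "\<xi> - \<eta>" \<eta>] F_triangle[of "\<eta> - \<xi>" \<xi>] by auto
  moreover have "F (\<eta> - \<xi>) = F (\<xi> - \<eta>)" using F_minus[of "\<xi> - \<eta>"] by simp
  ultimately show ?thesis using upper[of "\<xi> - \<eta>"] by linarith
qed

lemma F_continuous: "continuous_on A F"
proof -
  have "lipschitz_on bnd UNIV F"
    using F_diff_le bnd_pos by (auto simp: lipschitz_on_def dist_norm)
  then show ?thesis
    using lipschitz_on_continuous_on continuous_on_subset by blast
qed

lemma grad_F_derivative: "\<xi> \<noteq> 0 \<Longrightarrow> (F has_derivative (\<lambda>h. grad F \<xi> \<bullet> h)) (at \<xi>)"
  by (intro grad_derivative diff)

lemma F_line_DERIV:
  assumes "\<xi> + t *\<^sub>R \<eta> \<noteq> 0"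
  shows "((\<lambda>s. F (\<xi> + s *\<^sub>R \<eta>)) has_real_derivative grad F (\<xi> + t *\<^sub>R \<eta>) \<bullet> \<eta>) (at t)"
proof -
  have "((\<lambda>t. \<xi> + t *\<^sub>R \<eta>) has_derivative (\<lambda>s. s *\<^sub>R \<eta>)) (at t)"
    by (auto intro!: derivative_eq_intros)
  from has_derivative_compose[OF this grad_F_derivative[OF assms]] show ?thesis
    by (simp add: has_field_derivative_def mult.commute[of _ "grad F _ \<bullet> _"])
qed

text \<open>Subadditivity bounds each difference quotient in the direction \<open>\<eta>\<close> by
  \<open>F \<eta>\<close>. Equivalently, gradients of \<open>F\<close> lie in the polar unit ball,
  which drives both the duality and the gluing.\<close>

lemma grad_F_le: "\<xi> \<noteq> 0 \<Longrightarrow> grad F \<xi> \<bullet> \<eta> \<le> F \<eta>"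
proof -
  assume "\<xi> \<noteq> 0"
  then have "((\<lambda>s. F (\<xi> + s *\<^sub>R \<eta>)) has_real_derivative grad F \<xi> \<bullet> \<eta>) (at 0)"
    using F_line_DERIV[of \<xi> 0 \<eta>] by simp
  then have "((\<lambda>s. (F (\<xi> + s *\<^sub>R \<eta>) - F \<xi>) / s) \<longlongrightarrow> grad F \<xi> \<bullet> \<eta>) (at_right 0)"
    by (auto simp: DERIV_def intro: tendsto_mono[OF at_le])
  moreover have "\<forall>\<^sub>F s in at_right 0. (F (\<xi> + s *\<^sub>R \<eta>) - F \<xi>) / s \<le> F \<eta>"
  proof (rule eventually_at_rightI[of 0 1])
    fix s :: real assume "s \<in> {0<..<1}"
    then show "(F (\<xi> + s *\<^sub>R \<eta>) - F \<xi>) / s \<le> F \<eta>"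
      using F_triangle[of \<xi> "s *\<^sub>R \<eta>"] by (simp add: hom field_simps)
  qed simp
  ultimately show ?thesis
    by (rule tendsto_upperbound) simp
qed

lemma grad_F_abs_le: "\<xi> \<noteq> 0 \<Longrightarrow> \<bar>grad F \<xi> \<bullet> \<eta>\<bar> \<le> F \<eta>"
  using grad_F_le[of \<xi> \<eta>] grad_F_le[of \<xi> "- \<eta>"] by (simp add: F_minus abs_le_iff)

text \<open>Since \<open>F\<close> is even, negative factors are allowed; this relates the outer
  normal to the gradient of a function that is positive inside the domain.\<close>

lemma grad_F_scale: "c \<noteq> 0 \<Longrightarrow> \<xi> \<noteq> 0 \<Longrightarrow> grad F (c *\<^sub>R \<xi>) = sgn c *\<^sub>R grad F \<xi>"
proof -
  assume c: "c \<noteq> 0" and \<xi>: "\<xi> \<noteq> 0"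
  have "((\<lambda>z. F (c *\<^sub>R z)) has_derivative (\<lambda>h. grad F (c *\<^sub>R \<xi>) \<bullet> (c *\<^sub>R h))) (at \<xi>)"
    by (rule has_derivative_compose[where g = F, OF _ grad_F_derivative]) (use c \<xi> in \<open>auto intro!: derivative_eq_intros\<close>)
  then have "((\<lambda>z. \<bar>c\<bar> * F z) has_derivative (\<lambda>h. (c *\<^sub>R grad F (c *\<^sub>R \<xi>)) \<bullet> h)) (at \<xi>)"
    by (simp add: hom)
  moreover have "((\<lambda>z. \<bar>c\<bar> * F z) has_derivative (\<lambda>h. (\<bar>c\<bar> *\<^sub>R grad F \<xi>) \<bullet> h)) (at \<xi>)"
    using has_derivative_mult_right[OF grad_F_derivative[OF \<xi>], of "\<bar>c\<bar>"] by simp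
  ultimately have "c *\<^sub>R grad F (c *\<^sub>R \<xi>) = \<bar>c\<bar> *\<^sub>R grad F \<xi>"
    using grad_eq by metis
  then have "(1 / c) *\<^sub>R (c *\<^sub>R grad F (c *\<^sub>R \<xi>)) = (1 / c) *\<^sub>R (\<bar>c\<bar> *\<^sub>R grad F \<xi>)" by simp
  moreover have "(1/c) * \<bar>c\<bar> = sgn c" using c by (auto simp: sgn_if)
  ultimately show ?thesis using c by simp
qed

lemma grad_F_self: "\<xi> \<noteq> 0 \<Longrightarrow> grad F \<xi> \<bullet> \<xi> = F \<xi>"
proof -
  assume \<xi>: "\<xi> \<noteq> 0"
  then have 1: "((\<lambda>s. F (\<xi> + s *\<^sub>R \<xi>)) has_real_derivative grad F \<xi> \<bullet> \<xi>) (at 0)"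
    using F_line_DERIV[of \<xi> 0 \<xi>] by simp
  have "((\<lambda>s. (1 + s) * F \<xi>) has_real_derivative F \<xi>) (at 0)"
    by (auto intro!: derivative_eq_intros)
  then have "((\<lambda>s. F (\<xi> + s *\<^sub>R \<xi>)) has_real_derivative F \<xi>) (at 0)"
  proof (rule has_field_derivative_transform_within_open[where S = "{-1<..}"])
    fix s :: real assume "s \<in> {-1<..}"
    moreover have "\<xi> + s *\<^sub>R \<xi> = (1 + s) *\<^sub>R \<xi>" by (simp add: scaleR_add_left)
    ultimately show "(1 + s) * F \<xi> = F (\<xi> + s *\<^sub>R \<xi>)" using hom[of "1 + s" \<xi>] by simp
  qed auto
  with 1 show ?thesis using DERIV_unique by blast
qed

text \<open>Differentiate Euler's identity \<open>grad F \<xi> \<bullet> \<xi> = F \<xi>\<close>: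
  the terms \<open>grad F \<xi> \<bullet> w\<close> cancel and leave
  \<open>H w \<bullet> \<xi>\<close>.\<close>

lemma hessian_F_radial:
  assumes \<xi>: "\<xi> \<noteq> 0" and H: "(grad F has_derivative H) (at \<xi>)"
  shows "\<xi> \<bullet> H w = 0"
proof -
  have "((\<lambda>z. grad F z \<bullet> z) has_derivative (\<lambda>h. grad F \<xi> \<bullet> h + H h \<bullet> \<xi>)) (at \<xi>)"
    by (rule has_derivative_inner[OF H has_derivative_ident])
  then have "(F has_derivative (\<lambda>h. grad F \<xi> \<bullet> h + H h \<bullet> \<xi>)) (at \<xi>)"
    by (rule has_derivative_transform_within_open[where s = "-{0}"]) (use \<xi> grad_F_self in auto)
  then have "(\<lambda>h. grad F \<xi> \<bullet> h + H h \<bullet> \<xi>) = (\<lambda>h. grad F \<xi> \<bullet> h)"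
    using has_derivative_unique grad_F_derivative[OF \<xi>] by blast
  then have "grad F \<xi> \<bullet> w + H w \<bullet> \<xi> = grad F \<xi> \<bullet> w" by metis
  then show ?thesis by (simp add: inner_commute)
qed

section \<open>The polar norm\<close>

lemma inner_le_norm_F: "\<xi> \<bullet> v \<le> norm v / a * F \<xi>"
proof -
  have "a * (\<xi> \<bullet> v) \<le> a * (norm \<xi> * norm v)"
    using a_pos by (simp add: norm_cauchy_schwarz)
  also have "\<dots> \<le> F \<xi> * norm v"
    using lower[of \<xi>] by (simp add: mult_right_mono mult.assoc[symmetric])
  finally show ?thesis using a_pos by (simp add: field_simps)
qed

text \<open>The real supremum in \<open>polar\<close> has its usual meaning only for a set that is
  bounded above.\<close>

lemma polar_bdd: "bdd_above ((\<lambda>\<xi>. (\<xi> \<bullet> v) / F \<xi>) ` (-{0}))"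
  using inner_le_norm_F F_pos
  by (intro bdd_aboveI2[where M = "norm v / a"]) (simp add: pos_divide_le_eq)

lemma nonzero_nonempty: "-{0::real^'n} \<noteq> {}"
proof -
  obtain i :: 'n where True by simp
  have "axis i (1::real) \<noteq> (0 :: real^'n)" by (simp add: axis_eq_0_iff)
  then show ?thesis by blast
qed

lemma inner_le_polar: "\<xi> \<bullet> v \<le> polar F v * F \<xi>"
proof (cases "\<xi> = 0")
  case False
  then have "\<xi> \<bullet> v / F \<xi> \<le> polar F v"
    unfolding polar_def by (intro cSUP_upper polar_bdd) auto
  then show ?thesis using F_pos[OF False] by (simp add: field_simps)
qed (simp add: F_zero)

lemma polar_le: "(\<And>\<xi>. \<xi> \<noteq> 0 \<Longrightarrow> \<xi> \<bullet> v \<le> t * F \<xi>) \<Longrightarrow> polar F v \<le> t"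
  unfolding polar_def using nonzero_nonempty F_pos by (intro cSUP_least) (auto simp: field_simps)

lemma polar_triangle: "polar F (v + w) \<le> polar F v + polar F w"
  by (rule polar_le) (auto simp: inner_add_right distrib_right intro!: add_mono inner_le_polar)

text \<open>For v \<noteq> 0, test the supremum with \<xi> = v and use the upper bound on
  \<open>F\<close>.\<close>

lemma norm_le_polar: "norm v \<le> bnd * polar F v"
proof (cases "v = 0")
  case False
  have "norm v * norm v \<le> polar F v * F v"
    using inner_le_polar[of v v] by (simp add: dot_square_norm power2_eq_square)
  moreover have "0 \<le> polar F v"
  proof -
    have "0 \<le> norm v * norm v" by simp
    then have "0 \<le> polar F v * F v" using calculation by linarith
    then show ?thesis using F_pos[OF False] by (simp add: zero_le_mult_iff)
  qed
  ultimately have "norm v * norm v \<le> (polar F v * bnd) * norm v"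
    using mult_left_mono[OF upper[of v], of "polar F v"] by (simp add: mult.assoc)
  then show ?thesis using False by (simp add: mult.commute)
next
  case True
  have "axis (undefined::'n) (1::real) \<bullet> v \<le> polar F v * F (axis undefined 1)"
    by (rule inner_le_polar)
  then have "0 \<le> polar F v" using True F_pos[of "axis undefined 1"]
    by (simp add: axis_eq_0_iff zero_le_mult_iff)
  then show ?thesis using True bnd_pos by simp
qed

lemma polar_nonneg: "0 \<le> polar F v"
  using norm_le_polar[of v] bnd_pos by (metis norm_ge_zero order_trans zero_le_mult_iff linorder_not_less)

lemma polar_zero: "polar F 0 = 0"
  using polar_le[of 0 0] polar_nonneg[of 0] by (simp add: antisym)

lemma polar_pos: "v \<noteq> 0 \<Longrightarrow> 0 < polar F v"
  using norm_le_polar[of v] polar_nonneg[of v] by (cases "polar F v = 0") auto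

lemma polar_scale: "polar F (c *\<^sub>R v) = \<bar>c\<bar> * polar F v"
proof -
  have le: "polar F (c *\<^sub>R v) \<le> \<bar>c\<bar> * polar F v" for c v
  proof (rule polar_le)
    fix \<xi> :: "real^'n"
    have "\<xi> \<bullet> (c *\<^sub>R v) = (c *\<^sub>R \<xi>) \<bullet> v" by simp
    also have "\<dots> \<le> polar F v * F (c *\<^sub>R \<xi>)" by (rule inner_le_polar)
    finally show "\<xi> \<bullet> (c *\<^sub>R v) \<le> \<bar>c\<bar> * polar F v * F \<xi>" by (simp add: hom mult_ac)
  qed
  show ?thesis
  proof (cases "c = 0")
    case True then show ?thesis by (simp add: polar_zero)
  next
    case False
    have "polar F v \<le> \<bar>1 / c\<bar> * polar F (c *\<^sub>R v)" using le[of "1/c" "c *\<^sub>R v"] False by simp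
    then have "\<bar>c\<bar> * polar F v \<le> polar F (c *\<^sub>R v)" using False by (simp add: field_simps abs_divide)
    then show ?thesis using le[of c v] by simp
  qed
qed

lemma polar_minus: "polar F (- v) = polar F v"
  using polar_scale[of "-1" v] by simp

lemma polar_minus_commute: "polar F (v - w) = polar F (w - v)"
  using polar_minus[of "v - w"] by simp

lemma polar_le_norm: "polar F v \<le> norm v / a"
  by (intro polar_le inner_le_norm_F)

lemma polar_diff_le: "\<bar>polar F v - polar F w\<bar> \<le> polar F (v - w)"
  using polar_triangle[of "v - w" w] polar_triangle[of "w - v" v] polar_minus_commute[of v w] by auto

lemma polar_continuous: "continuous_on A (polar F)"
proof -
  have "lipschitz_on (1 / a) UNIV (polar F)"
    using order_trans[OF polar_diff_le polar_le_norm] a_pos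
    by (auto simp: lipschitz_on_def dist_norm dist_real_def)
  then show ?thesis
    using lipschitz_on_continuous_on continuous_on_subset by blast
qed

lemma polar_grad_F: "\<xi> \<noteq> 0 \<Longrightarrow> polar F (grad F \<xi>) = 1"
proof (rule antisym)
  assume \<xi>: "\<xi> \<noteq> 0"
  show "polar F (grad F \<xi>) \<le> 1"
    by (rule polar_le) (use grad_F_le[OF \<xi>] in \<open>simp add: inner_commute\<close>)
  show "1 \<le> polar F (grad F \<xi>)"
    using inner_le_polar[of \<xi> "grad F \<xi>"] grad_F_self[OF \<xi>] F_pos[OF \<xi>] by (simp add: inner_commute)
qed

text \<open>The difference of \<open>F\<close> and the linear form given by \<open>v\<close> is
  nonnegative and vanishes at \<open>\<xi>\<close>, so its derivative there is zero in every
  direction.\<close>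

lemma grad_F_unique:
  assumes \<xi>: "\<xi> \<noteq> 0" and "polar F v \<le> 1" "\<xi> \<bullet> v = F \<xi>"
  shows "v = grad F \<xi>"
proof -
  have le: "\<eta> \<bullet> v \<le> F \<eta>" for \<eta>
    using inner_le_polar[of \<eta> v] assms(2) F_nonneg[of \<eta>] by (smt (verit) mult_left_le_one_le mult_right_le_one_le polar_nonneg)
  have "((\<lambda>s. F (\<xi> + s *\<^sub>R \<eta>) - (\<xi> + s *\<^sub>R \<eta>) \<bullet> v) has_real_derivative grad F \<xi> \<bullet> \<eta> - \<eta> \<bullet> v) (at 0)" for \<eta>
    using F_line_DERIV[of \<xi> 0 \<eta>] \<xi> by (auto intro!: derivative_eq_intros simp: inner_add_left)
  then have "grad F \<xi> \<bullet> \<eta> - \<eta> \<bullet> v = 0" for \<eta>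
    by (rule DERIV_local_min[where d = 1]) (use le assms(3) in \<open>auto simp: field_simps\<close>)
  then have "(grad F \<xi> - v) \<bullet> \<eta> = 0" for \<eta> by (simp add: inner_diff_left inner_commute[of v \<eta>])
  from this[of "grad F \<xi> - v"] show ?thesis by simp
qed

end

section \<open>Boundary charts and the anisotropic mean curvature\<close>

text \<open>An abstract form of a boundary graph: \<open>G\<close> is positive inside, and
  \<open>e\<close> is a transversal direction along which it has slope exactly 1. \<open>G\<close>
  is defined and regular on all of space although it describes \<open>\<Omega>\<close> in the ball
  only, so it can be translated freely.\<close>

locale boundary_chart =
  fixes \<Omega> :: "(real^'n) set" and y0 :: "real^'n" and r :: real and G :: "real^'n \<Rightarrow> real" and e :: "real^'n"
  assumes open_dom: "open \<Omega>" and r_pos: "r > 0" and y0: "y0 \<in> frontier \<Omega>"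
    and dom_eq: "\<Omega> \<inter> ball y0 r = {y \<in> ball y0 r. G y > 0}"
    and G_diff: "\<And>y. G differentiable (at y)" and grad_G_C1: "Ck_on 1 UNIV (grad G)"
    and G_shift: "\<And>y t. G (y + t *\<^sub>R e) = G y + t"
begin

lemma G_derivative: "(G has_derivative (\<lambda>h. grad G y \<bullet> h)) (at y)"
  by (intro grad_derivative G_diff)

lemma G_continuous: "continuous_on A G"
  by (meson G_derivative continuous_at_imp_continuous_on has_derivative_continuous)

lemma G_line_DERIV: "((\<lambda>s. G (y + s *\<^sub>R v)) has_real_derivative grad G (y + t *\<^sub>R v) \<bullet> v) (at t)"
proof -
  have "((\<lambda>t. y + t *\<^sub>R v) has_derivative (\<lambda>s. s *\<^sub>R v)) (at t)"
    by (auto intro!: derivative_eq_intros)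
  from has_derivative_compose[OF this G_derivative] show ?thesis
    by (simp add: has_field_derivative_def mult.commute[of _ "grad G _ \<bullet> _"])
qed

lemma grad_G_shift: "grad G y \<bullet> e = 1"
proof -
  have "((\<lambda>s. G y + s) has_real_derivative 1) (at 0)"
    by (auto intro!: derivative_eq_intros)
  then show ?thesis
    using G_line_DERIV[of y e 0] DERIV_unique by (fastforce simp: G_shift)
qed

lemma grad_G_nonzero: "grad G y \<noteq> 0"
  using grad_G_shift[of y] by auto

lemma in_dom_iff: "y \<in> ball y0 r \<Longrightarrow> y \<in> \<Omega> \<longleftrightarrow> G y > 0"
  using dom_eq by blast

text \<open>From a zero of \<open>G\<close>, small steps along \<open>e\<close> make
  \<open>G\<close> positive and so enter the domain, while within the ball the set where
  \<open>G\<close> is negative is open and misses the domain.\<close>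

lemma in_frontier_iff:
  assumes y: "y \<in> ball y0 r"
  shows "y \<in> frontier \<Omega> \<longleftrightarrow> G y = 0"
proof
  assume fr: "y \<in> frontier \<Omega>"
  then have "y \<notin> \<Omega>" using open_dom by (simp add: frontier_def interior_open)
  then have "G y \<le> 0" using in_dom_iff[OF y] by simp
  moreover have "\<not> G y < 0"
  proof
    assume "G y < 0"
    have "open {z \<in> ball y0 r. G z < 0}"
      using open_Collect_less[OF G_continuous continuous_on_const[of UNIV 0]] by (auto simp: Collect_conj_eq open_Int[OF open_ball, unfolded ball_def])
    moreover have "y \<in> {z \<in> ball y0 r. G z < 0}" using y \<open>G y < 0\<close> by simp
    moreover have "y \<in> closure \<Omega>" using fr by (simp add: frontier_def)
    ultimately obtain z where "z \<in> \<Omega>" "z \<in> ball y0 r" "G z < 0"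
      using open_Int_closure_eq_empty by (smt (verit, ccfv_SIG) disjoint_iff mem_Collect_eq)
    then show False using in_dom_iff by auto
  qed
  ultimately show "G y = 0" by simp
next
  assume G0: "G y = 0"
  then have "y \<notin> \<Omega>" using in_dom_iff[OF y] by simp
  moreover have "y \<in> closure \<Omega>"
  proof -
    have "((\<lambda>t. y + t *\<^sub>R e) \<longlongrightarrow> y + 0 *\<^sub>R e) (at_right 0)"
      by (intro tendsto_intros)
    then have lim: "((\<lambda>t. y + t *\<^sub>R e) \<longlongrightarrow> y) (at_right 0)" by simp
    have "\<forall>\<^sub>F t in at_right 0. y + t *\<^sub>R e \<in> ball y0 r"
      using topological_tendstoD[OF lim open_ball y] .
    moreover have "\<forall>\<^sub>F t in at_right (0::real). t > 0"
      by (simp add: eventually_at_right_less)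
    ultimately have "\<forall>\<^sub>F t in at_right 0. y + t *\<^sub>R e \<in> \<Omega>"
      by eventually_elim (simp add: in_dom_iff G_shift G0)
    then show ?thesis
      by (intro Lim_in_closed_set[OF closed_closure _ _ lim])
        (auto elim: eventually_mono intro: closure_subset[THEN subsetD])
  qed
  ultimately show "y \<in> frontier \<Omega>" using open_dom by (simp add: frontier_def interior_open)
qed

lemma closure_dom_nonneg: "y \<in> ball y0 r \<Longrightarrow> y \<in> closure \<Omega> \<Longrightarrow> 0 \<le> G y"
  using in_dom_iff in_frontier_iff open_dom by (fastforce simp: frontier_def interior_open)

lemma frontier_curve:
  assumes y: "y \<in> ball y0 r" and v: "grad G y \<bullet> v = 0" and fr: "y \<in> frontier \<Omega>"
  obtains c where "c 0 = y" "\<And>t. c t \<in> frontier \<Omega>" "(c has_vector_derivative v) (at 0)"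
proof -
  \<comment> \<open>The line in direction \<open>v\<close> is pushed back to the zero set of
    \<open>G\<close> along \<open>e\<close>; the correction has derivative zero at 0 because
    \<open>v\<close> is orthogonal to the gradient.\<close>
  define z where "z t = y + t *\<^sub>R v - G (y + t *\<^sub>R v) *\<^sub>R e" for t
  \<comment> \<open>\<open>tangent_vector\<close> asks for a curve inside the frontier at all times,
    hence the constant value whenever \<open>z t\<close> is outside the chart ball.\<close>
  define c where "c t = (if z t \<in> ball y0 r then z t else y)" for t
  have Gy: "G y = 0" using in_frontier_iff[OF y] fr by simp
  have Gz: "G (z t) = 0" for t
    using G_shift[of "y + t *\<^sub>R v" "- G (y + t *\<^sub>R v)"] by (simp add: z_def)
  have cz: "continuous_on UNIV z"
    unfolding z_def by (intro continuous_intros continuous_on_compose2[OF G_continuous]) auto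
  have op: "open (z -` ball y0 r)" using open_vimage[OF open_ball cz] .
  have z0: "z 0 = y" by (simp add: z_def Gy)
  have "(z has_vector_derivative (v - (grad G y \<bullet> v) *\<^sub>R e)) (at 0)"
    unfolding z_def
    using G_line_DERIV[of y v 0]
    by (auto intro!: derivative_eq_intros simp: has_real_derivative_iff_has_vector_derivative)
  then have "(z has_vector_derivative v) (at 0)" by (simp add: v)
  then have "(c has_vector_derivative v) (at 0)"
    by (rule has_vector_derivative_transform_within_open[OF _ op]) (use y in \<open>auto simp: c_def z0\<close>)
  moreover have "c t \<in> frontier \<Omega>" for t
    using in_frontier_iff Gz fr by (simp add: c_def)
  moreover have "c 0 = y" by (simp add: c_def z0)
  ultimately show ?thesis using that by blast
qed

lemma tangent_vector_iff:
  assumes y: "y \<in> ball y0 r" and fr: "y \<in> frontier \<Omega>"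
  shows "tangent_vector (frontier \<Omega>) y v \<longleftrightarrow> grad G y \<bullet> v = 0"
proof
  assume "tangent_vector (frontier \<Omega>) y v"
  then obtain c where c: "c 0 = y" "\<And>t. c t \<in> frontier \<Omega>" "(c has_vector_derivative v) (at 0)"
    unfolding tangent_vector_def by blast
  have "((\<lambda>t. G (c t)) has_derivative (\<lambda>s. grad G y \<bullet> (s *\<^sub>R v))) (at 0)"
    by (rule has_derivative_compose[OF c(3)[unfolded has_vector_derivative_def], of G, unfolded c(1)])
      (rule G_derivative)
  moreover have "((\<lambda>t. G (c t)) has_derivative (\<lambda>s. 0)) (at 0)"
  proof -
    have "c \<midarrow>0\<rightarrow> y"
      using has_vector_derivative_continuous[OF c(3)] c(1) by (simp add: isCont_def)
    then have "\<forall>\<^sub>F t in at 0. c t \<in> ball y0 r"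
      using topological_tendstoD[OF _ open_ball y] by blast
    then have "\<forall>\<^sub>F t in at 0. G (c t) = 0"
      by eventually_elim (use c(2) in_frontier_iff in blast)
    then show ?thesis
      by (intro has_derivative_transform_eventually[where f = "\<lambda>t. 0" and g = "\<lambda>t. G (c t)", OF has_derivative_const])
        (use c(1) in_frontier_iff[OF y] fr in \<open>auto elim: eventually_mono\<close>)
  qed
  ultimately have "(\<lambda>s. grad G y \<bullet> (s *\<^sub>R v)) = (\<lambda>s. 0)"
    using has_derivative_unique by blast
  from fun_cong[OF this, of 1] show "grad G y \<bullet> v = 0" by simp
next
  assume "grad G y \<bullet> v = 0"
  from frontier_curve[OF y this fr] show "tangent_vector (frontier \<Omega>) y v"
    unfolding tangent_vector_def by metis
qed

lemma eventually_line:
  assumes y: "y \<in> ball y0 r"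
  shows "\<forall>\<^sub>F t in at_right (0::real). y + t *\<^sub>R w \<in> ball y0 r"
proof -
  have "((\<lambda>t. y + t *\<^sub>R w) \<longlongrightarrow> y + 0 *\<^sub>R w) (at_right 0)"
    by (intro tendsto_intros)
  then have lim: "((\<lambda>t. y + t *\<^sub>R w) \<longlongrightarrow> y) (at_right 0)" by simp
  show ?thesis using topological_tendstoD[OF lim open_ball y] .
qed

lemma eventually_in_dom:
  assumes y: "y \<in> ball y0 r" and fr: "y \<in> frontier \<Omega>" and w: "grad G y \<bullet> w > 0"
  shows "\<forall>\<^sub>F t in at_right (0::real). y + t *\<^sub>R w \<in> \<Omega>"
proof -
  obtain d where "d > 0" and d: "\<And>h. 0 < h \<Longrightarrow> h < d \<Longrightarrow> G (y + 0 *\<^sub>R w) < G (y + (0 + h) *\<^sub>R w)"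
    using DERIV_pos_inc_right[OF G_line_DERIV[of y w 0]] w by auto
  then have "\<forall>\<^sub>F t in at_right 0. G y < G (y + t *\<^sub>R w)"
    by (auto simp: eventually_at_right_field intro!: exI[of _ d])
  with eventually_line[OF y, of w] show ?thesis
    by eventually_elim (use in_dom_iff in_frontier_iff[OF y] fr in auto)
qed

lemma eventually_not_in_closure:
  assumes y: "y \<in> ball y0 r" and fr: "y \<in> frontier \<Omega>" and w: "grad G y \<bullet> w < 0"
  shows "\<forall>\<^sub>F t in at_right (0::real). y + t *\<^sub>R w \<notin> closure \<Omega>"
proof -
  obtain d where "d > 0" and d: "\<And>h. 0 < h \<Longrightarrow> h < d \<Longrightarrow> G (y + 0 *\<^sub>R w) > G (y + (0 + h) *\<^sub>R w)"
    using DERIV_neg_dec_right[OF G_line_DERIV[of y w 0]] w by auto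
  then have "\<forall>\<^sub>F t in at_right 0. G y > G (y + t *\<^sub>R w)"
    by (auto simp: eventually_at_right_field intro!: exI[of _ d])
  with eventually_line[OF y, of w] show ?thesis
    by eventually_elim (use closure_dom_nonneg in_frontier_iff[OF y] fr in force)
qed

text \<open>The tangent space is the orthogonal complement of \<open>grad G y\<close>, so a unit
  normal is determined up to sign, and the one-sided condition along the line decides the
  sign.\<close>

lemma outer_normal_eq:
  assumes y: "y \<in> ball y0 r" and fr: "y \<in> frontier \<Omega>"
  shows "outer_normal \<Omega> y = (- 1 / norm (grad G y)) *\<^sub>R grad G y"
  unfolding outer_normal_def
proof (rule the_equality)
  let ?P = "grad G y"
  let ?n = "(- 1 / norm ?P) *\<^sub>R ?P"
  have nP: "norm ?P > 0" using grad_G_nonzero by simp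
  have "?P \<bullet> (- ?n) = norm ?P" using nP by (simp add: dot_square_norm power2_eq_square)
  then have "\<forall>\<^sub>F t in at_right 0. y + t *\<^sub>R (- ?n) \<in> \<Omega>" "\<forall>\<^sub>F t in at_right 0. y + t *\<^sub>R ?n \<notin> closure \<Omega>"
    using nP by (intro eventually_in_dom[OF y fr] eventually_not_in_closure[OF y fr]; simp)+
  then have "\<forall>\<^sub>F t in at_right 0. y - t *\<^sub>R ?n \<in> \<Omega> \<and> y + t *\<^sub>R ?n \<notin> closure \<Omega>"
    by eventually_elim simp
  then show "norm ?n = 1 \<and> (\<forall>v. tangent_vector (frontier \<Omega>) y v \<longrightarrow> ?n \<bullet> v = 0) \<and>
    (\<forall>\<^sub>F t in at_right 0. y - t *\<^sub>R ?n \<in> \<Omega> \<and> y + t *\<^sub>R ?n \<notin> closure \<Omega>)"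
    using nP tangent_vector_iff[OF y fr] by auto
  fix \<nu> assume \<nu>: "norm \<nu> = 1 \<and> (\<forall>v. tangent_vector (frontier \<Omega>) y v \<longrightarrow> \<nu> \<bullet> v = 0) \<and>
    (\<forall>\<^sub>F t in at_right 0. y - t *\<^sub>R \<nu> \<in> \<Omega> \<and> y + t *\<^sub>R \<nu> \<notin> closure \<Omega>)"
  \<comment> \<open>The component of \<open>\<nu>\<close> orthogonal to \<open>?P\<close> is
    tangent, hence orthogonal to \<open>\<nu>\<close> as well, hence zero.\<close>
  define c where "c = (\<nu> \<bullet> ?P) / (norm ?P)\<^sup>2"
  have "?P \<bullet> (\<nu> - c *\<^sub>R ?P) = 0"
    using nP by (simp add: c_def inner_diff_right dot_square_norm inner_commute)
  moreover from this have "\<nu> \<bullet> (\<nu> - c *\<^sub>R ?P) = 0" using \<nu> tangent_vector_iff[OF y fr] by blast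
  ultimately have "(\<nu> - c *\<^sub>R ?P) \<bullet> (\<nu> - c *\<^sub>R ?P) = 0" by (simp add: inner_diff_left)
  then have \<nu>c: "\<nu> = c *\<^sub>R ?P" by simp
  then have nc: "\<bar>c\<bar> * norm ?P = 1" using \<nu> by simp
  have "\<not> c > 0"
  proof
    assume "c > 0"
    then have "?P \<bullet> (- \<nu>) < 0" using \<nu>c nP by (simp add: dot_square_norm)
    from eventually_not_in_closure[OF y fr this] have "\<forall>\<^sub>F t in at_right 0. y - t *\<^sub>R \<nu> \<notin> closure \<Omega>"
      by simp
    moreover have "\<forall>\<^sub>F t in at_right 0. y - t *\<^sub>R \<nu> \<in> \<Omega>"
      using \<nu> by (auto elim: eventually_mono)
    ultimately have "\<forall>\<^sub>F t in at_right (0::real). False"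
      by eventually_elim (use closure_subset in blast)
    then show False by simp
  qed
  then have "c = - 1 / norm ?P" using nc nP by (simp add: field_simps abs_if split: if_splits)
  then show "\<nu> = ?n" using \<nu>c by simp
qed

text \<open>The definition picks some extension of the normal, so an arbitrary one is compared with
  the normalised gradient \<open>n\<close>. Their derivatives agree on tangent vectors, and
  \<open>hessian_F_radial\<close> kills the remaining normal contribution to the trace. The minus
  sign reflects that \<open>grad G\<close> points inward.\<close>

lemma mean_curvature_eq:
  assumes "C2_norm F a"
  shows "mean_curvature_F F \<Omega> y0 = - divergence (\<lambda>y. grad F (grad G y)) y0"
proof -
  interpret C2_norm F a by fact
  define n where "n y = (- 1 / norm (grad G y)) *\<^sub>R grad G y" for y
  have n0: "n y \<noteq> 0" "norm (n y) = 1" for y using grad_G_nonzero[of y] by (auto simp: n_def)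
  have y0b: "y0 \<in> ball y0 r" using r_pos by simp
  have n_C1: "Ck_on 1 UNIV n"
  proof -
    have "Ck_on 1 UNIV (\<lambda>y. grad G y \<bullet> grad G y)" by (intro Ck1_inner grad_G_C1)
    then have "Ck_on 1 UNIV (\<lambda>y. - 1 / sqrt (grad G y \<bullet> grad G y))"
      by (rule Ck1_real_comp[where T = "{0<..}" and q' = "\<lambda>s. (inverse (sqrt s) / 2) / (sqrt s)\<^sup>2"])
        (auto intro!: derivative_eq_intros continuous_intros simp: power2_eq_square grad_G_nonzero)
    from Ck1_scaleR[OF this grad_G_C1] show ?thesis
      by (simp add: n_def[abs_def] norm_eq_sqrt_inner)
  qed
  have n_outer: "n y = outer_normal \<Omega> y" if "y \<in> ball y0 r \<inter> frontier \<Omega>" for y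
    using outer_normal_eq that by (simp add: n_def)
  define Q where "Q h \<longleftrightarrow> (\<exists>\<nu> U. open U \<and> y0 \<in> U \<and> Ck_on 1 U \<nu> \<and>
     (\<forall>y\<in>U \<inter> frontier \<Omega>. \<nu> y = outer_normal \<Omega> y) \<and>
     h = divergence (\<lambda>y. grad F (\<nu> y)) y0)" for h
  have "Q (divergence (\<lambda>y. grad F (n y)) y0)"
    unfolding Q_def
    by (rule exI[of _ n], rule exI[of _ "ball y0 r"]) (use y0b n_outer Ck1_subset[OF n_C1] in auto)
  then have "Q (mean_curvature_F F \<Omega> y0)"
    unfolding mean_curvature_F_def Q_def[symmetric] by (rule someI)
  then obtain \<nu> U where U: "open U" "y0 \<in> U" "Ck_on 1 U \<nu>" "\<And>y. y \<in> U \<inter> frontier \<Omega> \<Longrightarrow> \<nu> y = outer_normal \<Omega> y"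
    and H: "mean_curvature_F F \<Omega> y0 = divergence (\<lambda>y. grad F (\<nu> y)) y0"
    unfolding Q_def by blast
  obtain D where D: "(\<nu> has_derivative D) (at y0)"
    using Ck1_E[OF U(3)] U(2) by metis
  obtain D' where D': "(n has_derivative D') (at y0)"
    using Ck1_E[OF n_C1] UNIV_I by metis
  obtain K where K: "(grad F has_derivative K) (at (n y0))"
    using Ck1_E[OF C2] n0 by (metis ComplI singletonD)
  have \<nu>0: "\<nu> y0 = n y0" using U(2,4) n_outer y0b y0 by simp
  define B where "B h = K (D h) - K (D' h)" for h
  have linB: "linear B"
    unfolding B_def
    using linear_compose_sub[OF linear_compose[OF has_derivative_linear[OF D] has_derivative_linear[OF K]]
        linear_compose[OF has_derivative_linear[OF D'] has_derivative_linear[OF K]]]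
    by (simp add: o_def)
  have B0: "B v = 0" if v: "grad G y0 \<bullet> v = 0" for v
  proof -
    obtain c where c: "c 0 = y0" "\<And>t. c t \<in> frontier \<Omega>" "(c has_vector_derivative v) (at 0)"
      using frontier_curve[OF y0b v y0] by blast
    have cD: "(c has_derivative (\<lambda>s. s *\<^sub>R v)) (at 0)" using c(3) by (simp add: has_vector_derivative_def)
    have 1: "((\<lambda>t. \<nu> (c t)) has_derivative (\<lambda>s. D (s *\<^sub>R v))) (at 0)"
      using has_derivative_compose[OF cD, of \<nu> D] D c(1) by simp
    have 2: "((\<lambda>t. n (c t)) has_derivative (\<lambda>s. D' (s *\<^sub>R v))) (at 0)"
      using has_derivative_compose[OF cD, of n D'] D' c(1) by simp
    have "c \<midarrow>0\<rightarrow> y0"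
      using has_vector_derivative_continuous[OF c(3)] c(1) by (simp add: isCont_def)
    then have "\<forall>\<^sub>F t in at 0. c t \<in> ball y0 r \<inter> U"
      using topological_tendstoD[of c y0 "at 0" "ball y0 r \<inter> U"] y0b U(1,2) by auto
    then have "\<forall>\<^sub>F t in at 0. \<nu> (c t) = n (c t)"
    proof eventually_elim
      case (elim t)
      then show ?case using n_outer[of "c t"] U(4)[of "c t"] c(2)[of t] by simp
    qed
    then have "((\<lambda>t. \<nu> (c t)) has_derivative (\<lambda>s. D' (s *\<^sub>R v))) (at 0)"
      by (intro has_derivative_transform_eventually[OF 2])
        (use \<nu>0 c(1) in \<open>auto elim: eventually_mono\<close>)
    with 1 have "(\<lambda>s. D (s *\<^sub>R v)) = (\<lambda>s. D' (s *\<^sub>R v))" using has_derivative_unique by blast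
    from fun_cong[OF this, of 1] show ?thesis by (simp add: B_def)
  qed
  \<comment> \<open>\<open>B\<close> vanishes on the tangent hyperplane, so it has rank at most one
    and its trace is the single entry \<open>n y0 \<bullet> B (n y0)\<close>.\<close>
  have Bh: "B h = (n y0 \<bullet> h) *\<^sub>R B (n y0)" for h
  proof -
    have "grad G y0 = (- norm (grad G y0)) *\<^sub>R n y0" using grad_G_nonzero by (simp add: n_def)
    moreover have "n y0 \<bullet> (h - (n y0 \<bullet> h) *\<^sub>R n y0) = 0"
      using n0(2)[of y0] by (simp add: inner_diff_right dot_square_norm)
    ultimately have "grad G y0 \<bullet> (h - (n y0 \<bullet> h) *\<^sub>R n y0) = 0"
      by (metis inner_scaleR_left mult_zero_right)
    from B0[OF this] show ?thesis by (simp add: linear_diff[OF linB] linear_cmul[OF linB])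
  qed
  have "(\<Sum>i\<in>UNIV. B (axis i 1) $ i) = n y0 \<bullet> B (n y0)"
  proof -
    have "B (axis i 1) $ i = n y0 $ i * B (n y0) $ i" for i
      using arg_cong[OF Bh[of "axis i 1"], of "\<lambda>v. v $ i"] by (simp add: inner_axis)
    then show ?thesis by (simp add: inner_vec_def)
  qed
  also have "\<dots> = 0"
    unfolding B_def inner_diff_right using hessian_F_radial[OF n0(1) K] by simp
  finally have tr: "(\<Sum>i\<in>UNIV. K (D (axis i 1)) $ i) = (\<Sum>i\<in>UNIV. K (D' (axis i 1)) $ i)"
    by (simp add: B_def sum_subtractf)
  have "divergence (\<lambda>y. grad F (\<nu> y)) y0 = (\<Sum>i\<in>UNIV. K (D (axis i 1)) $ i)"
    using has_derivative_compose[OF D, of "grad F" K] K \<nu>0 by (intro divergence_eq) simp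
  moreover have nd: "((\<lambda>y. grad F (n y)) has_derivative (\<lambda>h. K (D' h))) (at y0)"
    using has_derivative_compose[OF D' K] .
  moreover have "divergence (\<lambda>y. grad F (n y)) y0 = (\<Sum>i\<in>UNIV. K (D' (axis i 1)) $ i)"
    using divergence_eq[OF nd] .
  moreover have "grad F (grad G y) = - grad F (n y)" for y
    using grad_F_scale[of "- 1 / norm (grad G y)" "grad G y"] grad_G_nonzero[of y]
    by (simp add: n_def sgn_if)
  then have "divergence (\<lambda>y. grad F (grad G y)) y0 = - divergence (\<lambda>y. grad F (n y)) y0"
    using divergence_eq[OF has_derivative_minus[OF nd]] divergence_eq[OF nd] by (simp add: sum_negf)
  ultimately show ?thesis using H tr by simp
qed

end

lemma boundary_chart_exists:
  fixes \<Omega> :: "(real^'n) set"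
  assumes "open \<Omega>" "Ck_boundary 2 \<Omega>" "y0 \<in> frontier \<Omega>"
  obtains r G e where "boundary_chart \<Omega> y0 r G e"
proof -
  obtain r i s and \<gamma> :: "real^'n \<Rightarrow> real" where r: "r > 0" and s: "s \<in> {-1, 1 :: real}" and \<gamma>: "Ck_on 2 UNIV \<gamma>"
    and dom: "\<Omega> \<inter> ball y0 r = {y \<in> ball y0 r. s * (y $ i) > \<gamma> (y - (y $ i) *\<^sub>R axis i 1)}"
    using assms(2,3) unfolding Ck_boundary_def by blast
  define \<pi> where "\<pi> y = y - (y $ i) *\<^sub>R axis i 1" for y :: "real^'n"
  define G where "G y = s * (y $ i) - \<gamma> (\<pi> y)" for y
  have \<pi>: "bounded_linear \<pi>" unfolding \<pi>_def
    by (intro bounded_linear_intros bounded_linear_vec_nth)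
  have \<gamma>d: "\<gamma> differentiable (at y)" for y using \<gamma> by (simp add: numeral_2_eq_2)
  have "Ck_on 1 UNIV (\<lambda>x. frechet_derivative \<gamma> (at x) (axis i 1))" for i
    using \<gamma> by (simp add: numeral_2_eq_2)
  then have g\<gamma>: "Ck_on 1 UNIV (grad \<gamma>)" by (intro Ck1_vecI) (simp add: grad_def)
  \<comment> \<open>\<open>\<pi>\<close> is an orthogonal projection, hence self-adjoint, so the
    chain rule puts \<open>\<pi>\<close> in front of the gradient of
    \<open>\<gamma>\<close>.\<close>
  define P where "P y = s *\<^sub>R axis i 1 - \<pi> (grad \<gamma> (\<pi> y))" for y
  have GP: "(G has_derivative (\<lambda>h. P y \<bullet> h)) (at y)" for y
  proof -
    have "((\<lambda>y. \<gamma> (\<pi> y)) has_derivative (\<lambda>h. grad \<gamma> (\<pi> y) \<bullet> \<pi> h)) (at y)"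
      by (rule has_derivative_compose[where g = \<gamma>, OF bounded_linear_imp_has_derivative[OF \<pi>] grad_derivative[OF \<gamma>d]])
    then have "(G has_derivative (\<lambda>h. s * (h $ i) - grad \<gamma> (\<pi> y) \<bullet> \<pi> h)) (at y)"
      unfolding G_def by (intro has_derivative_diff has_derivative_mult_right
          bounded_linear_imp_has_derivative bounded_linear_vec_nth)
    moreover have "s * (h $ i) - grad \<gamma> (\<pi> y) \<bullet> \<pi> h = P y \<bullet> h" for h
      by (simp add: P_def \<pi>_def inner_diff_left inner_diff_right inner_axis inner_axis' algebra_simps)
    ultimately show ?thesis by simp
  qed
  have "grad G = P" using grad_eq[OF GP] by auto
  moreover have "Ck_on 1 UNIV P"
    unfolding P_def
    by (intro Ck1_diff Ck1_const Ck1_bounded_linear[OF \<pi>] Ck1_comp[OF _ g\<gamma>] Ck1_ident) auto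
  ultimately have "boundary_chart \<Omega> y0 r G (s *\<^sub>R axis i 1)"
    using assms r dom s GP
    by unfold_locales (auto simp: G_def \<pi>_def differentiable_def algebra_simps)
  then show ?thesis by (rule that)
qed

section \<open>Barriers for the distance function\<close>

lemma differentiable_locally_lipschitz:
  fixes f :: "'a::real_normed_vector \<Rightarrow> 'b::real_normed_vector"
  assumes "f differentiable (at y)"
  obtains L \<rho> where "L \<ge> 0" "\<rho> > 0" "\<And>w. norm (w - y) < \<rho> \<Longrightarrow> norm (f w - f y) \<le> L * norm (w - y)"
proof -
  obtain f' where f': "(f has_derivative f') (at y)" using assms by (auto simp: differentiable_def)
  then have bl: "bounded_linear f'" by (rule has_derivative_bounded_linear)
  obtain \<rho> where \<rho>: "\<rho> > 0" "\<And>w. norm (w - y) < \<rho> \<Longrightarrow> norm (f w - f y - f' (w - y)) \<le> 1 * norm (w - y)"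
    using f' unfolding has_derivative_at_alt by (metis zero_less_one)
  obtain K where K: "K \<ge> 0" "\<And>h. norm (f' h) \<le> norm h * K"
    using bounded_linear.nonneg_bounded[OF bl] by blast
  have "norm (f w - f y) \<le> (K + 1) * norm (w - y)" if "norm (w - y) < \<rho>" for w
    using norm_triangle_ineq[of "f w - f y - f' (w - y)" "f' (w - y)"] \<rho>(2)[OF that] K(2)[of "w - y"]
    by (simp add: algebra_simps)
  then show ?thesis using that[of "K + 1" \<rho>] K \<rho> by simp
qed

context C2_norm
begin

definition dist_F :: "(real^'n) set \<Rightarrow> real^'n \<Rightarrow> real" where
  "dist_F \<Omega> x = (INF y\<in>-\<Omega>. polar F (x - y))"

lemma dist_F_le: "y \<notin> \<Omega> \<Longrightarrow> dist_F \<Omega> x \<le> polar F (x - y)"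
  unfolding dist_F_def by (intro cINF_lower bdd_belowI2[where m = 0] polar_nonneg) auto

lemma dist_F_attained:
  assumes "open \<Omega>" "\<Omega> \<noteq> UNIV"
  obtains y where "y \<notin> \<Omega>" "dist_F \<Omega> x = polar F (x - y)"
proof -
  obtain y1 where y1: "y1 \<notin> \<Omega>" using assms(2) by blast
  \<comment> \<open>By \<open>norm_le_polar\<close>, points of the complement outside this ball are
    farther from \<open>x\<close> in the polar norm than \<open>y1\<close>, so the infimum is one
    over a compact set.\<close>
  define S where "S = - \<Omega> \<inter> cball x (bnd * polar F (x - y1))"
  have "y1 \<in> S" using y1 norm_le_polar[of "x - y1"] by (simp add: S_def dist_norm)
  moreover have "compact S" using assms(1) by (simp add: S_def closed_Int_compact closed_Compl)
  moreover have "continuous_on S (\<lambda>y. polar F (x - y))"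
    by (intro continuous_on_compose2[OF polar_continuous[of UNIV]] continuous_intros) auto
  ultimately obtain y where y: "y \<in> S" "\<And>w. w \<in> S \<Longrightarrow> polar F (x - y) \<le> polar F (x - w)"
    using continuous_attains_inf[of S "\<lambda>y. polar F (x - y)"] by blast
  have "polar F (x - y) \<le> polar F (x - w)" if "w \<notin> \<Omega>" for w
  proof (cases "w \<in> S")
    case False
    then have "bnd * polar F (x - y1) < bnd * polar F (x - w)"
      using that norm_le_polar[of "x - w"] by (simp add: S_def dist_norm)
    then show ?thesis using y(2)[OF \<open>y1 \<in> S\<close>] bnd_pos by simp
  qed (use y in auto)
  then have "polar F (x - y) \<le> dist_F \<Omega> x"
    unfolding dist_F_def using y1 by (intro cINF_greatest) auto
  moreover have "y \<notin> \<Omega>" using y(1) by (simp add: S_def)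
  ultimately show ?thesis using that dist_F_le[of y \<Omega> x] by (meson antisym)
qed

lemma polar_less_dist_F: "polar F (x - z) < dist_F \<Omega> x \<Longrightarrow> z \<in> \<Omega>"
  using dist_F_le[of z \<Omega> x] by (meson not_less)

lemma dist_F_pos: "open \<Omega> \<Longrightarrow> \<Omega> \<noteq> UNIV \<Longrightarrow> x \<in> \<Omega> \<Longrightarrow> 0 < dist_F \<Omega> x"
  using dist_F_attained[of \<Omega> x] polar_pos by (metis eq_iff_diff_eq_0)

lemma dist_F_diff_le: "open \<Omega> \<Longrightarrow> \<Omega> \<noteq> UNIV \<Longrightarrow> \<bar>dist_F \<Omega> x - dist_F \<Omega> z\<bar> \<le> polar F (x - z)"
proof -
  assume \<Omega>: "open \<Omega>" "\<Omega> \<noteq> UNIV"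
  have "dist_F \<Omega> x \<le> dist_F \<Omega> z + polar F (x - z)" for x z
  proof -
    obtain y where y: "y \<notin> \<Omega>" "dist_F \<Omega> z = polar F (z - y)" using dist_F_attained[OF \<Omega>] by metis
    then show ?thesis using dist_F_le[OF y(1), of x] polar_triangle[of "x - z" "z - y"] by simp
  qed
  from this[of x z] this[of z x] show ?thesis using polar_minus_commute[of x z] by simp
qed

lemma dist_F_continuous: "open \<Omega> \<Longrightarrow> \<Omega> \<noteq> UNIV \<Longrightarrow> continuous_on A (dist_F \<Omega>)"
proof -
  assume \<Omega>: "open \<Omega>" "\<Omega> \<noteq> UNIV"
  have "lipschitz_on (1 / a) UNIV (dist_F \<Omega>)"
    using order_trans[OF dist_F_diff_le[OF \<Omega>] polar_le_norm] a_pos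
    by (auto simp: lipschitz_on_def dist_norm dist_real_def)
  then show ?thesis
    using lipschitz_on_continuous_on continuous_on_subset by blast
qed

text \<open>Convexity of the Wulff shape around \<open>x\<close> touching the boundary at \<open>y0\<close> puts it on one side of the
  tangent hyperplane at \<open>y0\<close>, which determines the direction of \<open>x - y0\<close>.\<close>
lemma nearest_point_direction:
  assumes ch: "boundary_chart \<Omega> y0 r G e" and d: "dist_F \<Omega> x = polar F (x - y0)" and pos: "0 < polar F (x - y0)"
  shows "x - y0 = polar F (x - y0) *\<^sub>R grad F (grad G y0)"
proof -
  interpret boundary_chart \<Omega> y0 r G e by fact
  define t where "t = polar F (x - y0)"
  define n where "n = grad G y0"
  define N where "N = grad F n"
  have n: "n \<noteq> 0" using grad_G_nonzero by (simp add: n_def)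
  have t: "t > 0" using pos by (simp add: t_def)
  have "t * F n \<le> n \<bullet> (x - y0)"
  proof (rule ccontr)
    assume "\<not> ?thesis"
    then have lt: "n \<bullet> (x - y0) < t * F n" by simp
    \<comment> \<open>Smaller than the relative deficit of \<open>n \<bullet> (x - y0)\<close>, so
      that \<open>n \<bullet> w < 0\<close> and the ray from \<open>y0\<close> in direction
      \<open>w\<close> leaves the closure. Positive, so that the same ray enters the open Wulff
      shape around \<open>x\<close>, which lies in \<open>\<Omega>\<close>.\<close>
    define s where "s = min (1/2) ((t * F n - n \<bullet> (x - y0)) / (2 * t * F n))"
    have tF: "t * F n > 0" using t F_pos[OF n] by simp
    have s: "0 < s" "s < 1" using lt tF by (auto simp: s_def)
    have "s \<le> (t * F n - n \<bullet> (x - y0)) / (2 * t * F n)" by (simp add: s_def)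
    then have "s * (2 * t * F n) \<le> t * F n - n \<bullet> (x - y0)"
      using tF by (simp add: pos_le_divide_eq)
    then have sl: "s * (t * F n) < t * F n - n \<bullet> (x - y0)" using lt by simp
    define w where "w = (x - y0) - ((1 - s) * t) *\<^sub>R N"
    have "n \<bullet> w = n \<bullet> (x - y0) - (1 - s) * t * F n"
      using grad_F_self[OF n] by (simp add: w_def N_def inner_diff_right inner_commute)
    also have "\<dots> < 0" using sl by (simp add: algebra_simps)
    finally have "grad G y0 \<bullet> w < 0" by (simp add: n_def)
    moreover have "y0 \<in> ball y0 r" using r_pos by simp
    ultimately have ev: "\<forall>\<^sub>F \<theta> in at_right (0::real). y0 + \<theta> *\<^sub>R w \<notin> closure \<Omega>"
      using eventually_not_in_closure y0 by blast
    have "\<forall>\<^sub>F \<theta> in at_right (0::real). \<theta> < 1" "\<forall>\<^sub>F \<theta> in at_right (0::real). 0 < \<theta>"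
      by (auto simp: eventually_at_right_less eventually_at_right_field intro!: exI[of _ 1])
    with ev have "\<forall>\<^sub>F \<theta> in at_right (0::real). False"
    proof eventually_elim
      case (elim \<theta>)
      have "x - (y0 + \<theta> *\<^sub>R w) = (1 - \<theta>) *\<^sub>R (x - y0) + (\<theta> * ((1 - s) * t)) *\<^sub>R N"
        by (simp add: w_def algebra_simps)
      then have "polar F (x - (y0 + \<theta> *\<^sub>R w)) \<le> (1 - \<theta>) * t + \<theta> * ((1 - s) * t)"
        using polar_triangle[of "(1 - \<theta>) *\<^sub>R (x - y0)" "(\<theta> * ((1 - s) * t)) *\<^sub>R N"] elim s t
        by (simp add: polar_scale t_def[symmetric] N_def polar_grad_F[OF n])
      also have "\<dots> = t - \<theta> * s * t" by (simp add: algebra_simps)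
      also have "\<dots> < t" using elim s t by simp
      finally have "y0 + \<theta> *\<^sub>R w \<in> \<Omega>"
        using polar_less_dist_F d t_def by metis
      then show ?case using elim closure_subset by blast
    qed
    then show False by simp
  qed
  moreover have "n \<bullet> (x - y0) \<le> t * F n" using inner_le_polar[of n "x - y0"] by (simp add: t_def)
  ultimately have "n \<bullet> (x - y0) = t * F n" by simp
  then have "(1 / t) *\<^sub>R (x - y0) = N"
    unfolding N_def using t by (intro grad_F_unique[OF n]) (auto simp: polar_scale t_def[symmetric])
  then have "t *\<^sub>R ((1 / t) *\<^sub>R (x - y0)) = t *\<^sub>R N" by simp
  then show ?thesis using t by (simp add: t_def N_def n_def)
qed

text \<open>Interior points of the segment from \<open>y0\<close> to \<open>x\<close> are closer to
  \<open>x\<close> in the polar norm than the distance allows for the complement, so they lie in the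
  domain and accumulate at \<open>y0\<close>.\<close>

lemma nearest_point_in_frontier:
  assumes "open \<Omega>" "x \<in> \<Omega>" "y0 \<notin> \<Omega>" "dist_F \<Omega> x = polar F (x - y0)"
  shows "y0 \<in> frontier \<Omega>"
proof -
  have t: "polar F (x - y0) > 0" using assms by (intro polar_pos) auto
  have "((\<lambda>\<theta>. y0 + \<theta> *\<^sub>R (x - y0)) \<longlongrightarrow> y0 + 0 *\<^sub>R (x - y0)) (at_right (0::real))"
    by (intro tendsto_intros)
  then have lim: "((\<lambda>\<theta>. y0 + \<theta> *\<^sub>R (x - y0)) \<longlongrightarrow> y0) (at_right (0::real))" by simp
  have "\<forall>\<^sub>F \<theta> in at_right (0::real). \<theta> < 1" "\<forall>\<^sub>F \<theta> in at_right (0::real). 0 < \<theta>"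
    by (auto simp: eventually_at_right_less eventually_at_right_field intro!: exI[of _ 1])
  then have "\<forall>\<^sub>F \<theta> in at_right (0::real). y0 + \<theta> *\<^sub>R (x - y0) \<in> \<Omega>"
  proof eventually_elim
    case (elim \<theta>)
    have "x - (y0 + \<theta> *\<^sub>R (x - y0)) = (1 - \<theta>) *\<^sub>R (x - y0)" by (simp add: algebra_simps)
    then have "polar F (x - (y0 + \<theta> *\<^sub>R (x - y0))) = (1 - \<theta>) * polar F (x - y0)"
      using elim by (simp add: polar_scale)
    also have "\<dots> < polar F (x - y0)" using elim t by simp
    finally show ?case using assms(4) by (intro polar_less_dist_F[of x]) simp
  qed
  then have "y0 \<in> closure \<Omega>"
    by (intro Lim_in_closed_set[OF closed_closure _ _ lim])
      (auto elim: eventually_mono intro: closure_subset[THEN subsetD])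
  then show ?thesis using assms by (simp add: frontier_def interior_open)
qed

end

context boundary_chart
begin

text \<open>Near \<open>y0\<close> the slope of \<open>G\<close> along \<open>N\<close> is 1 up to a
  multiple of \<open>norm (z - y0)\<close>, so a shift by slightly more than \<open>G z\<close>
  reaches the region where \<open>G\<close> is not positive. The error has the product form
  \<open>\<bar>G z\<bar> * norm (z - y0)\<close>, which a multiple of the square of \<open>G\<close>
  and a small quadratic term can absorb later.\<close>

lemma shifted_point_outside:
  assumes "grad G y0 \<bullet> N = 1"
  obtains K M \<rho> where "K \<ge> 0" "M \<ge> 0" "\<rho> > 0"
    "\<And>z. norm (z - y0) < \<rho> \<Longrightarrow> \<exists>s. \<bar>s\<bar> \<le> M * norm (z - y0) \<and> s \<le> G z + 2 * K * \<bar>G z\<bar> * norm (z - y0) \<and> z - s *\<^sub>R N \<notin> \<Omega>"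
proof -
  have G0: "G y0 = 0" using in_frontier_iff[of y0] y0 r_pos by simp
  obtain L \<rho>1 where L: "L \<ge> 0" "\<rho>1 > 0"
    "\<And>w. norm (w - y0) < \<rho>1 \<Longrightarrow> norm (grad G w - grad G y0) \<le> L * norm (w - y0)"
    using differentiable_locally_lipschitz[OF Ck1_differentiable[OF grad_G_C1 UNIV_I]] by metis
  obtain M \<rho>2 where M: "M \<ge> 0" "\<rho>2 > 0" "\<And>w. norm (w - y0) < \<rho>2 \<Longrightarrow> norm (G w - G y0) \<le> M * norm (w - y0)"
    using differentiable_locally_lipschitz[OF G_diff] by metis
  define C where "C = 1 + 2 * M * norm N"
  define K where "K = L * norm N * C"
  have C1: "C \<ge> 1" using M by (simp add: C_def)
  have K0: "K \<ge> 0" using L C1 by (simp add: K_def)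
  \<comment> \<open>The factor \<open>C\<close> accounts for the whole segment from \<open>z\<close>
    to the shifted point; the last entry gives \<delta> \<le> 1/2.\<close>
  define \<rho> where "\<rho> = min (min \<rho>2 (min \<rho>1 r / C)) (1 / (2 * K + 2))"
  have \<rho>: "\<rho> > 0" using M(2) L(2) r_pos C1 K0 by (simp add: \<rho>_def)
  have "\<exists>s. \<bar>s\<bar> \<le> 2 * M * norm (z - y0) \<and> s \<le> G z + 2 * K * \<bar>G z\<bar> * norm (z - y0) \<and> z - s *\<^sub>R N \<notin> \<Omega>"
    if z: "norm (z - y0) < \<rho>" for z
  proof -
    define q where "q = norm (z - y0)"
    define \<delta> where "\<delta> = K * q"
    \<comment> \<open>The relative surplus 2\<delta> beats the slope error \<delta>: (1 +
      2\<delta>)(1 - \<delta>) \<ge> 1 is used when G z \<ge> 0, and (1 - 2\<delta>)(1 + \<delta>)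
      \<le> 1 when G z < 0.\<close>
    define s where "s = G z + 2 * \<delta> * \<bar>G z\<bar>"
    have q: "0 \<le> q" "q < \<rho>2" "C * q < \<rho>1" "C * q < r" "q * (2 * K + 2) < 1"
      using z C1 K0 by (auto simp: q_def \<rho>_def field_simps)
    have \<delta>: "0 \<le> \<delta>" "\<delta> \<le> 1/2" using q K0 by (auto simp: \<delta>_def algebra_simps)
    have s2: "\<bar>s\<bar> \<le> 2 * \<bar>G z\<bar>"
    proof -
      have "2 * \<delta> * \<bar>G z\<bar> \<le> 1 * \<bar>G z\<bar>" using \<delta> by (intro mult_right_mono) auto
      then show ?thesis
        using \<delta> abs_triangle_ineq[of "G z" "2 * \<delta> * \<bar>G z\<bar>"] by (simp add: s_def abs_mult)
    qed
    have Gz: "\<bar>G z\<bar> \<le> M * q" using M(3)[of z] q G0 by (simp add: q_def)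
    have near: "norm (z - \<theta> *\<^sub>R N - y0) \<le> C * q" if "\<bar>\<theta>\<bar> \<le> \<bar>s\<bar>" for \<theta>
    proof -
      have "norm (z - \<theta> *\<^sub>R N - y0) \<le> q + \<bar>\<theta>\<bar> * norm N"
        using norm_triangle_ineq4[of "z - y0" "\<theta> *\<^sub>R N"] by (simp add: q_def algebra_simps)
      also have "\<bar>\<theta>\<bar> * norm N \<le> (2 * (M * q)) * norm N"
        using that s2 Gz by (intro mult_right_mono) auto
      finally show ?thesis by (simp add: C_def algebra_simps)
    qed
    have slope: "\<bar>grad G (z - \<theta> *\<^sub>R N) \<bullet> N - 1\<bar> \<le> \<delta>" if "\<bar>\<theta>\<bar> \<le> \<bar>s\<bar>" for \<theta>
    proof -
      have "\<bar>grad G (z - \<theta> *\<^sub>R N) \<bullet> N - 1\<bar> = \<bar>(grad G (z - \<theta> *\<^sub>R N) - grad G y0) \<bullet> N\<bar>"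
        using assms by (simp add: inner_diff_left)
      also have "\<dots> \<le> norm (grad G (z - \<theta> *\<^sub>R N) - grad G y0) * norm N" by (rule Cauchy_Schwarz_ineq2)
      also have "\<dots> \<le> (L * (C * q)) * norm N"
        using near[OF that] L q by (intro mult_right_mono order_trans[OF L(3)] mult_left_mono) auto
      finally show ?thesis by (simp add: \<delta>_def K_def mult_ac)
    qed
    have D: "((\<lambda>\<theta>. G (z + \<theta> *\<^sub>R (- N))) has_real_derivative - (grad G (z - \<theta> *\<^sub>R N) \<bullet> N)) (at \<theta>)" for \<theta>
      using G_line_DERIV[of z "- N" \<theta>] by simp
    have "G (z - s *\<^sub>R N) \<le> 0"
    proof (cases "s = 0")
      case True
      have "G z \<le> 0" using True \<delta>(1) by (simp add: s_def) (smt (verit) mult_nonneg_nonneg)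
      then show ?thesis using True by simp
    next
      case False
      have "\<exists>\<theta>. \<bar>\<theta>\<bar> \<le> \<bar>s\<bar> \<and> G (z - s *\<^sub>R N) = G z - s * (grad G (z - \<theta> *\<^sub>R N) \<bullet> N)"
      proof (cases "s > 0")
        case True
        obtain \<theta> where "0 < \<theta>" "\<theta> < s" "G (z + s *\<^sub>R (- N)) - G (z + 0 *\<^sub>R (- N)) = (s - 0) * - (grad G (z - \<theta> *\<^sub>R N) \<bullet> N)"
          using MVT2[OF True D] by blast
        then show ?thesis by (intro exI[of _ \<theta>]) auto
      next
        case F: False
        then have "s < 0" using False by simp
        then obtain \<theta> where "s < \<theta>" "\<theta> < 0" "G (z + 0 *\<^sub>R (- N)) - G (z + s *\<^sub>R (- N)) = (0 - s) * - (grad G (z - \<theta> *\<^sub>R N) \<bullet> N)"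
          using MVT2[OF _ D] by blast
        then show ?thesis by (intro exI[of _ \<theta>]) auto
      qed
      then obtain \<theta> where \<theta>: "\<bar>\<theta>\<bar> \<le> \<bar>s\<bar>" "G (z - s *\<^sub>R N) = G z - s * (grad G (z - \<theta> *\<^sub>R N) \<bullet> N)" by blast
      define m where "m = grad G (z - \<theta> *\<^sub>R N) \<bullet> N"
      have m: "1 - \<delta> \<le> m" "m \<le> 1 + \<delta>" using slope[OF \<theta>(1)] by (auto simp: m_def abs_le_iff)
      show ?thesis
      proof (cases "G z \<ge> 0")
        case True
        have sg: "s = G z * (1 + 2 * \<delta>)" using True by (simp add: s_def algebra_simps)
        have "s * (1 - \<delta>) \<le> s * m" using m True \<delta> sg by (intro mult_left_mono) auto
        moreover have "G z * (\<delta> * (1 - 2 * \<delta>)) \<ge> 0" using True \<delta> by simp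
        then have "G z \<le> s * (1 - \<delta>)" unfolding sg by (simp add: algebra_simps)
        ultimately show ?thesis using \<theta>(2) by (simp add: m_def)
      next
        case False
        have sg: "s = G z * (1 - 2 * \<delta>)" using False by (simp add: s_def algebra_simps)
        have "s \<le> 0" unfolding sg using False \<delta> by (intro mult_nonpos_nonneg) auto
        then have "s * (1 + \<delta>) \<le> s * m" using m by (intro mult_left_mono_neg) auto
        moreover have "G z * (\<delta> * (1 + 2 * \<delta>)) \<le> 0" using False \<delta> by (intro mult_nonpos_nonneg) auto
        then have "G z \<le> s * (1 + \<delta>)" unfolding sg by (simp add: algebra_simps)
        ultimately show ?thesis using \<theta>(2) by (simp add: m_def)
      qed
    qed
    moreover have "z - s *\<^sub>R N \<in> ball y0 r"
      using near[of s] q by (simp add: dist_norm norm_minus_commute)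
    ultimately have "z - s *\<^sub>R N \<notin> \<Omega>" using in_dom_iff by force
    moreover have "\<bar>s\<bar> \<le> 2 * M * q" using s2 Gz by simp
    moreover have "s = G z + 2 * K * \<bar>G z\<bar> * q" by (simp add: s_def \<delta>_def)
    ultimately show ?thesis unfolding q_def by (intro exI[of _ s]) auto
  qed
  then show ?thesis using that[of K "2 * M" \<rho>] K0 M \<rho> by simp
qed

end

text \<open>Serves to normalise a chart to \<open>F (grad G y0) = 1\<close>; scaling
  \<open>e\<close> inversely keeps unit slope along it.\<close>

lemma boundary_chart_rescale:
  assumes "boundary_chart \<Omega> y0 r G e" "c > 0"
  shows "boundary_chart \<Omega> y0 r (\<lambda>y. G y / c) (c *\<^sub>R e)"
    and "grad (\<lambda>y. G y / c) = (\<lambda>y. (1 / c) *\<^sub>R grad G y)"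
proof -
  interpret boundary_chart \<Omega> y0 r G e by fact
  have D: "((\<lambda>y. G y / c) has_derivative (\<lambda>h. ((1 / c) *\<^sub>R grad G y) \<bullet> h)) (at y)" for y
    using has_derivative_mult_right[OF G_derivative, of "1 / c"] by simp
  show g: "grad (\<lambda>y. G y / c) = (\<lambda>y. (1 / c) *\<^sub>R grad G y)"
    using grad_eq[OF D] by auto
  have "G (y + t *\<^sub>R c *\<^sub>R e) = G y + t * c" for y t
    using G_shift[of y "t * c"] by simp
  then show "boundary_chart \<Omega> y0 r (\<lambda>y. G y / c) (c *\<^sub>R e)"
    using assms(2) open_dom r_pos y0 dom_eq
    by unfold_locales (auto simp: g zero_less_divide_iff add_divide_distrib
        simp del: Ck_on.simps One_nat_def
        intro: differentiableI[OF D] Ck1_scaleR[OF Ck1_const grad_G_C1])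
qed

context C2_norm
begin

lemma F_grad_composition_C1:
  assumes "Ck_on 1 U P" "\<And>z. z \<in> U \<Longrightarrow> P z \<noteq> 0"
  shows "Ck_on 1 U (\<lambda>z. grad F (P z))"
  using assms(2) by (intro Ck1_comp[OF assms(1) C2]) auto

text \<open>The barrier is a translate, by the vector from \<open>y0\<close> to \<open>x\<close>, of a function whose level set through \<open>y0\<close> is
  \<open>\<partial>\<Omega>\<close>. Its second derivative in the radial direction is large, but does not contribute to
  the anisotropic curvature, as \<open>F\<^sub>\<xi>\<^sub>\<xi>(\<xi>) \<xi> = 0\<close>.\<close>
lemma barrier_exists:
  assumes op: "open \<Omega>" and nU: "\<Omega> \<noteq> UNIV" and bd: "Ck_boundary 2 \<Omega>"
    and curv: "\<And>y. y \<in> frontier \<Omega> \<Longrightarrow> mean_curvature_F F \<Omega> y \<ge> 0"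
    and x: "x \<in> \<Omega>" and \<eta>: "\<eta> > 0"
  shows "\<exists>\<psi> \<rho> c. \<rho> > 0 \<and> c > 0 \<and> \<psi> x = dist_F \<Omega> x \<and> (\<forall>z. \<psi> differentiable (at z)) \<and> Ck_on 1 UNIV (grad \<psi>) \<and>
    (\<forall>z\<in>ball x \<rho>. grad \<psi> z \<noteq> 0 \<and> F (grad \<psi> z) \<ge> 1 - \<eta> \<and> divergence (\<lambda>z. grad F (grad \<psi> z)) z \<le> \<eta> \<and>
      \<psi> z \<ge> dist_F \<Omega> z + c * (norm (z - x))\<^sup>2)"
proof -
  obtain y0 where near: "y0 \<notin> \<Omega>" "dist_F \<Omega> x = polar F (x - y0)"
    using dist_F_attained[OF op nU] by metis
  define t where "t = polar F (x - y0)"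
  have t: "t > 0" using dist_F_pos[OF op nU x] near by (simp add: t_def)
  have fr: "y0 \<in> frontier \<Omega>" by (rule nearest_point_in_frontier[OF op x near])
  obtain r G' e' where ch': "boundary_chart \<Omega> y0 r G' e'"
    using boundary_chart_exists[OF op bd fr] by blast
  define c0 where "c0 = F (grad G' y0)"
  have c0: "c0 > 0" unfolding c0_def using boundary_chart.grad_G_nonzero[OF ch'] by (rule F_pos)
  define G e where "G = (\<lambda>y. G' y / c0)" and "e = c0 *\<^sub>R e'"
  have ch: "boundary_chart \<Omega> y0 r G e"
    unfolding G_def e_def by (rule boundary_chart_rescale(1)[OF ch' c0])
  interpret boundary_chart \<Omega> y0 r G e by (rule ch)
  have Fn: "F (grad G y0) = 1"
    unfolding G_def boundary_chart_rescale(2)[OF ch' c0] using c0 by (simp add: hom c0_def)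
  define N where "N = grad F (grad G y0)"
  have GN: "grad G y0 \<bullet> N = 1"
    using grad_F_self[OF grad_G_nonzero] Fn by (simp add: N_def inner_commute)
  have polN: "polar F N = 1" unfolding N_def by (rule polar_grad_F[OF grad_G_nonzero])
  have xy: "x - y0 = t *\<^sub>R N"
    unfolding t_def N_def using nearest_point_direction[OF ch near(2)] t by (simp add: t_def)
  have G0: "G y0 = 0" using in_frontier_iff[of y0] fr r_pos by simp
  obtain D where D: "(grad G has_derivative D) (at y0)"
    using Ck1_E[OF grad_G_C1] UNIV_I by metis
  obtain K where K: "(grad F has_derivative K) (at (grad G y0))"
    using Ck1_E[OF C2] grad_G_nonzero by (metis ComplI singletonD)
  have linK: "linear K" using K by (rule has_derivative_linear)
  define T where "T = (\<Sum>i\<in>UNIV. K (axis i 1) $ i)"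
  \<comment> \<open>The quadratic term \<open>\<epsilon> * ((z - x) \<bullet> (z - x))\<close> of
    the barrier contributes \<open>2 * \<epsilon> * T\<close> to the divergence at \<open>x\<close>;
    this choice keeps it within \<open>\<eta> / 2\<close>.\<close>
  define \<epsilon> where "\<epsilon> = \<eta> / (4 * (\<bar>T\<bar> + 1))"
  have \<epsilon>: "\<epsilon> > 0" using \<eta> by (simp add: \<epsilon>_def)
  have \<epsilon>T: "2 * \<epsilon> * T \<le> \<eta> / 2"
  proof -
    have "2 * \<epsilon> * T \<le> 2 * \<epsilon> * (\<bar>T\<bar> + 1)" using \<epsilon> by (intro mult_left_mono) auto
    also have "\<dots> = \<eta> / 2" by (simp add: \<epsilon>_def field_simps)
    finally show ?thesis .
  qed
  obtain L M \<rho>0 where L: "L \<ge> 0" and M: "M \<ge> 0" and \<rho>0: "\<rho>0 > 0" and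
    out: "\<And>z. norm (z - y0) < \<rho>0 \<Longrightarrow> \<exists>s. \<bar>s\<bar> \<le> M * norm (z - y0) \<and> s \<le> G z + 2 * L * \<bar>G z\<bar> * norm (z - y0) \<and> z - s *\<^sub>R N \<notin> \<Omega>"
    using shifted_point_outside[OF GN] by blast
  \<comment> \<open>From completing the square: 2 L |G| q \<le> (\<epsilon>/2) q^2 + (2
    L^2/\<epsilon>) G^2. The other half of \<epsilon> q^2 remains as the gap between barrier and
    distance.\<close>
  define C where "C = 2 * L\<^sup>2 / \<epsilon>"
  define \<psi> where "\<psi> z = t + G (z - (x - y0)) + \<epsilon> * ((z - x) \<bullet> (z - x)) + C * (G (z - (x - y0)))\<^sup>2" for z
  define P where "P z = (1 + 2 * C * G (z - (x - y0))) *\<^sub>R grad G (z - (x - y0)) + (2 * \<epsilon>) *\<^sub>R (z - x)" for z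
  have \<psi>P: "(\<psi> has_derivative (\<lambda>h. P z \<bullet> h)) (at z)" for z
  proof -
    have 1: "((\<lambda>z. G (z - (x - y0))) has_derivative (\<lambda>h. grad G (z - (x - y0)) \<bullet> h)) (at z)"
      by (rule has_derivative_compose[where g = G, OF _ G_derivative]) (auto intro!: derivative_eq_intros)
    show ?thesis
      unfolding \<psi>_def power2_eq_square
      by (rule derivative_eq_intros 1 refl)+
        (simp add: P_def fun_eq_iff inner_add_left inner_diff_left inner_diff_right inner_commute algebra_simps)
  qed
  have grad\<psi>: "grad \<psi> = P" using grad_eq[OF \<psi>P] by auto
  have tr: "Ck_on 1 UNIV (\<lambda>z. z - (x - y0))" by (intro Ck1_diff Ck1_ident Ck1_const)
  have GC1: "Ck_on 1 UNIV G"
    by (rule Ck1I[OF G_derivative]) (intro continuous_intros continuous_on_subset[OF Ck1D(3)[OF grad_G_C1]], simp)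
  have PC1: "Ck_on 1 UNIV P"
    unfolding P_def
    by (intro Ck1_add Ck1_scaleR Ck1_mult Ck1_const Ck1_diff Ck1_ident Ck1_comp[OF tr GC1] Ck1_comp[OF tr grad_G_C1]) auto
  have Px: "P x = grad G y0" by (simp add: P_def G0)
  have DP: "(P has_derivative (\<lambda>h. D h + (2 * C * (grad G y0 \<bullet> h)) *\<^sub>R grad G y0 + (2 * \<epsilon>) *\<^sub>R h)) (at x)"
  proof -
    have 1: "((\<lambda>z. G (z - (x - y0))) has_derivative (\<lambda>h. grad G y0 \<bullet> h)) (at x)"
      by (rule has_derivative_compose[where g = G]) (auto intro!: derivative_eq_intros G_derivative)
    have 2: "((\<lambda>z. grad G (z - (x - y0))) has_derivative D) (at x)"
      by (rule has_derivative_compose[where g = "grad G" and g' = D]) (auto intro!: derivative_eq_intros D)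
    show ?thesis
      unfolding P_def
      by (rule derivative_eq_intros 1 2 refl)+ (simp add: fun_eq_iff G0 algebra_simps)
  qed
  \<comment> \<open>\<open>G\<close> is positive inside, so this trace is minus the curvature at
    \<open>y0\<close>.\<close>
  have curv0: "(\<Sum>i\<in>UNIV. K (D (axis i 1)) $ i) \<le> 0"
    using curv[OF fr] mean_curvature_eq[OF C2_norm_axioms] divergence_eq[OF has_derivative_compose[OF D K]] by simp
  have radial: "(\<Sum>i\<in>UNIV. grad G y0 $ i * K (grad G y0) $ i) = 0"
    using hessian_F_radial[OF grad_G_nonzero K, of "grad G y0"] by (simp add: inner_vec_def)
  have DX: "((\<lambda>z. grad F (P z)) has_derivative (\<lambda>h. K (D h + (2 * C * (grad G y0 \<bullet> h)) *\<^sub>R grad G y0 + (2 * \<epsilon>) *\<^sub>R h))) (at x)"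
    using has_derivative_compose[OF DP, of "grad F" K] K Px by simp
  have "divergence (\<lambda>z. grad F (P z)) x = (\<Sum>i\<in>UNIV. K (D (axis i 1)) $ i)
      + 2 * C * (\<Sum>i\<in>UNIV. grad G y0 $ i * K (grad G y0) $ i) + 2 * \<epsilon> * T"
    unfolding divergence_eq[OF DX] T_def
    by (simp add: linear_add[OF linK] linear_cmul[OF linK] sum.distrib sum_distrib_left inner_axis mult.assoc)
  then have divx: "divergence (\<lambda>z. grad F (P z)) x < \<eta>"
    using curv0 radial \<epsilon>T \<eta> by simp
  define U where "U = - {z. P z = 0}"
  have oU: "open U"
    unfolding U_def using continuous_closed_preimage_constant[OF Ck1D(3)[OF PC1] closed_UNIV, of 0] by (simp add: open_closed)
  have XC1: "Ck_on 1 U (\<lambda>z. grad F (P z))"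
    by (intro F_grad_composition_C1 Ck1_subset[OF PC1]) (auto simp: U_def)
  \<comment> \<open>The required properties of the gradient and of the divergence hold strictly at
    \<open>x\<close> and are open conditions, so they persist on a ball.\<close>
  define W where "W = (U \<inter> divergence (\<lambda>z. grad F (P z)) -` {..<\<eta>}) \<inter> (\<lambda>z. F (P z)) -` {1 - \<eta><..}"
  have "open W"
    unfolding W_def
    by (intro open_Int continuous_open_preimage[OF continuous_on_divergence[OF XC1] oU] open_vimage
        continuous_on_compose2[OF F_continuous[of UNIV] Ck1D(3)[OF PC1]]) auto
  moreover have "x \<in> W" using divx Px grad_G_nonzero Fn \<eta> by (simp add: W_def U_def)
  ultimately obtain \<rho>1 where \<rho>1: "\<rho>1 > 0" "ball x \<rho>1 \<subseteq> W" using open_contains_ball by blast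
  \<comment> \<open>The bound by \<open>t / (M + 1)\<close> gives |s| < t, so that
    \<open>polar F ((t + s) *\<^sub>R N)\<close> equals t + s.\<close>
  define \<rho> where "\<rho> = min \<rho>1 (min \<rho>0 (t / (M + 1)))"
  have \<rho>: "\<rho> > 0" using \<rho>1 \<rho>0 t M by (simp add: \<rho>_def)
  have above: "\<psi> z \<ge> dist_F \<Omega> z + (\<epsilon> / 2) * (norm (z - x))\<^sup>2" if z: "z \<in> ball x \<rho>" for z
  proof -
    define w where "w = z - (x - y0)"
    define q where "q = norm (z - x)"
    have q: "q < \<rho>" "q \<ge> 0" using z by (auto simp: q_def dist_norm norm_minus_commute)
    have wq: "norm (w - y0) = q" by (simp add: w_def q_def)
    obtain s where s: "\<bar>s\<bar> \<le> M * q" "s \<le> G w + 2 * L * \<bar>G w\<bar> * q" "w - s *\<^sub>R N \<notin> \<Omega>"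
      using out[of w] q wq by (auto simp: \<rho>_def)
    have "q * (M + 1) < t" using q M by (simp add: \<rho>_def field_simps)
    then have "\<bar>s\<bar> < t" using s(1) q by (simp add: algebra_simps)
    have "z - (w - s *\<^sub>R N) = (t + s) *\<^sub>R N" using xy by (simp add: w_def algebra_simps)
    then have "dist_F \<Omega> z \<le> t + s"
      using dist_F_le[OF s(3), of z] \<open>\<bar>s\<bar> < t\<close> by (simp add: polar_scale polN)
    also have "\<dots> \<le> t + G w + 2 * L * \<bar>G w\<bar> * q" using s(2) by simp
    also have "2 * L * \<bar>G w\<bar> * q \<le> (\<epsilon> / 2) * q\<^sup>2 + C * (G w)\<^sup>2"
    proof -
      have "0 \<le> (\<epsilon> / 2) * (q - 2 * L * \<bar>G w\<bar> / \<epsilon>)\<^sup>2" using \<epsilon> by simp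
      also have "\<dots> = (\<epsilon> / 2) * q\<^sup>2 - 2 * L * \<bar>G w\<bar> * q + C * (G w)\<^sup>2"
        using \<epsilon> by (simp add: C_def power2_eq_square field_simps)
      finally show ?thesis by simp
    qed
    finally have "dist_F \<Omega> z \<le> t + G w + (\<epsilon> / 2) * q\<^sup>2 + C * (G w)\<^sup>2" by simp
    moreover have "\<psi> z = t + G w + \<epsilon> * q\<^sup>2 + C * (G w)\<^sup>2"
      by (simp add: \<psi>_def w_def q_def dot_square_norm)
    ultimately show ?thesis by (simp add: q_def[symmetric] field_simps)
  qed
  have "\<forall>z\<in>ball x \<rho>. grad \<psi> z \<noteq> 0 \<and> F (grad \<psi> z) \<ge> 1 - \<eta> \<and> divergence (\<lambda>z. grad F (grad \<psi> z)) z \<le> \<eta> \<and>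
      \<psi> z \<ge> dist_F \<Omega> z + (\<epsilon> / 2) * (norm (z - x))\<^sup>2"
  proof
    fix z assume z: "z \<in> ball x \<rho>"
    then have "z \<in> W" using \<rho>1 by (auto simp: \<rho>_def)
    then show "grad \<psi> z \<noteq> 0 \<and> F (grad \<psi> z) \<ge> 1 - \<eta> \<and> divergence (\<lambda>z. grad F (grad \<psi> z)) z \<le> \<eta> \<and>
      \<psi> z \<ge> dist_F \<Omega> z + (\<epsilon> / 2) * (norm (z - x))\<^sup>2"
      using above[OF z] by (simp add: grad\<psi> W_def U_def)
  qed
  moreover have "\<psi> x = dist_F \<Omega> x" by (simp add: \<psi>_def G0 near(2) t_def)
  moreover have "\<psi> differentiable (at z)" for z using \<psi>P by (rule differentiableI)
  moreover have "Ck_on 1 UNIV (grad \<psi>)" using PC1 grad\<psi> by simp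
  moreover have "\<epsilon> / 2 > 0" using \<epsilon> by simp
  ultimately show ?thesis using \<rho> by blast
qed

end

section \<open>Gluing the barriers\<close>

lemma has_real_derivative_max_powr:
  assumes p: "1 < (p::real)"
  shows "((\<lambda>s::real. (max 0 s) powr p) has_real_derivative p * (max 0 s) powr (p - 1)) (at s)"
proof -
  consider "s < 0" | "s > 0" | "s = 0" by linarith
  then show ?thesis
  proof cases
    case 1
    have "((\<lambda>s::real. 0) has_real_derivative 0) (at s)" by simp
    then have "((\<lambda>s::real. (max 0 s) powr p) has_real_derivative 0) (at s)"
      by (rule has_field_derivative_transform_within_open[where S = "{..<0}"]) (use 1 in auto)
    then show ?thesis using 1 by simp
  next
    case 2
    have "((\<lambda>s::real. s powr p) has_real_derivative p * s powr (p - 1)) (at s)"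
      using has_real_derivative_powr[OF 2] .
    then have "((\<lambda>s::real. (max 0 s) powr p) has_real_derivative p * s powr (p - 1)) (at s)"
      by (rule has_field_derivative_transform_within_open[where S = "{0<..}"]) (use 2 in auto)
    then show ?thesis using 2 by simp
  next
    case 3
    have "((\<lambda>h::real. (max 0 h) powr p / h) \<longlongrightarrow> 0) (at 0)"
    proof (rule tendsto_0_le[where K = 1])
      have "((\<lambda>h::real. \<bar>h\<bar> powr (p - 1)) \<longlongrightarrow> \<bar>0\<bar> powr (p - 1)) (at 0)"
        using p by (intro tendsto_powr' tendsto_intros) auto
      then show "((\<lambda>h::real. \<bar>h\<bar> powr (p - 1)) \<longlongrightarrow> 0) (at 0)" by simp
      have "norm ((max 0 h) powr p / h) \<le> norm (\<bar>h\<bar> powr (p - 1)) * 1" for h :: real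
        using powr_mult_base[of h "p - 1"] by (cases "h > 0") (auto simp: max_def field_simps)
      then show "\<forall>\<^sub>F h in at (0::real). norm ((max 0 h) powr p / h) \<le> norm (\<bar>h\<bar> powr (p - 1)) * 1"
        by (rule always_eventually[OF allI])
    qed
    then show ?thesis using 3 p by (simp add: DERIV_def)
  qed
qed

lemma has_real_derivative_max_sq:
  "((\<lambda>s::real. (max 0 s)\<^sup>2) has_real_derivative 2 * max 0 s) (at s)"
  using has_real_derivative_max_powr[of 2 s] by simp

text \<open>The quotient A/(A + B) of squared positive parts is C^1; its denominator never vanishes
  because \<alpha> < \<beta>.\<close>

lemma cutoff_exists:
  fixes \<alpha> \<beta> :: real
  assumes "\<alpha> < \<beta>"
  shows "\<exists>G G' :: real \<Rightarrow> real. (\<forall>s. (G has_real_derivative G' s) (at s)) \<and> continuous_on UNIV G' \<and> (\<forall>s. G' s \<le> 0) \<and>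
    (\<forall>s. 0 \<le> G s \<and> G s \<le> 1) \<and> (\<forall>s\<le>\<alpha>. G s = 1) \<and> (\<forall>s\<ge>\<beta>. G s = 0) \<and> (\<forall>s<\<alpha>. G' s = 0) \<and> (\<forall>s\<ge>\<beta>. G' s = 0)"
proof -
  define A B where "A s = (max 0 (\<beta> - s))\<^sup>2" and "B s = (max 0 (s - \<alpha>))\<^sup>2" for s
  define A' B' where "A' s = - 2 * max 0 (\<beta> - s)" and "B' s = 2 * max 0 (s - \<alpha>)" for s
  have A': "(A has_real_derivative A' s) (at s)" for s
  proof -
    have "((\<lambda>s. \<beta> - s) has_real_derivative - 1) (at s)" by (auto intro!: derivative_eq_intros)
    from DERIV_chain2[OF has_real_derivative_max_sq this] show ?thesis
      by (simp add: A_def[abs_def] A'_def)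
  qed
  have B': "(B has_real_derivative B' s) (at s)" for s
  proof -
    have "((\<lambda>s. s - \<alpha>) has_real_derivative 1) (at s)" by (auto intro!: derivative_eq_intros)
    from DERIV_chain2[OF has_real_derivative_max_sq this] show ?thesis
      by (simp add: B_def[abs_def] B'_def)
  qed
  have pos: "A s + B s > 0" for s
  proof (cases "s < \<beta>")
    case True
    then have "A s > 0" by (simp add: A_def)
    then show ?thesis by (simp add: B_def add_pos_nonneg)
  next
    case False
    then have "B s > 0" using assms by (simp add: B_def)
    then show ?thesis by (simp add: A_def add_nonneg_pos)
  qed
  define G where "G s = A s / (A s + B s)" for s
  define G' where "G' s = (A' s * B s - A s * B' s) / (A s + B s)\<^sup>2" for s
  show ?thesis
  proof (rule exI[of _ G], rule exI[of _ G'], intro conjI allI impI)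
    show "(G has_real_derivative G' s) (at s)" for s
    proof -
      have "(G has_real_derivative (A' s * (A s + B s) - A s * (A' s + B' s)) / ((A s + B s) * (A s + B s))) (at s)"
        unfolding G_def by (intro DERIV_divide DERIV_add A' B') (use pos[of s] in simp)
      then show ?thesis by (simp add: G'_def power2_eq_square algebra_simps)
    qed
    have c: "continuous_on UNIV A" "continuous_on UNIV B" "continuous_on UNIV A'" "continuous_on UNIV B'"
      unfolding A_def B_def A'_def B'_def by (intro continuous_intros)+
    show "continuous_on UNIV G'"
      unfolding G'_def by (intro continuous_intros c) (use pos in \<open>auto simp: less_imp_neq[symmetric]\<close>)
    show "G' s \<le> 0" for s
      unfolding G'_def
      by (intro divide_nonpos_nonneg) (auto simp: A'_def B'_def A_def B_def mult_nonneg_nonneg intro: order_trans[of _ 0])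
    show "0 \<le> G s" "G s \<le> 1" for s
      using pos[of s] by (auto simp: G_def A_def B_def intro!: divide_nonneg_pos)
    show "G s = 1" if "s \<le> \<alpha>" for s
      using that pos[of s] by (simp add: G_def B_def)
    show "G s = 0" if "\<beta> \<le> s" for s using that by (simp add: G_def A_def)
    show "G' s = 0" if "s < \<alpha>" for s using that by (simp add: G'_def B_def B'_def)
    show "G' s = 0" if "\<beta> \<le> s" for s using that by (simp add: G'_def A_def A'_def)
  qed
qed

text \<open>The cutoff is applied to the squared Euclidean distance, which is smooth also at the
  centre.\<close>

lemma bump_exists:
  fixes x :: "real^'n"
  assumes "\<rho> > 0"
  shows "\<exists>\<zeta>. Ck_on 1 UNIV \<zeta> \<and> (\<forall>z. 0 \<le> \<zeta> z \<and> \<zeta> z \<le> (1::real)) \<and>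
    (\<forall>z. norm (z - x) \<le> \<rho> / 2 \<longrightarrow> \<zeta> z = 1) \<and> (\<forall>z. 3 * \<rho> / 4 \<le> norm (z - x) \<longrightarrow> \<zeta> z = 0)"
proof -
  have "(\<rho> / 2)\<^sup>2 < (3 * \<rho> / 4)\<^sup>2" using assms by (intro power_strict_mono) auto
  from cutoff_exists[OF this] obtain G G' :: "real \<Rightarrow> real" where
    G: "\<And>s. (G has_real_derivative G' s) (at s)" "continuous_on UNIV G'" "\<And>s. 0 \<le> G s \<and> G s \<le> 1"
      "\<And>s. s \<le> (\<rho> / 2)\<^sup>2 \<Longrightarrow> G s = 1" "\<And>s. (3 * \<rho> / 4)\<^sup>2 \<le> s \<Longrightarrow> G s = 0"
    by blast
  have "Ck_on 1 UNIV (\<lambda>z. G ((z - x) \<bullet> (z - x)))"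
    by (intro Ck1_real_comp[OF _ UNIV_I G(1,2)] Ck1_inner Ck1_diff Ck1_ident Ck1_const)
  then show ?thesis
    using G(3-5) assms
    by (intro exI[of _ "\<lambda>z. G ((z - x) \<bullet> (z - x))"])
      (auto simp: dot_square_norm simp del: Ck_on.simps One_nat_def power_divide intro!: G power_mono)
qed

lemma grad_zero_of_locally_const:
  fixes f :: "real^'n \<Rightarrow> real"
  assumes "open U" "z \<in> U" "\<And>w. w \<in> U \<Longrightarrow> f w = c"
  shows "grad f z = 0"
proof (rule grad_eq)
  have "((\<lambda>_. c) has_derivative (\<lambda>h. 0 \<bullet> h)) (at z)" by simp
  then show "(f has_derivative (\<lambda>h. 0 \<bullet> h)) (at z)"
    by (rule has_derivative_transform_within_open[OF _ assms(1,2)]) (simp add: assms(3))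
qed

context C2_norm
begin

text \<open>Apart from the terms with \<open>e\<close>, differentiating the weights \<open>w/S\<close> contributes \<open>- 1/\<tau>\<close> times the covariance of \<open>P\<close> and \<open>X\<close>
  under these weights. It is nonnegative, as \<open>X\<close> is a subgradient of \<open>F\<close> at \<open>P\<close>.\<close>
lemma softmin_divergence_bound:
  fixes P X e :: "'k \<Rightarrow> real^'n" and w \<delta> :: "'k \<Rightarrow> real"
  assumes fin: "finite I" and w0: "\<And>k. k \<in> I \<Longrightarrow> w k \<ge> 0" and S: "S = (\<Sum>k\<in>I. w k)" "S > 0" and \<tau>: "\<tau> > 0"
    and X: "\<And>k \<xi>. k \<in> I \<Longrightarrow> w k \<noteq> 0 \<or> e k \<noteq> 0 \<Longrightarrow> \<bar>X k \<bullet> \<xi>\<bar> \<le> F \<xi>"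
    and P: "\<And>k. k \<in> I \<Longrightarrow> w k \<noteq> 0 \<Longrightarrow> X k \<bullet> P k = F (P k)" "\<And>k. k \<in> I \<Longrightarrow> w k \<noteq> 0 \<Longrightarrow> 1 - \<eta> \<le> F (P k)"
    and \<delta>: "\<And>k. k \<in> I \<Longrightarrow> w k \<noteq> 0 \<Longrightarrow> \<delta> k \<le> \<eta>"
    and e: "\<And>k. k \<in> I \<Longrightarrow> F (e k) \<le> S * \<theta>"
    and f: "f \<ge> 0" "f' \<le> 0" "0 \<le> \<tau> * f' + f"
  shows "- ((\<tau> * f' + f) / S\<^sup>2) * ((\<Sum>k\<in>I. e k - (w k / \<tau>) *\<^sub>R P k) \<bullet> (\<Sum>k\<in>I. w k *\<^sub>R X k))
      + (f / S) * (\<Sum>k\<in>I. (e k - (w k / \<tau>) *\<^sub>R P k) \<bullet> X k + w k * \<delta> k)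
    \<le> f' * (1 - \<eta>) + f * \<eta> + 2 * f * card I * \<theta>"
proof -
  define Y where "Y = (\<Sum>k\<in>I. w k *\<^sub>R X k)"
  define M where "M = (\<Sum>k\<in>I. w k *\<^sub>R P k)"
  define E where "E = (\<Sum>k\<in>I. e k)"
  define A where "A = (\<Sum>k\<in>I. w k * (P k \<bullet> X k))"
  define B where "B = (\<Sum>k\<in>I. e k \<bullet> X k)"
  define \<Delta> where "\<Delta> = (\<Sum>k\<in>I. w k * \<delta> k)"
  define g where "g = \<tau> * f' + f"
  have g: "0 \<le> g" "g \<le> f" using f \<tau> by (auto simp: g_def mult_nonneg_nonpos)
  have wX: "\<bar>w k * (X k \<bullet> \<xi>)\<bar> \<le> w k * F \<xi>" if "k \<in> I" for k \<xi>
    using X[OF that, of \<xi>] w0[OF that] by (cases "w k = 0") (auto simp: abs_mult)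
  have YF: "\<bar>Y \<bullet> \<xi>\<bar> \<le> S * F \<xi>" for \<xi>
  proof -
    have "\<bar>Y \<bullet> \<xi>\<bar> \<le> (\<Sum>k\<in>I. \<bar>w k * (X k \<bullet> \<xi>)\<bar>)"
      by (simp add: Y_def inner_sum_left)
    also have "\<dots> \<le> (\<Sum>k\<in>I. w k * F \<xi>)" by (intro sum_mono wX)
    finally show ?thesis by (simp add: S sum_distrib_right)
  qed
  \<comment> \<open>The mean Y/S lies in the polar unit ball, so its product with \<open>P k\<close>
    is at most \<open>F (P k)\<close>, which is \<open>P k \<bullet> X k\<close>. Summed with the
    weights, this is the sign of the covariance.\<close>
  have MY: "M \<bullet> Y \<le> S * A"
  proof -
    have "M \<bullet> Y = (\<Sum>k\<in>I. w k * (Y \<bullet> P k))"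
      by (simp add: M_def inner_sum_left) (simp add: inner_commute)
    also have "\<dots> \<le> (\<Sum>k\<in>I. w k * (S * (P k \<bullet> X k)))"
    proof (rule sum_mono)
      fix k assume k: "k \<in> I"
      show "w k * (Y \<bullet> P k) \<le> w k * (S * (P k \<bullet> X k))"
      proof (cases "w k = 0")
        case False
        then show ?thesis using YF[of "P k"] P(1)[OF k] w0[OF k]
          by (intro mult_left_mono) (auto simp: inner_commute)
      qed simp
    qed
    also have "\<dots> = S * A" by (simp add: A_def sum_distrib_left mult_ac)
    finally show ?thesis .
  qed
  have A: "A \<ge> (1 - \<eta>) * S"
  proof -
    have "(1 - \<eta>) * S = (\<Sum>k\<in>I. w k * (1 - \<eta>))" by (simp add: S(1) sum_distrib_left mult.commute)
    also have "\<dots> \<le> A" unfolding A_def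
    proof (rule sum_mono)
      fix k assume k: "k \<in> I"
      show "w k * (1 - \<eta>) \<le> w k * (P k \<bullet> X k)"
        using P[OF k] w0[OF k] by (cases "w k = 0") (auto simp: inner_commute intro!: mult_left_mono)
    qed
    finally show ?thesis .
  qed
  have \<Delta>: "\<Delta> \<le> \<eta> * S"
  proof -
    have "\<Delta> \<le> (\<Sum>k\<in>I. w k * \<eta>)" unfolding \<Delta>_def
    proof (rule sum_mono)
      fix k assume k: "k \<in> I"
      show "w k * \<delta> k \<le> w k * \<eta>"
        using \<delta>[OF k] w0[OF k] by (cases "w k = 0") (auto intro!: mult_left_mono)
    qed
    then show ?thesis by (simp add: S(1) sum_distrib_left mult.commute)
  qed
  have B: "\<bar>B\<bar> \<le> card I * (S * \<theta>)"
  proof -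
    have "\<bar>B\<bar> \<le> (\<Sum>k\<in>I. \<bar>e k \<bullet> X k\<bar>)" unfolding B_def by (rule sum_abs)
    also have "\<dots> \<le> (\<Sum>k\<in>I. S * \<theta>)"
    proof (rule sum_mono)
      fix k assume k: "k \<in> I"
      show "\<bar>e k \<bullet> X k\<bar> \<le> S * \<theta>"
        using X[OF k, of "e k"] e[OF k] F_zero by (cases "e k = 0") (auto simp: inner_commute)
    qed
    finally show ?thesis by simp
  qed
  have EY: "\<bar>E \<bullet> Y\<bar> \<le> S * (card I * (S * \<theta>))"
  proof -
    have "F E \<le> (\<Sum>k\<in>I. S * \<theta>)"
      unfolding E_def by (rule order_trans[OF F_sum_le sum_mono[OF e]])
    then have "S * F E \<le> S * (card I * (S * \<theta>))" using S(2) by (intro mult_left_mono) auto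
    then show ?thesis using YF[of E] by (simp add: inner_commute)
  qed
  have s1: "(\<Sum>k\<in>I. e k - (w k / \<tau>) *\<^sub>R P k) = E - (1 / \<tau>) *\<^sub>R M"
    by (simp add: E_def M_def sum_subtractf scaleR_sum_right)
  have s2: "(\<Sum>k\<in>I. (e k - (w k / \<tau>) *\<^sub>R P k) \<bullet> X k + w k * \<delta> k) = B - A / \<tau> + \<Delta>"
    by (simp add: B_def A_def \<Delta>_def inner_diff_left sum.distrib sum_subtractf sum_divide_distrib)
  have "- (g / S\<^sup>2) * ((E - (1 / \<tau>) *\<^sub>R M) \<bullet> Y) + (f / S) * (B - A / \<tau> + \<Delta>)
      = g / S\<^sup>2 * (- (E \<bullet> Y)) + g / (S\<^sup>2 * \<tau>) * (M \<bullet> Y) + f / S * B - f / (S * \<tau>) * A + f / S * \<Delta>"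
    using S \<tau> by (simp add: inner_diff_left algebra_simps divide_simps)
  also have "\<dots> \<le> g / S\<^sup>2 * (S * (card I * (S * \<theta>))) + g / (S\<^sup>2 * \<tau>) * (S * A) + f / S * (card I * (S * \<theta>)) - f / (S * \<tau>) * A + f / S * (\<eta> * S)"
    using EY MY B \<Delta> g f S \<tau> by (intro add_mono diff_mono mult_left_mono) auto
  also have "\<dots> = g * card I * \<theta> + f * card I * \<theta> + (g - f) / (S * \<tau>) * A + f * \<eta>"
    using S \<tau> by (simp add: divide_simps power2_eq_square) (simp add: algebra_simps)
  \<comment> \<open>The two terms of order 1/\<tau> have combined to g - f = \<tau> f', which
    cancels the 1/\<tau>.\<close>
  also have "(g - f) / (S * \<tau>) * A = f' * (A / S)"
    using \<tau> S by (simp add: g_def)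
  also have "\<dots> \<le> f' * (1 - \<eta>)"
    using A S f by (intro mult_left_mono_neg) (auto simp: field_simps)
  also have "g * card I * \<theta> \<le> f * card I * \<theta>"
  \<comment> \<open>Nonnegativity of \<open>\<theta>\<close> is read off from the bound on
    \<open>e\<close> at some index, so the empty index set is treated apart.\<close>
  proof (cases "I = {}")
    case False
    then obtain k where "k \<in> I" by blast
    then have "0 \<le> S * \<theta>" using e F_nonneg order_trans by blast
    then have "\<theta> \<ge> 0" using S by (simp add: zero_le_mult_iff)
    then show ?thesis using g by (intro mult_right_mono) auto
  qed simp
  finally show ?thesis unfolding s1 s2 Y_def[symmetric] g_def by (simp add: mult_ac)
qed

text \<open>The barrier is lowered by a constant, so that it lies below the distance near \<open>x\<close> but stays above it by \<open>b\<close> where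
  the cutoff \<open>\<zeta>\<close> is not locally constant; there its weight is then exponentially small.\<close>
definition barrier_piece ::
  "(real^'n) set \<Rightarrow> real \<Rightarrow> real \<Rightarrow> real^'n \<Rightarrow> (real^'n \<Rightarrow> real) \<Rightarrow> (real^'n \<Rightarrow> real) \<Rightarrow> real \<Rightarrow> real \<Rightarrow> (real^'n) set \<Rightarrow> bool" where
  "barrier_piece \<Omega> d0 \<eta> x \<psi> \<zeta> \<rho> b A \<longleftrightarrow> \<rho> > 0 \<and> b > 0 \<and> open A \<and> x \<in> A \<and> Ck_on 1 UNIV \<zeta> \<and> Ck_on 1 UNIV \<psi> \<and>
    Ck_on 1 (ball x \<rho>) (\<lambda>z. grad F (grad \<psi> z)) \<and>
    (\<forall>z. 0 \<le> \<zeta> z \<and> \<zeta> z \<le> 1) \<and> (\<forall>z. 3 * \<rho> / 4 \<le> norm (z - x) \<longrightarrow> \<zeta> z = 0) \<and>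
    (\<forall>z\<in>ball x \<rho>. grad \<psi> z \<noteq> 0 \<and> 1 - \<eta> \<le> F (grad \<psi> z) \<and> divergence (\<lambda>z. grad F (grad \<psi> z)) z \<le> \<eta> \<and> d0 / 2 \<le> \<psi> z) \<and>
    (\<forall>z\<in>A. \<zeta> z = 1 \<and> \<psi> z < dist_F \<Omega> z) \<and>
    (\<forall>z. grad \<zeta> z \<noteq> 0 \<longrightarrow> z \<in> ball x \<rho> \<and> dist_F \<Omega> z + b \<le> \<psi> z)"

lemma barrier_piece_exists:
  assumes op: "open \<Omega>" and nU: "\<Omega> \<noteq> UNIV" and bd: "Ck_boundary 2 \<Omega>"
    and curv: "\<And>y. y \<in> frontier \<Omega> \<Longrightarrow> mean_curvature_F F \<Omega> y \<ge> 0"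
    and x: "x \<in> \<Omega>" and \<eta>: "\<eta> > 0" and d0: "0 < d0" "d0 \<le> dist_F \<Omega> x"
  shows "\<exists>\<psi> \<zeta> \<rho> b A. barrier_piece \<Omega> d0 \<eta> x \<psi> \<zeta> \<rho> b A"
proof -
  obtain \<psi> \<rho>0 c where \<rho>0: "\<rho>0 > 0" and c: "c > 0" and \<psi>x: "\<psi> x = dist_F \<Omega> x" and \<psi>d: "\<And>z. \<psi> differentiable (at z)"
    and \<psi>C: "Ck_on 1 UNIV (grad \<psi>)"
    and \<psi>: "\<And>z. z\<in>ball x \<rho>0 \<Longrightarrow> grad \<psi> z \<noteq> 0 \<and> F (grad \<psi> z) \<ge> 1 - \<eta> \<and> divergence (\<lambda>z. grad F (grad \<psi> z)) z \<le> \<eta> \<and>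
      \<psi> z \<ge> dist_F \<Omega> z + c * (norm (z - x))\<^sup>2"
    using barrier_exists[OF op nU bd curv x \<eta>] by blast
  have "open (dist_F \<Omega> -` {3/4 * d0<..})"
    by (rule open_vimage[OF open_greaterThan dist_F_continuous[OF op nU]])
  moreover have "x \<in> dist_F \<Omega> -` {3/4 * d0<..}" using d0 by simp
  ultimately obtain \<rho>1 where \<rho>1: "\<rho>1 > 0" "ball x \<rho>1 \<subseteq> dist_F \<Omega> -` {3/4 * d0<..}"
    using open_contains_ball by blast
  define \<rho> where "\<rho> = min \<rho>0 \<rho>1"
  \<comment> \<open>The bump varies only where \<open>norm (z - x)\<close> is between \<rho>/2 and
    3\<rho>/4, and there the gap is at least c \<rho>^2/4; lowering by b \<le> c \<rho>^2/8 leaves a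
    gap of at least b. The bound d0/4 keeps the lowered barrier above 3/4 d0 - d0/4 = d0/2.\<close>
  define b where "b = min (c * \<rho>\<^sup>2 / 8) (d0 / 4)"
  have \<rho>: "\<rho> > 0" "ball x \<rho> \<subseteq> ball x \<rho>0" "ball x \<rho> \<subseteq> ball x \<rho>1" using \<rho>0 \<rho>1 by (auto simp: \<rho>_def)
  have b: "b > 0" "b \<le> c * \<rho>\<^sup>2 / 8" "b \<le> d0 / 4" using c \<rho> d0 by (auto simp: b_def)
  obtain \<zeta> :: "real^'n \<Rightarrow> real" where "Ck_on 1 UNIV \<zeta> \<and> (\<forall>z. 0 \<le> \<zeta> z \<and> \<zeta> z \<le> 1) \<and>
    (\<forall>z. norm (z - x) \<le> \<rho> / 2 \<longrightarrow> \<zeta> z = 1) \<and> (\<forall>z. 3 * \<rho> / 4 \<le> norm (z - x) \<longrightarrow> \<zeta> z = 0)"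
    using bump_exists[OF \<rho>(1), of x] by (rule exE)
  then have \<zeta>: "Ck_on 1 UNIV \<zeta>" "\<And>z. 0 \<le> \<zeta> z" "\<And>z. \<zeta> z \<le> 1"
    "\<And>z. norm (z - x) \<le> \<rho> / 2 \<Longrightarrow> \<zeta> z = 1" "\<And>z. 3 * \<rho> / 4 \<le> norm (z - x) \<Longrightarrow> \<zeta> z = 0"
    by (simp_all del: Ck_on.simps One_nat_def)
  define \<phi> where "\<phi> z = \<psi> z - b" for z
  have g\<phi>: "grad \<phi> = grad \<psi>"
  proof
    fix z
    have "(\<phi> has_derivative (\<lambda>h. grad \<psi> z \<bullet> h)) (at z)"
      unfolding \<phi>_def using has_derivative_diff[OF grad_derivative[OF \<psi>d[of z]] has_derivative_const[of b]] by simp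
    then show "grad \<phi> z = grad \<psi> z" by (rule grad_eq)
  qed
  have \<psi>C1: "Ck_on 1 UNIV \<psi>"
    by (rule Ck1I[OF grad_derivative[OF \<psi>d]]) (intro continuous_intros continuous_on_subset[OF Ck1D(3)[OF \<psi>C]], simp)
  define A where "A = ball x (\<rho>/2) \<inter> {z. \<phi> z < dist_F \<Omega> z}"
  have "open {z. \<phi> z < dist_F \<Omega> z}"
    unfolding \<phi>_def by (intro open_Collect_less dist_F_continuous[OF op nU] continuous_intros Ck1D(3)[OF \<psi>C1])
  then have "open A" by (auto simp: A_def)
  moreover have "x \<in> A" using \<rho> b \<psi>x by (simp add: A_def \<phi>_def)
  moreover have "Ck_on 1 UNIV \<phi>" unfolding \<phi>_def by (intro Ck1_diff \<psi>C1 Ck1_const)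
  moreover have "Ck_on 1 (ball x \<rho>) (\<lambda>z. grad F (grad \<phi> z))"
    unfolding g\<phi> by (intro F_grad_composition_C1 Ck1_subset[OF \<psi>C]) (use \<psi> \<rho> in auto)
  moreover have "grad \<phi> z \<noteq> 0 \<and> 1 - \<eta> \<le> F (grad \<phi> z) \<and> divergence (\<lambda>z. grad F (grad \<phi> z)) z \<le> \<eta> \<and> d0 / 2 \<le> \<phi> z"
    if z: "z \<in> ball x \<rho>" for z
  proof -
    have "z \<in> dist_F \<Omega> -` {3/4 * d0<..}" using z \<rho> \<rho>1 by blast
    then have "3/4 * d0 < dist_F \<Omega> z" by simp
    moreover have "\<psi> z \<ge> dist_F \<Omega> z + c * (norm (z - x))\<^sup>2" using \<psi> z \<rho> by blast
    moreover have "c * (norm (z - x))\<^sup>2 \<ge> 0" using c by simp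
    ultimately have "d0 / 2 \<le> \<phi> z" using b by (simp add: \<phi>_def)
    then show ?thesis using \<psi>[of z] z \<rho> by (auto simp: g\<phi>)
  qed
  moreover have "z \<in> ball x \<rho> \<and> dist_F \<Omega> z + b \<le> \<phi> z" if g: "grad \<zeta> z \<noteq> 0" for z
  proof -
    have 1: "norm (z - x) \<ge> \<rho> / 2"
    proof (rule ccontr)
      assume "\<not> ?thesis"
      then have "z \<in> ball x (\<rho>/2)" by (simp add: dist_norm norm_minus_commute)
      then have "grad \<zeta> z = 0"
        by (rule grad_zero_of_locally_const[where c = 1, OF open_ball]) (auto intro!: \<zeta>(4) simp: dist_norm norm_minus_commute)
      then show False using g by simp
    qed
    have 2: "norm (z - x) \<le> 3 * \<rho> / 4"
    proof (rule ccontr)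
      assume "\<not> ?thesis"
      then have "z \<in> - cball x (3 * \<rho> / 4)" by (simp add: dist_norm norm_minus_commute)
      then have "grad \<zeta> z = 0"
        by (intro grad_zero_of_locally_const[where c = 0 and U = "- cball x (3 * \<rho> / 4)"]) (auto intro!: \<zeta>(5) simp: dist_norm norm_minus_commute)
      then show False using g by simp
    qed
    then have zb: "z \<in> ball x \<rho>" using \<rho> by (simp add: dist_norm norm_minus_commute)
    have "(\<rho> / 2)\<^sup>2 \<le> (norm (z - x))\<^sup>2" using 1 \<rho> by (intro power_mono) auto
    then have "c * \<rho>\<^sup>2 / 4 \<le> c * (norm (z - x))\<^sup>2" using c by (simp add: power_divide)
    moreover have "\<psi> z \<ge> dist_F \<Omega> z + c * (norm (z - x))\<^sup>2" using \<psi> zb \<rho> by blast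
    ultimately show ?thesis using b zb by (simp add: \<phi>_def)
  qed
  moreover have "\<zeta> z = 1 \<and> \<phi> z < dist_F \<Omega> z" if "z \<in> A" for z
    using that \<zeta>(4)[of z] by (auto simp: A_def dist_norm norm_minus_commute)
  ultimately have "barrier_piece \<Omega> d0 \<eta> x \<phi> \<zeta> \<rho> b A"
    unfolding barrier_piece_def using \<rho>(1) b(1) \<zeta>(1,2,3,5) by (intro conjI allI ballI impI) (simp_all del: Ck_on.simps One_nat_def)
  then show ?thesis by blast
qed


text \<open>\<open>grad F (grad \<psi> z)\<close> is controlled on the ball only, since
  \<open>grad \<psi>\<close> may vanish elsewhere. The weight vanishes beyond three quarters of the
  radius, so the product is C^1 on all of space, and outside the ball both sides of the product rule
  are zero.\<close>

lemma barrier_piece_field: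
  fixes \<tau> :: real
  assumes piece: "barrier_piece \<Omega> d0 \<eta> x \<psi> \<zeta> \<rho> b A"
  defines "w \<equiv> \<lambda>z. \<zeta> z * exp (- \<psi> z / \<tau>)" and "X \<equiv> \<lambda>z. grad F (grad \<psi> z)"
  shows "Ck_on 1 UNIV w" "Ck_on 1 UNIV (\<lambda>z. w z *\<^sub>R X z)"
    "\<And>z. grad w z = exp (- \<psi> z / \<tau>) *\<^sub>R grad \<zeta> z - (w z / \<tau>) *\<^sub>R grad \<psi> z"
    "\<And>z. divergence (\<lambda>z. w z *\<^sub>R X z) z = grad w z \<bullet> X z + w z * divergence X z"
proof -
  have \<rho>: "\<rho> > 0" and \<zeta>C: "Ck_on 1 UNIV \<zeta>" and \<psi>C: "Ck_on 1 UNIV \<psi>" and XC: "Ck_on 1 (ball x \<rho>) X"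
    and \<zeta>0: "\<And>z. 3 * \<rho> / 4 \<le> norm (z - x) \<Longrightarrow> \<zeta> z = 0"
    using piece by (simp_all add: barrier_piece_def X_def del: Ck_on.simps One_nat_def)
  have EC: "Ck_on 1 UNIV (\<lambda>z. exp (- \<psi> z / \<tau>))"
  proof (rule Ck1_real_comp[OF \<psi>C UNIV_I, where q' = "\<lambda>s. exp (- s / \<tau>) * (- 1 / \<tau>)"])
    show "((\<lambda>s. exp (- s / \<tau>)) has_real_derivative exp (- s / \<tau>) * (- 1 / \<tau>)) (at s)" for s
      by (auto intro!: derivative_eq_intros simp: divide_inverse)
    show "continuous_on UNIV (\<lambda>s. exp (- s / \<tau>) * (- 1 / \<tau>))"
      unfolding divide_inverse by (intro continuous_intros)
  qed
  show wC: "Ck_on 1 UNIV w" unfolding w_def by (intro Ck1_mult \<zeta>C EC)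
  define O2 where "O2 = - cball x (3 * \<rho> / 4)"
  have O2: "open O2" "\<And>z. z \<in> O2 \<Longrightarrow> w z = 0"
    using \<zeta>0 by (auto simp: O2_def w_def dist_norm norm_minus_commute)
  have out: "z \<in> O2" if "z \<notin> ball x \<rho>" for z using that \<rho> by (simp add: O2_def)
  have "Ck_on 1 (\<Union>{ball x \<rho>, O2}) (\<lambda>z. w z *\<^sub>R X z)"
  proof (rule Ck1_open_Union)
    fix U assume "U \<in> {ball x \<rho>, O2}"
    then consider "U = ball x \<rho>" | "U = O2" by blast
    then show "Ck_on 1 U (\<lambda>z. w z *\<^sub>R X z)"
    proof cases
      case 1 then show ?thesis by (simp only:) (intro Ck1_scaleR XC Ck1_subset[OF wC], simp)
    next
      case 2 show ?thesis unfolding 2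
        by (rule Ck1_cong[OF Ck1_const[where c = 0] O2(1)]) (simp add: O2(2))
    qed
  qed (use O2 in auto)
  moreover have "\<Union>{ball x \<rho>, O2} = UNIV" using out by blast
  ultimately show "Ck_on 1 UNIV (\<lambda>z. w z *\<^sub>R X z)" by simp
  have gw: "(w has_derivative (\<lambda>h. (exp (- \<psi> z / \<tau>) *\<^sub>R grad \<zeta> z - (w z / \<tau>) *\<^sub>R grad \<psi> z) \<bullet> h)) (at z)" for z
  proof -
    have 1: "(\<zeta> has_derivative (\<lambda>h. grad \<zeta> z \<bullet> h)) (at z)" "(\<psi> has_derivative (\<lambda>h. grad \<psi> z \<bullet> h)) (at z)"
      using grad_derivative Ck1_differentiable[OF \<zeta>C UNIV_I] Ck1_differentiable[OF \<psi>C UNIV_I] by blast+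
    show ?thesis
      unfolding w_def divide_inverse
      by (rule derivative_eq_intros 1 refl)+ (simp add: fun_eq_iff inner_diff_left algebra_simps)
  qed
  show "grad w z = exp (- \<psi> z / \<tau>) *\<^sub>R grad \<zeta> z - (w z / \<tau>) *\<^sub>R grad \<psi> z" for z
    using grad_eq[OF gw] .
  show "divergence (\<lambda>z. w z *\<^sub>R X z) z = grad w z \<bullet> X z + w z * divergence X z" for z
  proof (cases "z \<in> ball x \<rho>")
    case True
    show ?thesis
      by (rule divergence_scaleR[OF grad_derivative[OF Ck1_differentiable[OF wC UNIV_I]] Ck1_differentiable[OF XC True]])
  next
    case False
    have "grad w z = 0" by (rule grad_zero_of_locally_const[OF O2(1) out[OF False] O2(2)])
    moreover have "((\<lambda>z. w z *\<^sub>R X z) has_derivative (\<lambda>h. 0)) (at z)"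
      by (rule has_derivative_transform_within_open[OF has_derivative_const O2(1) out[OF False]]) (simp add: O2(2))
    from divergence_eq[OF this] have "divergence (\<lambda>z. w z *\<^sub>R X z) z = 0" by simp
    ultimately show ?thesis using O2(2)[OF out[OF False]] by simp
  qed
qed

text \<open>The smooth function \<open>D\<close> replaces the distance. All bounds are stated at
  \<open>D z\<close>, so that a differential equation for \<open>f\<close> applies at whatever value
  \<open>D\<close> takes; the last bound says \<open>polar F (V z) \<le> f (D z)\<close>.\<close>

lemma barta_field_exists:
  assumes op: "open \<Omega>" and nU: "\<Omega> \<noteq> UNIV" and bd: "Ck_boundary 2 \<Omega>"
    and curv: "\<And>y. y \<in> frontier \<Omega> \<Longrightarrow> mean_curvature_F F \<Omega> y \<ge> 0"
    and Kc: "compact Kc" "Kc \<subseteq> \<Omega>" and R: "\<And>z. dist_F \<Omega> z \<le> R" "R < R'"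
    and f: "\<And>s. 0 < s \<Longrightarrow> s < R' \<Longrightarrow> (f has_real_derivative f' s) (at s)" "continuous_on {0<..<R'} f'"
      "\<And>s. 0 < s \<Longrightarrow> s < R' \<Longrightarrow> 0 < f s" "\<And>s. 0 < s \<Longrightarrow> s < R' \<Longrightarrow> f' s \<le> 0"
    and \<epsilon>: "\<epsilon> > 0"
  obtains U V D where "open U" "Kc \<subseteq> U" "Ck_on 1 U V" "\<And>z. z \<in> U \<Longrightarrow> 0 < D z \<and> D z < R'"
    "\<And>z. z \<in> U \<Longrightarrow> divergence V z \<le> f' (D z) + \<epsilon>"
    "\<And>z \<xi>. z \<in> U \<Longrightarrow> \<bar>V z \<bullet> \<xi>\<bar> \<le> f (D z) * F \<xi>"
proof (cases "Kc = {}")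
  case True
  show ?thesis
    by (rule that[of "{}" "\<lambda>_. 0" "\<lambda>_. 0"]) (use True in \<open>auto simp: One_nat_def\<close>)
next
  case False
  obtain x1 where x1: "x1 \<in> Kc" "\<And>x. x \<in> Kc \<Longrightarrow> dist_F \<Omega> x1 \<le> dist_F \<Omega> x"
    using continuous_attains_inf[OF Kc(1) False dist_F_continuous[OF op nU]] by blast
  define d0 where "d0 = dist_F \<Omega> x1"
  have d0: "0 < d0" using dist_F_pos[OF op nU] x1 Kc by (auto simp: d0_def)
  have d0R: "d0 \<le> R" using R by (simp add: d0_def)
  \<comment> \<open>This will contain the values of \<open>D\<close>. Some lowered barrier lies
    below the distance, which gives the upper end. All active barriers are at least d0/2, and the
    soft minimum loses at most \<tau> ln m < d0/4, which gives the lower end.\<close>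
  define J where "J = {d0 / 4..R}"
  have J: "compact J" "J \<noteq> {}" "J \<subseteq> {0<..<R'}" using d0 d0R R(2) by (auto simp: J_def)
  have fcont: "continuous_on {0<..<R'} f"
    using f(1) by (intro continuous_at_imp_continuous_on ballI DERIV_isCont) auto
  obtain s1 where s1: "s1 \<in> J" "\<And>s. s \<in> J \<Longrightarrow> f s1 \<le> f s"
    using continuous_attains_inf[OF J(1,2) continuous_on_subset[OF fcont J(3)]] by blast
  define fmin where "fmin = f s1"
  have fmin: "fmin > 0" using f(3) s1 J(3) by (auto simp: fmin_def)
  have "bounded (f ` J)" "bounded (f' ` J)"
    by (intro compact_imp_bounded compact_continuous_image J continuous_on_subset[OF fcont J(3)] continuous_on_subset[OF f(2) J(3)])+
  then obtain L1 L2 where L12: "\<And>s. s \<in> J \<Longrightarrow> \<bar>f s\<bar> \<le> L1" "\<And>s. s \<in> J \<Longrightarrow> \<bar>f' s\<bar> \<le> L2"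
    unfolding bounded_iff by (metis image_eqI real_norm_def)
  define L where "L = max L1 L2 + 1"
  have L: "\<And>s. s \<in> J \<Longrightarrow> \<bar>f s\<bar> \<le> L" "\<And>s. s \<in> J \<Longrightarrow> \<bar>f' s\<bar> \<le> L" "L > 0"
    using L12 s1(1) by (force simp: L_def)+
  \<comment> \<open>Two errors of size at most L \<eta> use up half of \<epsilon>; the derivatives
    of the cutoffs use the other half.\<close>
  define \<eta> where "\<eta> = \<epsilon> / (4 * L)"
  have \<eta>: "\<eta> > 0" "L * \<eta> = \<epsilon> / 4" using \<epsilon> L by (auto simp: \<eta>_def)
  have "\<forall>x\<in>Kc. \<exists>\<psi> \<zeta> \<rho> b A. barrier_piece \<Omega> d0 \<eta> x \<psi> \<zeta> \<rho> b A"
    using barrier_piece_exists[OF op nU bd curv _ \<eta>(1) d0] x1(2) Kc(2) d0_def by blast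
  then obtain \<psi> \<zeta> \<rho> b A where "\<forall>x\<in>Kc. barrier_piece \<Omega> d0 \<eta> x (\<psi> x) (\<zeta> x) (\<rho> x) (b x) (A x)"
    unfolding bchoice_iff by (elim exE)
  then have piece: "barrier_piece \<Omega> d0 \<eta> x (\<psi> x) (\<zeta> x) (\<rho> x) (b x) (A x)" if "x \<in> Kc" for x
    using that by blast
  have A: "\<And>x. x \<in> Kc \<Longrightarrow> open (A x)" "Kc \<subseteq> (\<Union>x\<in>Kc. A x)"
    using piece by (auto simp: barrier_piece_def)
  obtain I where I: "I \<subseteq> Kc" "finite I" "Kc \<subseteq> (\<Union>x\<in>I. A x)"
    using compactE_image[OF Kc(1), of Kc A] A by metis
  have In: "I \<noteq> {}" using I False by auto
  define m where "m = real (card I)"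
  have m: "m \<ge> 1" using In I(2) by (simp add: m_def Suc_leI card_gt_0_iff)
  have pI: "barrier_piece \<Omega> d0 \<eta> k (\<psi> k) (\<zeta> k) (\<rho> k) (b k) (A k)" if "k \<in> I" for k
    using piece that I(1) by blast
  define bm where "bm = Min (b ` I)"
  have bm: "bm > 0" "\<And>k. k \<in> I \<Longrightarrow> bm \<le> b k"
    using pI I(2) In by (auto simp: bm_def barrier_piece_def)
  have "\<exists>C\<ge>0. \<forall>z. F (grad (\<zeta> k) z) \<le> C" if k: "k \<in> I" for k
  proof -
    have \<zeta>C: "Ck_on 1 UNIV (\<zeta> k)" and sup: "\<And>z. grad (\<zeta> k) z \<noteq> 0 \<Longrightarrow> z \<in> ball k (\<rho> k)"
      using pI[OF k] by (simp_all add: barrier_piece_def del: Ck_on.simps One_nat_def)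
    have "compact ((\<lambda>z. F (grad (\<zeta> k) z)) ` cball k (\<rho> k))"
      by (intro compact_continuous_image continuous_on_compose2[OF F_continuous[of UNIV]]
          continuous_on_subset[OF continuous_on_grad[OF \<zeta>C]]) auto
    then obtain C where C: "\<And>z. z \<in> cball k (\<rho> k) \<Longrightarrow> \<bar>F (grad (\<zeta> k) z)\<bar> \<le> C"
      by (force dest!: compact_imp_bounded simp: bounded_iff)
    have "F (grad (\<zeta> k) z) \<le> max C 0" for z
      using C[of z] sup[of z] F_zero by (cases "grad (\<zeta> k) z = 0") force+
    then show ?thesis by (intro exI[of _ "max C 0"]) auto
  qed
  then obtain C where C: "\<And>k. k \<in> I \<Longrightarrow> C k \<ge> 0" "\<And>k z. k \<in> I \<Longrightarrow> F (grad (\<zeta> k) z) \<le> C k"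
    by metis
  define C0 where "C0 = (\<Sum>k\<in>I. C k)"
  have C0: "C0 \<ge> 0" "\<And>k z. k \<in> I \<Longrightarrow> F (grad (\<zeta> k) z) \<le> C0"
    using C I(2) by (auto simp: C0_def sum_nonneg intro: order_trans[OF _ member_le_sum])
  \<comment> \<open>The requirements on \<tau>: \<open>D\<close> stays above d0/4, the combination
    \<tau> f' + f is nonnegative on \<open>J\<close>, and the errors from the cutoffs, exponentially
    small in 1/\<tau>, stay within their share of \<epsilon>.\<close>
  have ev0: "\<forall>\<^sub>F \<tau> in at_right (0::real). \<tau> > 0" by (simp add: eventually_at_right_less)
  have ev1: "\<forall>\<^sub>F \<tau> in at_right 0. \<tau> * ln m < d0 / 4"
    by (rule order_tendstoD(2)[OF tendsto_mult[OF tendsto_ident_at tendsto_const]]) (use d0 in simp)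
  have ev2: "\<forall>\<^sub>F \<tau> in at_right 0. \<tau> * L < fmin"
    by (rule order_tendstoD(2)[OF tendsto_mult[OF tendsto_ident_at tendsto_const]]) (use fmin in simp)
  have "((\<lambda>\<tau>. exp (- bm / \<tau>)) \<longlongrightarrow> 0) (at_right 0)" using bm(1) by real_asymp
  then have "((\<lambda>\<tau>. (4 * m * C0 * L) * exp (- bm / \<tau>)) \<longlongrightarrow> (4 * m * C0 * L) * 0) (at_right 0)"
    by (intro tendsto_intros)
  then have ev3: "\<forall>\<^sub>F \<tau> in at_right 0. (4 * m * C0 * L) * exp (- bm / \<tau>) < \<epsilon>"
    by (rule order_tendstoD(2)) (use \<epsilon> in simp)
  from eventually_conj[OF ev0 eventually_conj[OF ev1 eventually_conj[OF ev2 ev3]]]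
  obtain \<tau> where \<tau>: "\<tau> > 0" "\<tau> * ln m < d0 / 4" "\<tau> * L < fmin" "(4 * m * C0 * L) * exp (- bm / \<tau>) < \<epsilon>"
    using eventually_happens trivial_limit_at_right_real by blast
  define w where "w k z = \<zeta> k z * exp (- \<psi> k z / \<tau>)" for k z
  define X where "X k z = grad F (grad (\<psi> k) z)" for k z
  have wC: "Ck_on 1 UNIV (w k)" and wXC: "Ck_on 1 UNIV (\<lambda>z. w k z *\<^sub>R X k z)"
    and gw: "grad (w k) z = exp (- \<psi> k z / \<tau>) *\<^sub>R grad (\<zeta> k) z - (w k z / \<tau>) *\<^sub>R grad (\<psi> k) z"
    and divw: "divergence (\<lambda>z. w k z *\<^sub>R X k z) z = grad (w k) z \<bullet> X k z + w k z * divergence (X k) z" if "k \<in> I" for k z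
    unfolding w_def[abs_def] X_def[abs_def] using barrier_piece_field[OF pI[OF that], of \<tau>] by blast+
  have w0: "0 \<le> w k z" if "k \<in> I" for k z
    using pI[OF that] by (simp add: w_def barrier_piece_def)
  have in_ball: "z \<in> ball k (\<rho> k)" if "k \<in> I" "w k z \<noteq> 0 \<or> grad (\<zeta> k) z \<noteq> 0" for k z
  proof (cases "grad (\<zeta> k) z = 0")
    case True
    then have "\<zeta> k z \<noteq> 0" using that by (auto simp: w_def)
    then have "\<not> 3 * \<rho> k / 4 \<le> norm (z - k)" and "\<rho> k > 0"
      using pI[OF that(1)] unfolding barrier_piece_def by blast+
    then show ?thesis by (simp add: dist_norm norm_minus_commute)
  next
    case False
    then show ?thesis using pI[OF that(1)] unfolding barrier_piece_def by blast
  qed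
  have good: "grad (\<psi> k) z \<noteq> 0" "1 - \<eta> \<le> F (grad (\<psi> k) z)" "divergence (X k) z \<le> \<eta>" "d0 / 2 \<le> \<psi> k z"
    if "k \<in> I" "w k z \<noteq> 0 \<or> grad (\<zeta> k) z \<noteq> 0" for k z
    using pI[OF that(1)] in_ball[OF that] unfolding barrier_piece_def X_def[abs_def] by blast+
  define S where "S z = (\<Sum>k\<in>I. w k z)" for z
  define Y where "Y z = (\<Sum>k\<in>I. w k z *\<^sub>R X k z)" for z
  have SC: "Ck_on 1 UNIV S" unfolding S_def by (intro Ck1_sum wC)
  have YC: "Ck_on 1 UNIV Y" unfolding Y_def by (intro Ck1_sum wXC)
  define U where "U = (\<Union>x\<in>I. A x)"
  have U: "open U" "Kc \<subseteq> U" using A(1) I by (auto simp: U_def)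
  define D where "D z = - \<tau> * ln (S z)" for z
  \<comment> \<open>On \<open>A k\<close> the cutoff is 1 and the lowered barrier lies strictly
    below the distance, so a single weight already exceeds this exponential.\<close>
  have Slow: "S z > exp (- dist_F \<Omega> z / \<tau>)" if z: "z \<in> U" for z
  proof -
    obtain k where k: "k \<in> I" "z \<in> A k" using z by (auto simp: U_def)
    then have "\<zeta> k z = 1" "\<psi> k z < dist_F \<Omega> z" using pI[OF k(1)] unfolding barrier_piece_def by blast+
    then have "exp (- dist_F \<Omega> z / \<tau>) < w k z" using \<tau>(1) by (simp add: w_def divide_strict_right_mono)
    also have "w k z \<le> S z" unfolding S_def using I(2) k(1) w0 by (intro member_le_sum) auto
    finally show ?thesis .
  qed
  have Spos: "S z > 0" if "z \<in> U" for z using Slow[OF that] exp_gt_zero less_trans by blast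
  have DJ: "D z \<in> J" if z: "z \<in> U" for z
  proof -
    have "- dist_F \<Omega> z / \<tau> < ln (S z)"
      using Slow[OF z] Spos[OF z] by (metis exp_less_cancel_iff exp_ln)
    then have "D z < dist_F \<Omega> z" using \<tau>(1) by (simp add: D_def field_simps)
    then have 1: "D z \<le> R" using R(1)[of z] by simp
    have "w k z \<le> exp (- (d0 / 2) / \<tau>)" if k: "k \<in> I" for k
    proof (cases "w k z = 0")
      case False
      have "w k z \<le> 1 * exp (- \<psi> k z / \<tau>)"
        unfolding w_def using pI[OF k] by (intro mult_right_mono) (simp_all add: barrier_piece_def)
      also have "\<dots> \<le> exp (- (d0 / 2) / \<tau>)"
      proof -
        have "- \<psi> k z / \<tau> \<le> - (d0 / 2) / \<tau>"
          using good(4)[OF k, of z] False \<tau>(1) by (intro divide_right_mono) auto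
        then show ?thesis by (simp only: exp_le_cancel_iff mult_1)
      qed
      finally show ?thesis .
    qed simp
    then have "S z \<le> m * exp (- (d0 / 2) / \<tau>)"
      unfolding S_def m_def by (rule sum_bounded_above)
    then have "ln (S z) \<le> ln (m * exp (- (d0 / 2) / \<tau>))"
      using Spos[OF z] m by simp
    also have "\<dots> = ln m + - (d0 / 2) / \<tau>" using m by (subst ln_mult) auto
    finally have "\<tau> * ln (S z) \<le> \<tau> * ln m - d0 / 2"
      using \<tau>(1) by (simp add: field_simps)
    then have "D z \<ge> d0 / 4" using \<tau>(2) by (simp add: D_def)
    with 1 show ?thesis by (simp add: J_def)
  qed
  define T where "T = {0<..} \<inter> (\<lambda>s. - \<tau> * ln s) -` {0<..<R'}"
  \<comment> \<open>The derivative of s \<mapsto> f(- \<tau> ln s)/s; this is the function of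
    \<open>S\<close> that multiplies \<open>Y\<close> in the field \<open>V\<close>.\<close>
  define q' where "q' s = - ((\<tau> * f' (- \<tau> * ln s) + f (- \<tau> * ln s)) / s\<^sup>2)" for s
  have q: "((\<lambda>s. f (- \<tau> * ln s) / s) has_real_derivative q' s) (at s)" if "s \<in> T" for s
  proof -
    have s: "s > 0" "0 < - \<tau> * ln s" "- \<tau> * ln s < R'" using that by (auto simp: T_def)
    have "((\<lambda>s. - \<tau> * ln s) has_real_derivative - \<tau> / s) (at s)"
      using s by (auto intro!: derivative_eq_intros)
    from DERIV_chain2[OF f(1)[OF s(2,3)] this]
    have "((\<lambda>s. f (- \<tau> * ln s)) has_real_derivative f' (- \<tau> * ln s) * (- \<tau> / s)) (at s)" .
    then have "((\<lambda>s. f (- \<tau> * ln s) / s) has_real_derivative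
        (f' (- \<tau> * ln s) * (- \<tau> / s) * s - f (- \<tau> * ln s) * 1) / (s * s)) (at s)"
      using s by (intro DERIV_divide DERIV_ident) auto
    moreover have "f' (- \<tau> * ln s) * (- \<tau> / s) * s - f (- \<tau> * ln s) * 1 = - (\<tau> * f' (- \<tau> * ln s) + f (- \<tau> * ln s))"
      using s by simp
    ultimately show ?thesis
      unfolding q'_def power2_eq_square minus_divide_left by metis
  qed
  have q'C: "continuous_on T q'"
    unfolding q'_def
    by (intro continuous_intros continuous_on_compose2[OF f(2)] continuous_on_compose2[OF fcont])
      (auto simp: T_def)
  have ST: "S z \<in> T" if "z \<in> U" for z
    using Spos[OF that] DJ[OF that] J(3) by (auto simp: T_def D_def)
  define V where "V z = (f (D z) / S z) *\<^sub>R Y z" for z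
  have qC: "Ck_on 1 U (\<lambda>z. f (D z) / S z)"
    unfolding D_def
    by (rule Ck1_real_comp[where q = "\<lambda>s. f (- \<tau> * ln s) / s", OF Ck1_subset[OF SC] ST q q'C]) auto
  have VC: "Ck_on 1 U V" unfolding V_def using qC Ck1_subset[OF YC, of U] by (intro Ck1_scaleR) auto
  have D0: "0 < D z \<and> D z < R'" if "z \<in> U" for z using DJ[OF that] J(3) by auto
  show ?thesis
  proof (rule that[of U V D])
    show "divergence V z \<le> f' (D z) + \<epsilon>" if z: "z \<in> U" for z
    proof -
      have fD: "f (D z) > 0" "f' (D z) \<le> 0" "f (D z) \<le> L" "\<bar>f' (D z)\<bar> \<le> L" "fmin \<le> f (D z)"
        using f(3,4) D0[OF z] L(1,2)[OF DJ[OF z]] s1(2)[OF DJ[OF z]] by (auto simp: fmin_def)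
      have gS: "grad S z = (\<Sum>k\<in>I. grad (w k) z)"
      proof (rule grad_eq)
        show "(S has_derivative (\<lambda>h. (\<Sum>k\<in>I. grad (w k) z) \<bullet> h)) (at z)"
          unfolding S_def inner_sum_left
          by (intro has_derivative_sum grad_derivative Ck1_differentiable[OF wC]) auto
      qed
      have dq: "((\<lambda>z. f (D z) / S z) has_derivative (\<lambda>h. (q' (S z) *\<^sub>R grad S z) \<bullet> h)) (at z)"
        using has_derivative_compose[OF grad_derivative[OF Ck1_differentiable[OF SC UNIV_I]] q[OF ST[OF z], unfolded has_field_derivative_def]]
        by (simp add: D_def)
      have "divergence V z = (q' (S z) *\<^sub>R grad S z) \<bullet> Y z + (f (D z) / S z) * divergence Y z"
        unfolding V_def by (rule divergence_scaleR[OF dq Ck1_differentiable[OF YC UNIV_I]])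
      also have "divergence Y z = (\<Sum>k\<in>I. grad (w k) z \<bullet> X k z + w k z * divergence (X k) z)"
        unfolding Y_def by (subst divergence_sum) (use Ck1_differentiable[OF wXC UNIV_I] divw in auto)
      finally have dV: "divergence V z = - ((\<tau> * f' (D z) + f (D z)) / (S z)\<^sup>2) * (grad S z \<bullet> Y z)
          + (f (D z) / S z) * (\<Sum>k\<in>I. grad (w k) z \<bullet> X k z + w k z * divergence (X k) z)"
        by (simp add: q'_def D_def)
      define e where "e k = exp (- \<psi> k z / \<tau>) *\<^sub>R grad (\<zeta> k) z" for k
      define \<theta> where "\<theta> = C0 * exp (- bm / \<tau>)"
      \<comment> \<open>Where a cutoff varies, its barrier exceeds the distance by at least
        \<open>bm\<close>, while \<open>S z\<close> is at least exp(- d/\<tau>) with d the distance;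
        the quotient is at most exp(- bm/\<tau>).\<close>
      have e_bound: "F (e k) \<le> S z * \<theta>" if k: "k \<in> I" for k
      proof (cases "grad (\<zeta> k) z = 0")
        case True
        then show ?thesis using F_zero Spos[OF z] C0 by (simp add: e_def \<theta>_def)
      next
        case False
        then have "dist_F \<Omega> z + b k \<le> \<psi> k z"
          using pI[OF k] unfolding barrier_piece_def by blast
        then have "exp (- \<psi> k z / \<tau>) \<le> exp ((- dist_F \<Omega> z - bm) / \<tau>)"
          using bm(2)[OF k] \<tau>(1) by (subst exp_le_cancel_iff, intro divide_right_mono) auto
        also have "\<dots> = exp (- dist_F \<Omega> z / \<tau>) * exp (- bm / \<tau>)"
          by (simp add: exp_add[symmetric] diff_divide_distrib)
        also have "\<dots> \<le> S z * exp (- bm / \<tau>)"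
          using Slow[OF z] by (intro mult_right_mono) auto
        finally have "exp (- \<psi> k z / \<tau>) * F (grad (\<zeta> k) z) \<le> (S z * exp (- bm / \<tau>)) * C0"
          using C0(2)[OF k] F_nonneg Spos[OF z] by (intro mult_mono) auto
        then show ?thesis by (simp add: e_def \<theta>_def hom mult_ac)
      qed
      have "divergence V z \<le> f' (D z) * (1 - \<eta>) + f (D z) * \<eta> + 2 * f (D z) * real (card I) * \<theta>"
      proof -
        have gw': "grad (w k) z = e k - (w k z / \<tau>) *\<^sub>R grad (\<psi> k) z" if "k \<in> I" for k
          using gw[OF that] by (simp add: e_def)
        have "divergence V z = - ((\<tau> * f' (D z) + f (D z)) / (S z)\<^sup>2) * ((\<Sum>k\<in>I. e k - (w k z / \<tau>) *\<^sub>R grad (\<psi> k) z) \<bullet> (\<Sum>k\<in>I. w k z *\<^sub>R X k z))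
          + (f (D z) / S z) * (\<Sum>k\<in>I. (e k - (w k z / \<tau>) *\<^sub>R grad (\<psi> k) z) \<bullet> X k z + w k z * divergence (X k) z)"
          unfolding dV gS Y_def by (simp add: gw' cong: sum.cong)
        also have "\<dots> \<le> f' (D z) * (1 - \<eta>) + f (D z) * \<eta> + 2 * f (D z) * real (card I) * \<theta>"
        proof (rule softmin_divergence_bound[OF I(2)])
          show "0 \<le> \<tau> * f' (D z) + f (D z)"
          proof -
            have "\<tau> * - f' (D z) \<le> \<tau> * L" using fD \<tau>(1) by (intro mult_left_mono) auto
            then show ?thesis using \<tau>(3) fD by simp
          qed
          show "\<bar>X k z \<bullet> \<xi>\<bar> \<le> F \<xi>" if "k \<in> I" "w k z \<noteq> 0 \<or> e k \<noteq> 0" for k \<xi>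
            unfolding X_def by (intro grad_F_abs_le good(1)[OF that(1)]) (use that(2) in \<open>auto simp: e_def\<close>)
          show "X k z \<bullet> grad (\<psi> k) z = F (grad (\<psi> k) z)" if "k \<in> I" "w k z \<noteq> 0" for k
            unfolding X_def by (intro grad_F_self good(1)[OF that(1)]) (use that(2) in auto)
        qed (use w0 Spos[OF z] \<tau>(1) good e_bound fD in \<open>auto simp: S_def\<close>)
        finally show ?thesis .
      qed
      also have "f' (D z) * (1 - \<eta>) \<le> f' (D z) + L * \<eta>"
      proof -
        have "- f' (D z) * \<eta> \<le> L * \<eta>" using fD(4) \<eta>(1) by (intro mult_right_mono) auto
        then show ?thesis by (simp add: algebra_simps)
      qed
      also have "f (D z) * \<eta> \<le> L * \<eta>" using fD \<eta> by (intro mult_right_mono) auto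
      also have "2 * f (D z) * real (card I) * \<theta> \<le> 2 * L * real (card I) * \<theta>"
        using fD C0 by (intro mult_right_mono) (auto simp: \<theta>_def)
      also have "2 * L * real (card I) * \<theta> \<le> \<epsilon> / 2"
        using \<tau>(4) by (simp add: \<theta>_def m_def mult_ac)
      finally show ?thesis using \<eta>(2) by simp
    qed
    show "\<bar>V z \<bullet> \<xi>\<bar> \<le> f (D z) * F \<xi>" if z: "z \<in> U" for z \<xi>
    proof -
      have "\<bar>Y z \<bullet> \<xi>\<bar> \<le> (\<Sum>k\<in>I. \<bar>w k z * (X k z \<bullet> \<xi>)\<bar>)" by (simp add: Y_def inner_sum_left)
      also have "\<dots> \<le> (\<Sum>k\<in>I. w k z * F \<xi>)"
      proof (rule sum_mono)
        fix k assume k: "k \<in> I"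
        show "\<bar>w k z * (X k z \<bullet> \<xi>)\<bar> \<le> w k z * F \<xi>"
        proof (cases "w k z = 0")
          case False
          then have "\<bar>X k z \<bullet> \<xi>\<bar> \<le> F \<xi>"
            unfolding X_def using good(1)[OF k] by (intro grad_F_abs_le) auto
          then show ?thesis using w0[OF k, of z] by (simp add: abs_mult mult_left_mono)
        qed simp
      qed
      also have "\<dots> = S z * F \<xi>" by (simp add: S_def sum_distrib_right)
      finally have "(f (D z) / S z) * \<bar>Y z \<bullet> \<xi>\<bar> \<le> (f (D z) / S z) * (S z * F \<xi>)"
        using f(3) D0[OF z] Spos[OF z] by (intro mult_left_mono) (auto intro!: divide_nonneg_pos less_imp_le)
      moreover have "\<bar>V z \<bullet> \<xi>\<bar> = (f (D z) / S z) * \<bar>Y z \<bullet> \<xi>\<bar>"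
        using f(3)[of "D z"] D0[OF z] Spos[OF z] by (simp add: V_def abs_mult)
      ultimately show ?thesis using Spos[OF z] by simp
    qed
  qed (use U VC D0 in auto)
qed

end

section \<open>The Cheeger constant is bounded by the inradius\<close>

lemma divergence_translate_ident: "divergence (\<lambda>x::real^'n. x - c) x = real CARD('n)"
proof -
  have "((\<lambda>x::real^'n. x - c) has_derivative (\<lambda>h. h)) (at x)" by (auto intro!: derivative_eq_intros)
  from divergence_eq[OF this] show ?thesis by simp
qed

context C2_norm
begin

text \<open>The unit ball of \<open>F\<close> is compact, and replacing one of its points by a
  nearby net point costs only a fixed fraction of \<open>polar F x\<close>.\<close>

lemma finite_net_exists:
  assumes "0 < \<delta>"
  obtains \<Xi> where "finite \<Xi>" "\<Xi> \<noteq> {}" "\<And>\<xi>. \<xi> \<in> \<Xi> \<Longrightarrow> F \<xi> \<le> 1" "\<And>x. \<exists>\<xi>\<in>\<Xi>. (1 - \<delta>) * polar F x \<le> \<xi> \<bullet> x"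
proof -
  define C where "C = {\<xi>. F \<xi> \<le> 1}"
  \<comment> \<open>An error \<open>e\<close> in \<open>\<xi>\<close> changes
    \<open>\<xi> \<bullet> x\<close> by at most \<open>e * norm x\<close>, hence by at most
    \<open>e * bnd * polar F x\<close>, which is half of
    \<open>\<delta> * polar F x\<close>.\<close>
  define e where "e = \<delta> / (2 * bnd)"
  have e: "e > 0" using assms bnd_pos by (simp add: e_def)
  have "closed C" unfolding C_def by (intro closed_Collect_le F_continuous continuous_on_const)
  moreover have "bounded C"
    unfolding bounded_iff
  proof (intro exI ballI)
    fix \<xi> assume "\<xi> \<in> C"
    then have "a * norm \<xi> \<le> 1" using lower[of \<xi>] by (simp add: C_def)
    then show "norm \<xi> \<le> 1 / a" using a_pos by (simp add: field_simps)
  qed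
  ultimately have "compact C" by (simp add: compact_eq_bounded_closed)
  then obtain \<Xi> where \<Xi>: "finite \<Xi>" "\<Xi> \<subseteq> C" "C \<subseteq> (\<Union>\<xi>\<in>\<Xi>. ball \<xi> e)"
    using compactE_image[of C C "\<lambda>\<xi>. ball \<xi> e"] e by force
  have "0 \<in> C" by (simp add: C_def F_zero)
  then have "\<Xi> \<noteq> {}" using \<Xi> by blast
  moreover have "\<exists>\<xi>\<in>\<Xi>. (1 - \<delta>) * polar F x \<le> \<xi> \<bullet> x" for x
  proof (rule ccontr)
    assume "\<not> ?thesis"
    then have lt: "\<xi> \<bullet> x < (1 - \<delta>) * polar F x" if "\<xi> \<in> \<Xi>" for \<xi> using that by force
    \<comment> \<open>If all net points fell short by the fraction \<delta>, the supremum would fall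
      short of itself by \<delta>/2. This forces x = 0, where the strict inequality fails.\<close>
    have "polar F x \<le> (1 - \<delta> / 2) * polar F x"
    proof (rule polar_le)
      fix \<xi> :: "real^'n" assume "\<xi> \<noteq> 0"
      then have F\<xi>: "F \<xi> > 0" by (rule F_pos)
      define \<zeta> where "\<zeta> = (1 / F \<xi>) *\<^sub>R \<xi>"
      have "\<zeta> \<in> C" using F\<xi> by (simp add: C_def \<zeta>_def hom)
      then obtain \<xi>' where \<xi>': "\<xi>' \<in> \<Xi>" "norm (\<zeta> - \<xi>') < e" using \<Xi>(3) by (auto simp: dist_norm norm_minus_commute)
      have "\<zeta> \<bullet> x = \<xi>' \<bullet> x + (\<zeta> - \<xi>') \<bullet> x" by (simp add: inner_diff_left)
      also have "(\<zeta> - \<xi>') \<bullet> x \<le> norm (\<zeta> - \<xi>') * norm x" by (rule norm_cauchy_schwarz)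
      also have "\<dots> \<le> e * (bnd * polar F x)" using \<xi>' e norm_le_polar by (intro mult_mono) auto
      also have "\<dots> = \<delta> / 2 * polar F x" using bnd_pos by (simp add: e_def)
      finally have "\<zeta> \<bullet> x \<le> (1 - \<delta> / 2) * polar F x" using lt[OF \<xi>'(1)] by (simp add: algebra_simps)
      then show "\<xi> \<bullet> x \<le> (1 - \<delta> / 2) * polar F x * F \<xi>"
        using F\<xi> by (simp add: \<zeta>_def pos_divide_le_eq)
    qed
    then have "\<delta> / 2 * polar F x \<le> 0" by (simp add: algebra_simps)
    then have "polar F x \<le> 0" using assms by (simp add: mult_le_0_iff)
    then have "polar F x = 0" using polar_nonneg[of x] by simp
    then have "x = 0" using polar_pos[of x] by fastforce
    obtain \<xi> where "\<xi> \<in> \<Xi>" using \<open>\<Xi> \<noteq> {}\<close> by blast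
    then show False using lt[of \<xi>] \<open>x = 0\<close> \<open>polar F x = 0\<close> by simp
  qed
  ultimately show ?thesis using that[of \<Xi>] \<Xi> by (auto simp: C_def)
qed

text \<open>A smooth approximation of \<open>polar F\<close> by \<open>\<tau> log \<Sum> exp (\<xi> \<bullet> x / \<tau>)\<close> over a finite net of \<open>{F \<le> 1}\<close>.\<close>
lemma smooth_polar_exists:
  assumes "0 < \<delta>"
  obtains \<Phi> where "Ck_on 1 UNIV \<Phi>" "\<And>x. (1 - \<delta>) * polar F x \<le> \<Phi> x" "\<And>x. \<Phi> x \<le> polar F x + \<delta>"
    "\<And>x. F (grad \<Phi> x) \<le> 1" "\<And>x. \<Phi> x - \<delta> \<le> grad \<Phi> x \<bullet> x"
proof -
  obtain \<Xi> where \<Xi>: "finite \<Xi>" "\<Xi> \<noteq> {}" "\<And>\<xi>. \<xi> \<in> \<Xi> \<Longrightarrow> F \<xi> \<le> 1" "\<And>x. \<exists>\<xi>\<in>\<Xi>. (1 - \<delta>) * polar F x \<le> \<xi> \<bullet> x"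
    using finite_net_exists[OF assms] by blast
  define m where "m = real (card \<Xi>)"
  have m: "m \<ge> 1" using \<Xi>(1,2) by (simp add: m_def Suc_leI card_gt_0_iff)
  \<comment> \<open>The soft maximum exceeds the maximum by at most \<tau> ln m; the 1 avoids a zero
    denominator for a net with a single point.\<close>
  define \<tau> where "\<tau> = \<delta> / (ln m + 1)"
  have lm: "ln m \<ge> 0" using m by simp
  have \<tau>: "\<tau> > 0" "\<tau> * ln m \<le> \<delta>" using lm assms by (auto simp: \<tau>_def field_simps)
  define Z where "Z x = (\<Sum>\<xi>\<in>\<Xi>. exp ((\<xi> \<bullet> x) / \<tau>))" for x
  have Z: "Z x > 0" for x unfolding Z_def using \<Xi>(1,2) by (intro sum_pos) auto
  define \<Phi> where "\<Phi> x = \<tau> * ln (Z x)" for x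
  define q where "q \<xi> x = exp ((\<xi> \<bullet> x) / \<tau>) / Z x" for \<xi> x
  have q: "q \<xi> x > 0" for \<xi> x using Z by (simp add: q_def)
  have q1: "(\<Sum>\<xi>\<in>\<Xi>. q \<xi> x) = 1" for x using Z[of x] by (simp add: q_def sum_divide_distrib[symmetric] Z_def[symmetric])
  have expC: "Ck_on 1 UNIV (\<lambda>x. exp ((\<xi> \<bullet> x) / \<tau>))" for \<xi> :: "real^'n"
    by (rule Ck1_real_comp[where T = UNIV and q' = "\<lambda>s. exp (s / \<tau>) * (1 / \<tau>)" and q = "\<lambda>s. exp (s / \<tau>)"])
      (use \<tau> in \<open>auto intro!: Ck1_inner Ck1_const Ck1_ident derivative_eq_intros continuous_intros simp del: Ck_on.simps One_nat_def\<close>)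
  have ZC: "Ck_on 1 UNIV Z" unfolding Z_def by (intro Ck1_sum expC)
  have \<Phi>C: "Ck_on 1 UNIV \<Phi>"
    unfolding \<Phi>_def
    by (rule Ck1_real_comp[OF ZC, where T = "{0<..}" and q' = "\<lambda>s. \<tau> / s" and q = "\<lambda>s. \<tau> * ln s"])
      (use Z in \<open>auto intro!: derivative_eq_intros continuous_intros\<close>)
  have g\<Phi>: "grad \<Phi> x = (\<Sum>\<xi>\<in>\<Xi>. q \<xi> x *\<^sub>R \<xi>)" for x
  proof (rule grad_eq)
    have "(Z has_derivative (\<lambda>h. \<Sum>\<xi>\<in>\<Xi>. exp ((\<xi> \<bullet> x) / \<tau>) * ((\<xi> \<bullet> h) / \<tau>))) (at x)"
      unfolding Z_def using \<tau> by (auto intro!: derivative_eq_intros simp: mult.commute)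
    then have "((\<lambda>x. \<tau> * ln (Z x)) has_derivative (\<lambda>h. \<tau> * ((\<Sum>\<xi>\<in>\<Xi>. exp ((\<xi> \<bullet> x) / \<tau>) * ((\<xi> \<bullet> h) / \<tau>)) * inverse (Z x)))) (at x)"
      using Z[of x] by (auto intro!: derivative_eq_intros)
    moreover have "\<tau> * ((\<Sum>\<xi>\<in>\<Xi>. exp ((\<xi> \<bullet> x) / \<tau>) * ((\<xi> \<bullet> h) / \<tau>)) * inverse (Z x)) = (\<Sum>\<xi>\<in>\<Xi>. q \<xi> x *\<^sub>R \<xi>) \<bullet> h" for h
      unfolding inner_sum_left sum_distrib_left sum_distrib_right
      using \<tau> by (intro sum.cong refl) (simp add: q_def field_simps)
    ultimately show "(\<Phi> has_derivative (\<lambda>h. (\<Sum>\<xi>\<in>\<Xi>. q \<xi> x *\<^sub>R \<xi>) \<bullet> h)) (at x)"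
      by (simp add: \<Phi>_def[abs_def])
  qed
  have \<Phi>low: "\<xi> \<bullet> x \<le> \<Phi> x" if "\<xi> \<in> \<Xi>" for \<xi> x
  proof -
    have "exp ((\<xi> \<bullet> x) / \<tau>) \<le> Z x" unfolding Z_def using that \<Xi>(1) by (intro member_le_sum) auto
    then have "(\<xi> \<bullet> x) / \<tau> \<le> ln (Z x)" using Z[of x] by (simp add: ln_ge_iff)
    then show ?thesis using \<tau> by (simp add: \<Phi>_def field_simps)
  qed
  show ?thesis
  proof (rule that[OF \<Phi>C])
    fix x
    show "(1 - \<delta>) * polar F x \<le> \<Phi> x" using \<Xi>(4)[of x] \<Phi>low order_trans by blast
    show "\<Phi> x \<le> polar F x + \<delta>"
    proof -
      have "exp ((\<xi> \<bullet> x) / \<tau>) \<le> exp (polar F x / \<tau>)" if "\<xi> \<in> \<Xi>" for \<xi>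
      proof -
        have "\<xi> \<bullet> x \<le> polar F x * F \<xi>" by (rule inner_le_polar)
        also have "\<dots> \<le> polar F x * 1" using \<Xi>(3)[OF that] polar_nonneg by (intro mult_left_mono) auto
        finally show ?thesis using \<tau> by (simp add: divide_right_mono)
      qed
      then have "Z x \<le> m * exp (polar F x / \<tau>)" unfolding Z_def m_def by (rule sum_bounded_above)
      then have "ln (Z x) \<le> ln (m * exp (polar F x / \<tau>))" using Z[of x] m by simp
      also have "\<dots> = ln m + polar F x / \<tau>" using m by (subst ln_mult) auto
      finally have "\<tau> * ln (Z x) \<le> \<tau> * (ln m + polar F x / \<tau>)" using \<tau> by (intro mult_left_mono) auto
      then show ?thesis using \<tau> by (simp add: \<Phi>_def algebra_simps)
    qed
    show "F (grad \<Phi> x) \<le> 1"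
    proof -
      have "F (grad \<Phi> x) \<le> (\<Sum>\<xi>\<in>\<Xi>. q \<xi> x * F \<xi>)"
        unfolding g\<Phi> using F_sum_le[of "\<lambda>\<xi>. q \<xi> x *\<^sub>R \<xi>" \<Xi>] q[THEN less_imp_le] by (simp add: hom)
      also have "\<dots> \<le> (\<Sum>\<xi>\<in>\<Xi>. q \<xi> x * 1)"
        using \<Xi>(3) q[THEN less_imp_le] by (intro sum_mono mult_left_mono) auto
      finally show ?thesis using q1 by simp
    qed
    \<comment> \<open>Gibbs' inequality: the entropy of the weights \<open>q\<close> is at most \<open>ln m\<close>.\<close>
    show "\<Phi> x - \<delta> \<le> grad \<Phi> x \<bullet> x"
    proof -
      have "\<Phi> x - \<tau> * ln m - \<xi> \<bullet> x \<le> \<tau> * (1 / (m * q \<xi> x) - 1)" for \<xi>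
      proof -
        have "ln (1 / (m * q \<xi> x)) \<le> 1 / (m * q \<xi> x) - 1"
          using q[of \<xi> x] m by (intro ln_le_minus_one) simp
        moreover have "ln (1 / (m * q \<xi> x)) = ln (Z x) - ln m - (\<xi> \<bullet> x) / \<tau>"
          using q[of \<xi> x] m Z[of x] by (simp add: q_def ln_div ln_mult)
        ultimately have "\<tau> * (ln (Z x) - ln m - (\<xi> \<bullet> x) / \<tau>) \<le> \<tau> * (1 / (m * q \<xi> x) - 1)"
          using \<tau> by (intro mult_left_mono) auto
        then show ?thesis using \<tau> by (simp add: \<Phi>_def algebra_simps)
      qed
      then have "(\<Sum>\<xi>\<in>\<Xi>. q \<xi> x * (\<Phi> x - \<tau> * ln m - \<xi> \<bullet> x)) \<le> (\<Sum>\<xi>\<in>\<Xi>. q \<xi> x * (\<tau> * (1 / (m * q \<xi> x) - 1)))"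
        using q[THEN less_imp_le] by (intro sum_mono mult_left_mono) auto
      also have "\<dots> = (\<Sum>\<xi>\<in>\<Xi>. \<tau> / m - \<tau> * q \<xi> x)"
        using q m by (intro sum.cong refl) (simp add: field_simps less_imp_neq[symmetric])
      also have "\<dots> = 0" using q1[of x] m by (simp add: sum_subtractf sum_distrib_left[symmetric] m_def)
      finally have "(\<Sum>\<xi>\<in>\<Xi>. q \<xi> x * (\<Phi> x - \<tau> * ln m)) - grad \<Phi> x \<bullet> x \<le> 0"
        by (simp add: g\<Phi> inner_sum_left right_diff_distrib sum_subtractf)
      then have "(\<Sum>\<xi>\<in>\<Xi>. q \<xi> x) * (\<Phi> x - \<tau> * ln m) - grad \<Phi> x \<bullet> x \<le> 0"
        by (simp add: sum_distrib_right)
      then show ?thesis using q1[of x] \<tau>(2) by simp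
    qed
  qed
qed

end

lemma supp_vanishing_outside:
  fixes \<sigma> :: "real^'n \<Rightarrow> 'b::zero"
  assumes "compact (supp \<sigma>)"
  obtains r where "\<And>x. r \<le> norm x \<Longrightarrow> \<sigma> x = 0" "r > 0"
proof -
  obtain r where r: "r > 0" "\<And>x. x \<in> supp \<sigma> \<Longrightarrow> norm x \<le> r"
    using compact_imp_bounded[OF assms] unfolding bounded_pos by fast
  have "\<sigma> x = 0" if "r + 1 \<le> norm x" for x
  proof (rule ccontr)
    assume "\<sigma> x \<noteq> 0"
    then have "x \<in> supp \<sigma>" using closure_subset[of "{x. \<sigma> x \<noteq> 0}"] by (auto simp: supp_def)
    then show False using r(2)[of x] that by simp
  qed
  moreover have "r + 1 > 0" using r(1) by simp
  ultimately show ?thesis by (rule that)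
qed

context C2_norm
begin

text \<open>The upper bound for \<open>\<integral> -G'(\<Phi>)\<close> comes from integrating the divergence of \<open>G(\<Phi>) (x - c)\<close>.\<close>
lemma wulff_cutoff_exists:
  fixes c :: "real^'n"
  assumes \<delta>: "0 < \<delta>" "\<delta> < 1" and R: "R > 0" and \<alpha>: "\<alpha> = (1 - \<delta>)\<^sup>2 * R" "\<delta> < \<alpha>"
  shows "\<exists>g. Ck_on 1 UNIV g \<and> (\<forall>x. 0 \<le> g x \<and> g x \<le> 1) \<and>
    (\<forall>x. R \<le> polar F (x - c) \<longrightarrow> g x = 0) \<and> (\<forall>x. polar F (x - c) + \<delta> \<le> \<alpha> \<longrightarrow> g x = 1) \<and>
    (\<forall>\<sigma>. Ck_on 1 UNIV \<sigma> \<and> (\<forall>x. polar F (\<sigma> x) \<le> 1) \<longrightarrow>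
      (\<integral>x. g x * divergence \<sigma> x \<partial>lborel) \<le> real CARD('n) / (\<alpha> - \<delta>) * (\<integral>x. g x \<partial>lborel))"
proof -
  obtain \<Phi> where \<Phi>: "Ck_on 1 UNIV \<Phi>" "\<And>x. (1 - \<delta>) * polar F x \<le> \<Phi> x" "\<And>x. \<Phi> x \<le> polar F x + \<delta>"
    "\<And>x. F (grad \<Phi> x) \<le> 1" "\<And>x. \<Phi> x - \<delta> \<le> grad \<Phi> x \<bullet> x"
    using smooth_polar_exists[OF \<delta>(1)] by metis
  \<comment> \<open>Outside the open Wulff shape, \<Phi> is at least (1 - \<delta>) times the polar
    norm and so at least \<beta>; a cutoff of \<Phi> that ends at \<beta> vanishes there.\<close>
  define \<beta> where "\<beta> = (1 - \<delta>) * R"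
  have "(1 - \<delta>) * ((1 - \<delta>) * R) < 1 * ((1 - \<delta>) * R)"
    using \<delta> R by (intro mult_strict_right_mono) auto
  then have "\<alpha> < \<beta>" by (simp add: \<alpha>(1) \<beta>_def power2_eq_square)
  from cutoff_exists[OF this] obtain G G' :: "real \<Rightarrow> real" where
    "(\<forall>s. (G has_real_derivative G' s) (at s)) \<and> continuous_on UNIV G' \<and> (\<forall>s. G' s \<le> 0) \<and>
    (\<forall>s. 0 \<le> G s \<and> G s \<le> 1) \<and> (\<forall>s\<le>\<alpha>. G s = 1) \<and> (\<forall>s\<ge>\<beta>. G s = 0) \<and> (\<forall>s<\<alpha>. G' s = 0) \<and> (\<forall>s\<ge>\<beta>. G' s = 0)"
    by (elim exE)
  then have G: "\<And>s. (G has_real_derivative G' s) (at s)" "continuous_on UNIV G'" "\<And>s. G' s \<le> 0"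
    "\<And>s. 0 \<le> G s" "\<And>s. G s \<le> 1" "\<And>s. s \<le> \<alpha> \<Longrightarrow> G s = 1" "\<And>s. \<beta> \<le> s \<Longrightarrow> G s = 0" "\<And>s. s < \<alpha> \<Longrightarrow> G' s = 0"
    "\<And>s. \<beta> \<le> s \<Longrightarrow> G' s = 0"
    by simp_all
  define g where "g x = G (\<Phi> (x - c))" for x
  define h where "h x = - G' (\<Phi> (x - c))" for x
  define n where "n x = grad \<Phi> (x - c)" for x
  have trC: "Ck_on 1 UNIV (\<lambda>x. x - c)" by (intro Ck1_diff Ck1_ident Ck1_const)
  have \<Phi>C: "Ck_on 1 UNIV (\<lambda>x. \<Phi> (x - c))" by (rule Ck1_comp[OF trC \<Phi>(1)]) simp
  have gC: "Ck_on 1 UNIV g" unfolding g_def by (rule Ck1_real_comp[OF \<Phi>C UNIV_I G(1,2)])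
  have gg: "grad g x = - h x *\<^sub>R n x" for x
  proof (rule grad_eq)
    have "((\<lambda>x. \<Phi> (x - c)) has_derivative (\<lambda>h. n x \<bullet> h)) (at x)"
      unfolding n_def
      by (rule has_derivative_compose[where g = \<Phi>, OF _ grad_derivative[OF Ck1_differentiable[OF \<Phi>(1) UNIV_I]]])
        (auto intro!: derivative_eq_intros)
    from has_derivative_compose[OF this G(1)[unfolded has_field_derivative_def]]
    show "(g has_derivative (\<lambda>k. (- h x *\<^sub>R n x) \<bullet> k)) (at x)"
      by (simp add: g_def[abs_def] h_def)
  qed
  have h0: "h x \<ge> 0" for x using G(3) by (simp add: h_def)
  have \<Phi>cont: "continuous_on UNIV (\<lambda>x. \<Phi> (x - c))" by (rule Ck1D(3)[OF \<Phi>C])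
  have hcont: "continuous_on UNIV h"
    unfolding h_def by (intro continuous_intros continuous_on_compose2[OF G(2) \<Phi>cont]) auto
  have ncont: "continuous_on UNIV n"
    unfolding n_def
    by (intro continuous_on_compose2[OF continuous_on_grad[OF \<Phi>(1)]] continuous_intros) auto
  have gcont: "continuous_on UNIV g" by (rule Ck1D(3)[OF gC])
  have big: "\<beta> \<le> \<Phi> (x - c)" if "R \<le> polar F (x - c)" for x
  proof -
    have "\<beta> \<le> (1 - \<delta>) * polar F (x - c)" unfolding \<beta>_def using that \<delta> by (intro mult_left_mono) auto
    then show ?thesis using \<Phi>(2)[of "x - c"] by simp
  qed
  define r where "r = norm c + bnd * R"
  have out: "g x = 0" "h x = 0" if "r \<le> norm x" for x
  proof -
    have "bnd * R \<le> norm (x - c)" using that norm_triangle_ineq2[of x c] by (simp add: r_def)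
    also have "\<dots> \<le> bnd * polar F (x - c)" by (rule norm_le_polar)
    finally have "R \<le> polar F (x - c)" using bnd_pos by simp
    from big[OF this] show "g x = 0" "h x = 0" using G by (auto simp: g_def h_def)
  qed
  have hint: "integrable lborel h" using integrable_vanishing_outside[OF hcont out(2)] by blast
  have gint: "integrable lborel g" using integrable_vanishing_outside[OF gcont out(1)] by blast
  \<comment> \<open>\<open>h\<close> lives where \<Phi> \<ge> \<alpha>, and there
    \<open>n x \<bullet> (x - c)\<close> is at least \<Phi> - \<delta>, hence at least \<alpha> -
    \<delta>.\<close>
  have scale: "(\<alpha> - \<delta>) * integral\<^sup>L lborel h \<le> real CARD('n) * integral\<^sup>L lborel g"
  proof -
    have "has_bochner_integral lborel (\<lambda>x. grad g x \<bullet> (x - c) + g x * divergence (\<lambda>x. x - c) x) 0"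
      by (rule divergence_product_integral_zero[OF gC trC]) (use out in blast)
    then have z: "has_bochner_integral lborel (\<lambda>x. - (h x * (n x \<bullet> (x - c))) + g x * real CARD('n)) 0"
      by (simp add: gg divergence_translate_ident)
    have i0: "integrable lborel (\<lambda>x. h x * (n x \<bullet> (x - c)))"
      by (rule integrable_vanishing_outside[where r = r])
        (use out in \<open>auto intro!: continuous_intros hcont ncont\<close>)
    have "(\<alpha> - \<delta>) * h x \<le> h x * (n x \<bullet> (x - c))" for x
    proof (cases "\<Phi> (x - c) < \<alpha>")
      case False
      then have "\<alpha> - \<delta> \<le> n x \<bullet> (x - c)" using \<Phi>(5)[of "x - c"] by (simp add: n_def)
      then show ?thesis using h0[of x] by (simp add: mult.commute mult_left_mono)
    qed (simp add: h_def G(8))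
    then have "(\<integral>x. (\<alpha> - \<delta>) * h x \<partial>lborel) \<le> (\<integral>x. h x * (n x \<bullet> (x - c)) \<partial>lborel)"
      using hint i0 by (intro integral_mono) auto
    also have "\<dots> = real CARD('n) * integral\<^sup>L lborel g"
      using z i0 gint by (simp add: has_bochner_integral_iff mult.commute)
    finally show ?thesis by simp
  qed
  have "(\<integral>x. g x * divergence \<sigma> x \<partial>lborel) \<le> real CARD('n) / (\<alpha> - \<delta>) * (\<integral>x. g x \<partial>lborel)"
    if \<sigma>: "Ck_on 1 UNIV \<sigma>" "\<And>x. polar F (\<sigma> x) \<le> 1" for \<sigma>
  proof -
    have "has_bochner_integral lborel (\<lambda>x. grad g x \<bullet> \<sigma> x + g x * divergence \<sigma> x) 0"
      by (rule divergence_product_integral_zero[OF gC \<sigma>(1)]) (use out in blast)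
    then have z: "has_bochner_integral lborel (\<lambda>x. - (h x * (n x \<bullet> \<sigma> x)) + g x * divergence \<sigma> x) 0"
      by (simp add: gg)
    have i1: "integrable lborel (\<lambda>x. h x * (n x \<bullet> \<sigma> x))"
      by (rule integrable_vanishing_outside[where r = r])
        (use out in \<open>auto intro!: continuous_intros hcont ncont Ck1D(3)[OF \<sigma>(1)]\<close>)
    have i2: "integrable lborel (\<lambda>x. g x * divergence \<sigma> x)"
      by (rule integrable_vanishing_outside[where r = r])
        (use out in \<open>auto intro!: continuous_intros gcont continuous_on_divergence[OF \<sigma>(1)]\<close>)
    have "(\<integral>x. g x * divergence \<sigma> x \<partial>lborel) = (\<integral>x. h x * (n x \<bullet> \<sigma> x) \<partial>lborel)"
      using z i1 i2 by (simp add: has_bochner_integral_iff)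
    also have "\<dots> \<le> integral\<^sup>L lborel h"
    proof (rule integral_mono[OF i1 hint])
      fix x
      have "n x \<bullet> \<sigma> x \<le> polar F (\<sigma> x) * F (n x)" by (rule inner_le_polar)
      also have "\<dots> \<le> 1 * 1" using \<sigma>(2) \<Phi>(4) F_nonneg polar_nonneg by (intro mult_mono) (auto simp: n_def)
      finally show "h x * (n x \<bullet> \<sigma> x) \<le> h x" using mult_left_mono[OF _ h0[of x], of "n x \<bullet> \<sigma> x" 1] by simp
    qed
    also have "\<dots> \<le> real CARD('n) / (\<alpha> - \<delta>) * integral\<^sup>L lborel g"
      using scale \<alpha>(2) by (simp add: field_simps)
    finally show ?thesis .
  qed
  moreover have "g x = 0" if "R \<le> polar F (x - c)" for x using big[OF that] G(7) by (simp add: g_def)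
  moreover have "g x = 1" if "polar F (x - c) + \<delta> \<le> \<alpha>" for x
    using \<Phi>(3)[of "x - c"] that G(6) by (simp add: g_def)
  ultimately show ?thesis
    using gC G(4,5) by (intro exI[of _ g] conjI allI impI) (auto simp: g_def simp del: Ck_on.simps One_nat_def)
qed

text \<open>The cutoffs lie below the indicator of \<open>K\<close> and converge to it pointwise, so
  their bound passes to the limit by dominated convergence while the factor N/(\<alpha> - \<delta>)
  tends to N/R.\<close>

lemma wulff_perimeter_le:
  fixes c :: "real^'n"
  assumes R: "R > 0"
  defines "K \<equiv> {x. polar F (x - c) < R}"
  shows "perimeter_F F K \<le> ereal (real CARD('n) / R * measure lebesgue K)"
    and "open K" and "bounded K" and "c \<in> K"
proof -
  have pc: "continuous_on UNIV (\<lambda>x. polar F (x - c))"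
    by (intro continuous_on_compose2[OF polar_continuous[of UNIV]] continuous_intros) auto
  show op: "open K" unfolding K_def by (intro open_Collect_less pc continuous_on_const)
  show "c \<in> K" using R by (simp add: K_def polar_zero)
  have sub: "K \<subseteq> ball c (bnd * R)"
  proof
    fix x assume "x \<in> K"
    then have "bnd * polar F (x - c) < bnd * R" using bnd_pos by (simp add: K_def)
    then show "x \<in> ball c (bnd * R)" using norm_le_polar[of "x - c"] by (simp add: dist_norm norm_minus_commute)
  qed
  then show bK: "bounded K" using bounded_ball bounded_subset by blast
  have mK: "K \<in> sets borel" using op by simp
  have fin: "emeasure lborel K < \<infinity>" using emeasure_bounded_finite[OF bK] .
  define N where "N = real CARD('n)"
  have "(\<integral>x. divergence \<sigma> x \<partial>lebesgue_on K) \<le> N / R * measure lebesgue K"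
    if \<sigma>: "Ck_on 1 UNIV \<sigma>" "compact (supp \<sigma>)" "\<And>x. polar F (\<sigma> x) \<le> 1" for \<sigma>
  proof -
    have dcont: "continuous_on UNIV (divergence \<sigma>)" by (rule continuous_on_divergence[OF \<sigma>(1)])
    have "bounded (divergence \<sigma> ` cball c (bnd * R))"
      by (intro compact_imp_bounded compact_continuous_image continuous_on_subset[OF dcont]) auto
    then obtain B where B: "\<And>x. x \<in> cball c (bnd * R) \<Longrightarrow> \<bar>divergence \<sigma> x\<bar> \<le> B"
      by (force simp: bounded_iff)
    \<comment> \<open>The offset 2 keeps every \<open>\<delta> n\<close> strictly below 1.\<close>
    define \<delta> where "\<delta> n = 1 / (real n + 2)" for n :: nat
    define \<alpha> where "\<alpha> n = (1 - \<delta> n)\<^sup>2 * R" for n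
    have \<delta>: "0 < \<delta> n" "\<delta> n < 1" for n by (auto simp: \<delta>_def)
    have \<delta>0: "\<delta> \<longlonglongrightarrow> 0" unfolding \<delta>_def by real_asymp
    have "(\<lambda>n. (1 - \<delta> n)\<^sup>2 * R - \<delta> n) \<longlonglongrightarrow> (1 - 0)\<^sup>2 * R - 0" by (intro tendsto_intros \<delta>0)
    then have lim: "(\<lambda>n. \<alpha> n - \<delta> n) \<longlonglongrightarrow> R" by (simp add: \<alpha>_def)
    then have "\<forall>\<^sub>F n in sequentially. 0 < \<alpha> n - \<delta> n" using R order_tendstoD(1) by blast
    then obtain n0 where n0: "\<And>n. n \<ge> n0 \<Longrightarrow> \<delta> n < \<alpha> n" by (auto simp: eventually_sequentially)
    have "\<forall>n. \<exists>g. n \<ge> n0 \<longrightarrow> Ck_on 1 UNIV g \<and> (\<forall>x. 0 \<le> g x \<and> g x \<le> 1) \<and>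
      (\<forall>x. R \<le> polar F (x - c) \<longrightarrow> g x = 0) \<and> (\<forall>x. polar F (x - c) + \<delta> n \<le> \<alpha> n \<longrightarrow> g x = 1) \<and>
      (\<forall>\<sigma>. Ck_on 1 UNIV \<sigma> \<and> (\<forall>x. polar F (\<sigma> x) \<le> 1) \<longrightarrow>
      (\<integral>x. g x * divergence \<sigma> x \<partial>lborel) \<le> real CARD('n) / (\<alpha> n - \<delta> n) * (\<integral>x. g x \<partial>lborel))"
      using wulff_cutoff_exists[OF \<delta> R \<alpha>_def n0] by blast
    from choice[OF this] obtain g where g: "\<And>n. n \<ge> n0 \<Longrightarrow> Ck_on 1 UNIV (g n)" "\<And>n x. n \<ge> n0 \<Longrightarrow> 0 \<le> g n x \<and> g n x \<le> 1"
      "\<And>n x. n \<ge> n0 \<Longrightarrow> R \<le> polar F (x - c) \<Longrightarrow> g n x = 0" "\<And>n x. n \<ge> n0 \<Longrightarrow> polar F (x - c) + \<delta> n \<le> \<alpha> n \<Longrightarrow> g n x = 1"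
      and gle: "\<And>n. n \<ge> n0 \<Longrightarrow> (\<integral>x. g n x * divergence \<sigma> x \<partial>lborel) \<le> N / (\<alpha> n - \<delta> n) * (\<integral>x. g n x \<partial>lborel)"
      using \<sigma> unfolding N_def by blast
    \<comment> \<open>\<open>g n\<close> is specified from \<open>n0\<close> on only; after the
      shift the bounds hold for all indices, as dominated convergence demands.\<close>
    define g' where "g' n = g (n + n0)" for n
    have g'K: "g' n x \<le> indicator K x" "0 \<le> g' n x" for n x
      using g(2)[of "n + n0" x] g(3)[of "n + n0" x] by (auto simp: g'_def K_def indicator_def)
    have conv: "(\<lambda>n. g' n x) \<longlonglongrightarrow> indicator K x" for x
    proof (cases "x \<in> K")
      case True
      then have "polar F (x - c) < R" by (simp add: K_def)
      then have "\<forall>\<^sub>F n in sequentially. polar F (x - c) < \<alpha> n - \<delta> n" using lim order_tendstoD(1) by blast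
      then have "\<forall>\<^sub>F n in sequentially. polar F (x - c) < \<alpha> (n + n0) - \<delta> (n + n0)"
        by (rule sequentially_offset)
      then have "\<forall>\<^sub>F n in sequentially. g' n x = indicator K x"
        by eventually_elim (use True g(4) in \<open>simp add: g'_def\<close>)
      then show ?thesis by (rule tendsto_eventually)
    next
      case False
      then have "g' n x = 0" for n using g'K[of n x] by simp
      then show ?thesis using False by simp
    qed
    have gm: "g' n \<in> borel_measurable lborel" for n
      using borel_measurable_continuous_onI[OF Ck1D(3)[OF g(1)[of "n + n0"]]] by (simp add: g'_def)
    have dm: "divergence \<sigma> \<in> borel_measurable lborel"
      using borel_measurable_continuous_onI[OF dcont] by simp
    have iK: "integrable lborel (indicator K :: _ \<Rightarrow> real)" using mK fin by (simp add: integrable_indicator_iff)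
    have lim1: "(\<lambda>n. integral\<^sup>L lborel (g' n)) \<longlonglongrightarrow> integral\<^sup>L lborel (indicator K)"
      by (rule integral_dominated_convergence[where w = "indicator K"]) (use gm iK mK conv g'K in auto)
    have lim2: "(\<lambda>n. \<integral>x. g' n x * divergence \<sigma> x \<partial>lborel) \<longlonglongrightarrow> (\<integral>x. indicator K x * divergence \<sigma> x \<partial>lborel)"
    proof (rule integral_dominated_convergence[where w = "\<lambda>x. indicator K x * B"])
      show "AE x in lborel. (\<lambda>n. g' n x * divergence \<sigma> x) \<longlonglongrightarrow> indicator K x * divergence \<sigma> x"
        by (intro AE_I2 tendsto_mult conv tendsto_const)
      show "AE x in lborel. norm (g' n x * divergence \<sigma> x) \<le> indicator K x * B" for n
      proof (rule AE_I2)
        fix x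
        show "norm (g' n x * divergence \<sigma> x) \<le> indicator K x * B"
        proof (cases "x \<in> K")
          case True
          then have "\<bar>divergence \<sigma> x\<bar> \<le> B" using B sub by (meson ball_subset_cball subsetD)
          then have "g' n x * \<bar>divergence \<sigma> x\<bar> \<le> 1 * B" using g'K[of n x] True by (intro mult_mono) auto
          then show ?thesis using True g'K(2)[of n x] by (simp add: abs_mult)
        next
          case False
          then have "g' n x = 0" using g'K[of n x] by simp
          then show ?thesis using False by simp
        qed
      qed
    qed (use gm dm mK iK in auto)
    have "(\<lambda>n. \<alpha> (n + n0) - \<delta> (n + n0)) \<longlonglongrightarrow> R" using lim by (rule LIMSEQ_ignore_initial_segment)
    then have lim3: "(\<lambda>n. N / (\<alpha> (n + n0) - \<delta> (n + n0)) * integral\<^sup>L lborel (g' n)) \<longlonglongrightarrow> N / R * integral\<^sup>L lborel (indicator K)"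
      using R by (intro tendsto_intros lim1) auto
    have "(\<integral>x. indicator K x * divergence \<sigma> x \<partial>lborel) \<le> N / R * integral\<^sup>L lborel (indicator K)"
      by (rule LIMSEQ_le[OF lim2 lim3]) (use gle in \<open>auto simp: g'_def\<close>)
    moreover have "(\<integral>x. divergence \<sigma> x \<partial>lebesgue_on K) = (\<integral>x. indicator K x * divergence \<sigma> x \<partial>lborel)"
    proof -
      have "(\<integral>x. divergence \<sigma> x \<partial>lebesgue_on K) = (\<integral>x. indicator K x *\<^sub>R divergence \<sigma> x \<partial>lebesgue)"
        using mK by (intro integral_restrict_space) auto
      also have "\<dots> = (\<integral>x. indicator K x *\<^sub>R divergence \<sigma> x \<partial>lborel)"
        using mK dm by (intro integral_completion) auto
      finally show ?thesis by simp
    qed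
    moreover have "integral\<^sup>L lborel (indicator K :: _ \<Rightarrow> real) = measure lebesgue K"
      using mK by (simp add: measure_completion)
    ultimately show ?thesis by simp
  qed
  then show "perimeter_F F K \<le> ereal (real CARD('n) / R * measure lebesgue K)"
    unfolding perimeter_F_def N_def by (intro Sup_least) auto
qed

end

section \<open>The one-dimensional problem\<close>

lemma powr_pos: "0 < x \<Longrightarrow> 0 < x powr a" for x a :: real
  by simp

text \<open>Inverting \<open>y \<mapsto> \<integral>\<^sub>0\<^sup>y dt / (1 - t\<^sup>p/(p-1))\<^sup>1\<^sup>/\<^sup>p\<close> gives the generalised sine \<open>g\<close>, with \<open>g' = (1 - g\<^sup>p/(p-1))\<^sup>1\<^sup>/\<^sup>p\<close>.\<close>
lemma generalized_sine_exists:
  fixes p s0 :: real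
  assumes p: "1 < p" and s0: "0 < s0" "s0 < pi_p p / 2"
  shows "\<exists>g. (\<forall>s. 0 < s \<and> s < s0 \<longrightarrow> 0 < g s \<and> (g s) powr p < p - 1 \<and>
    (g has_real_derivative (1 - (g s) powr p / (p - 1)) powr (1 / p)) (at s))"
proof -
  define Y where "Y = (p - 1) powr (1 / p)"
  define k where "k t = 1 / (1 - t powr p / (p - 1)) powr (1 / p)" for t
  define \<Lambda> where "\<Lambda> y = integral {0..y} k" for y
  have Y: "Y > 0" "Y powr p = p - 1" using p by (auto simp: Y_def powr_powr)
  have less: "t powr p < p - 1" if "0 \<le> t" "t < Y" for t
    using powr_less_mono2[of p t Y] that p Y by simp
  have base: "0 < 1 - t powr p / (p - 1)" if "0 \<le> t" "t < Y" for t
    using less[OF that] p by (simp add: field_simps)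
  have kpos: "k t > 0" if "0 \<le> t" "t < Y" for t
    unfolding k_def by (intro divide_pos_pos powr_pos base that) simp
  have kcont: "continuous_on {0..y} k" if "y < Y" for y
    unfolding k_def
    by (intro continuous_intros continuous_on_powr') (use p base that in \<open>auto simp: less_imp_neq[symmetric]\<close>)
  have pi: "pi_p p / 2 = \<Lambda> Y" by (simp add: pi_p_def \<Lambda>_def k_def[abs_def] Y_def)
  \<comment> \<open>A gauge integral that does not exist has value 0, so positivity of
    \<open>pi_p p\<close> already yields integrability of the singular integrand.\<close>
  have "\<Lambda> Y \<noteq> 0" using s0 pi by simp
  then have "k integrable_on {0..Y}" using not_integrable_integral by (auto simp: \<Lambda>_def)
  then have "continuous_on {0..Y} \<Lambda>" unfolding \<Lambda>_def by (rule indefinite_integral_continuous_1)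
  then have "(\<Lambda> \<longlongrightarrow> \<Lambda> Y) (at_left Y)"
    using Y(1) continuous_on_Icc_at_leftD by blast
  \<comment> \<open>Inversion takes place on an interval that stops before the singularity at
    \<open>Y\<close> but still covers the values up to \<open>s0\<close>.\<close>
  then have "\<forall>\<^sub>F y in at_left Y. s0 < \<Lambda> y" using order_tendstoD(1) s0 pi by metis
  moreover have "\<forall>\<^sub>F y in at_left Y. 0 < y" using Y(1) by (intro eventually_at_leftI[of 0]) auto
  moreover have "\<forall>\<^sub>F y in at_left Y. y < Y" by (intro eventually_at_leftI[of 0]) (use Y in auto)
  ultimately have "\<forall>\<^sub>F y in at_left Y. s0 < \<Lambda> y \<and> 0 < y \<and> y < Y" by eventually_elim simp
  then obtain y1 where y1: "s0 < \<Lambda> y1" "0 < y1" "y1 < Y"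
    using eventually_happens trivial_limit_at_left_real by blast
  have \<Lambda>D: "(\<Lambda> has_real_derivative k y) (at y)" if "0 < y" "y < Y" for y
  proof -
    define z where "z = (y + Y) / 2"
    have z: "y < z" "z < Y" using that by (auto simp: z_def)
    have "(\<Lambda> has_real_derivative k y) (at y within {0..z})"
      unfolding \<Lambda>_def by (rule integral_has_real_derivative[OF kcont[OF z(2)]]) (use that z in auto)
    moreover have "at y within {0..z} = at y"
      using that z by (intro at_within_interior) auto
    ultimately show ?thesis by simp
  qed
  have \<Lambda>cont: "continuous_on {0..y1} \<Lambda>"
    unfolding \<Lambda>_def by (intro indefinite_integral_continuous_1 integrable_continuous_real kcont y1)
  have \<Lambda>mono: "\<Lambda> y < \<Lambda> z" if "0 \<le> y" "y < z" "z \<le> y1" for y z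
  proof (rule DERIV_pos_imp_increasing_open[OF that(2)])
    show "\<exists>d. (\<Lambda> has_real_derivative d) (at x) \<and> 0 < d" if "y < x" "x < z" for x
      using \<Lambda>D[of x] kpos[of x] that \<open>0 \<le> y\<close> \<open>z \<le> y1\<close> y1 by force
    show "continuous_on {y..z} \<Lambda>" using that by (intro continuous_on_subset[OF \<Lambda>cont]) auto
  qed
  have inj: "inj_on \<Lambda> {0..y1}"
    by (intro inj_onI) (metis \<Lambda>mono atLeastAtMost_iff less_irrefl linorder_neqE_linordered_idom)
  define g where "g = the_inv_into {0..y1} \<Lambda>"
  have g\<Lambda>: "g (\<Lambda> y) = y" if "y \<in> {0..y1}" for y
    unfolding g_def by (rule the_inv_into_f_f[OF inj that])
  have \<Lambda>0: "\<Lambda> 0 = 0" by (simp add: \<Lambda>_def)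
  have sub: "{0<..<\<Lambda> y1} \<subseteq> \<Lambda> ` {0<..<y1}"
  proof
    fix s assume s: "s \<in> {0<..<\<Lambda> y1}"
    then obtain y where "0 \<le> y" "y \<le> y1" "\<Lambda> y = s"
      using IVT'[of \<Lambda> 0 s y1] \<Lambda>0 \<Lambda>cont y1 by auto
    moreover have "y \<noteq> 0" "y \<noteq> y1" using s \<open>\<Lambda> y = s\<close> \<Lambda>0 by auto
    ultimately show "s \<in> \<Lambda> ` {0<..<y1}" by (intro image_eqI[of _ _ y]) auto
  qed
  have "continuous_on (\<Lambda> ` {0..y1}) g"
    by (rule continuous_on_inv[OF \<Lambda>cont]) (use g\<Lambda> in auto)
  then have gcont: "continuous_on {0<..<\<Lambda> y1} g"
    by (rule continuous_on_subset) (use sub in force)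
  have "0 < g s \<and> (g s) powr p < p - 1 \<and> (g has_real_derivative (1 - (g s) powr p / (p - 1)) powr (1 / p)) (at s)"
    if s: "0 < s" "s < s0" for s
  proof -
    have sL: "s \<in> {0<..<\<Lambda> y1}" using s y1 by simp
    then obtain y where y: "0 < y" "y < y1" "\<Lambda> y = s" using subsetD[OF sub sL] by auto
    then have gs: "g s = y" using g\<Lambda>[of y] by simp
    have "(g has_real_derivative inverse (k y)) (at s)"
    proof (rule DERIV_inverse_function[where a = 0 and b = "\<Lambda> y1" and f = \<Lambda>])
      show "(\<Lambda> has_real_derivative k y) (at (g s))" using \<Lambda>D y y1 gs by simp
      show "k y \<noteq> 0" using kpos[of y] y y1 by simp
      show "\<Lambda> (g t) = t" if "0 < t" "t < \<Lambda> y1" for t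
        using sub that g\<Lambda> by force
      show "isCont g s" using gcont sL by (simp add: continuous_on_eq_continuous_at)
    qed (use sL in auto)
    moreover have "inverse (k y) = (1 - (g s) powr p / (p - 1)) powr (1 / p)"
      using base[of y] y y1 gs by (simp add: k_def)
    ultimately show ?thesis using y y1 less[of y] gs by simp
  qed
  then show ?thesis by blast
qed

text \<open>With \<phi>(s) = g(\<kappa> s), the solution is f = (\<phi>'/\<phi>)^(p-1), the usual
  substitution that turns the one-dimensional p-Laplace eigenvalue equation into a Riccati equation;
  for p = 2 it is \<kappa> cot(\<kappa> s). The auxiliary \<open>h\<close> is (g'/g)^p, evaluated at
  \<kappa> s.\<close>

lemma riccati_solution_exists:
  fixes p R \<kappa> :: real
  assumes p: "1 < p" and R: "0 < R" and \<kappa>: "0 < \<kappa>" "\<kappa> * R < pi_p p / 2"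
  shows "\<exists>f f'. (\<forall>s. 0 < s \<and> s < R \<longrightarrow> (f has_real_derivative f' s) (at s)) \<and> continuous_on {0<..<R} f' \<and>
    (\<forall>s. 0 < s \<and> s < R \<longrightarrow> 0 < f s \<and> f' s \<le> 0 \<and> - f' s - (p - 1) * (f s) powr (p / (p - 1)) = \<kappa> powr p)"
proof -
  obtain g where g: "\<And>s. 0 < s \<Longrightarrow> s < \<kappa> * R \<Longrightarrow> 0 < g s" "\<And>s. 0 < s \<Longrightarrow> s < \<kappa> * R \<Longrightarrow> (g s) powr p < p - 1"
    "\<And>s. 0 < s \<Longrightarrow> s < \<kappa> * R \<Longrightarrow> (g has_real_derivative (1 - (g s) powr p / (p - 1)) powr (1 / p)) (at s)"
    using generalized_sine_exists[OF p, of "\<kappa> * R"] R \<kappa> by (metis mult_pos_pos)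
  define h where "h s = (g (\<kappa> * s)) powr (- p) - 1 / (p - 1)" for s
  define f where "f s = \<kappa> powr (p - 1) * (h s) powr ((p - 1) / p)" for s
  define f' where "f' s = - (\<kappa> powr p * ((p - 1) * (g (\<kappa> * s)) powr (- p)))" for s
  have dom: "0 < \<kappa> * s \<and> \<kappa> * s < \<kappa> * R" if "0 < s" "s < R" for s using that \<kappa> by simp
  have hpos: "h s > 0" if "0 < s" "s < R" for s
    using g(1,2)[of "\<kappa> * s"] dom[OF that] p by (simp add: h_def powr_minus field_simps)
  have D: "(f has_real_derivative f' s) (at s)" if s: "0 < s" "s < R" for s
  proof -
    define y where "y = g (\<kappa> * s)"
    define d where "d = (1 - y powr p / (p - 1)) powr (1 / p)"
    have y: "y > 0" "y powr p < p - 1" using g(1,2)[of "\<kappa> * s"] dom[OF s] by (auto simp: y_def)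
    have b: "1 - y powr p / (p - 1) > 0" using y p by (simp add: field_simps)
    then have d: "d > 0" unfolding d_def by (rule powr_pos)
    have hs: "h s = y powr (- p) * (1 - y powr p / (p - 1))"
      using y p by (simp add: h_def y_def[symmetric] powr_minus field_simps)
    have "((\<lambda>s. \<kappa> * s) has_real_derivative \<kappa>) (at s)" by (auto intro!: derivative_eq_intros)
    from DERIV_chain2[OF g(3)[of "\<kappa> * s"] this] dom[OF s]
    have gD: "((\<lambda>s. g (\<kappa> * s)) has_real_derivative d * \<kappa>) (at s)" by (simp add: d_def y_def)
    have hD: "(h has_real_derivative (- p) * y powr (- p - 1) * (d * \<kappa>)) (at s)"
    proof -
      have "((\<lambda>s. (g (\<kappa> * s)) powr (- p)) has_real_derivative (- p) * y powr (- p - 1) * (d * \<kappa>)) (at s)"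
        using DERIV_fun_powr[OF gD, of "- p"] y by (simp add: y_def)
      from DERIV_diff[OF this DERIV_const] show ?thesis by (simp add: h_def[abs_def])
    qed
    have "(f has_real_derivative \<kappa> powr (p - 1) * (((p - 1) / p) * h s powr ((p - 1) / p - 1) * ((- p) * y powr (- p - 1) * (d * \<kappa>)))) (at s)"
      unfolding f_def using DERIV_fun_powr[OF hD hpos[OF s], of "(p - 1) / p"] by (intro DERIV_cmult) simp
    moreover have "\<kappa> powr (p - 1) * (((p - 1) / p) * h s powr ((p - 1) / p - 1) * ((- p) * y powr (- p - 1) * (d * \<kappa>))) = f' s"
    proof -
      \<comment> \<open>With this exponent \<open>h\<close> becomes g/g', which cancels the factor
        g' = \<open>d\<close> from the chain rule; only a power of \<open>g\<close>
        survives.\<close>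
      have "(p - 1) / p - 1 = - (1 / p)" using p by (simp add: field_simps)
      then have "h s powr ((p - 1) / p - 1) = (y powr (- p)) powr (- (1 / p)) * (1 - y powr p / (p - 1)) powr (- (1 / p))"
        using y b by (simp only: hs) (subst powr_mult, auto)
      also have "(y powr (- p)) powr (- (1 / p)) = y" using y p by (simp only: powr_powr) simp
      also have "y * (1 - y powr p / (p - 1)) powr (- (1 / p)) = y * inverse d" by (simp add: d_def powr_minus)
      finally have 1: "h s powr ((p - 1) / p - 1) = y * inverse d" .
      have 2: "\<kappa> powr (p - 1) * \<kappa> = \<kappa> powr p" using \<kappa> powr_mult_base[of \<kappa> "p - 1"] by (simp add: mult.commute)
      have 3: "y * y powr (- p - 1) = y powr (- p)" using y powr_mult_base[of y "- p - 1"] by simp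
      have "\<kappa> powr (p - 1) * (((p - 1) / p) * (y * inverse d) * ((- p) * y powr (- p - 1) * (d * \<kappa>)))
          = - ((\<kappa> powr (p - 1) * \<kappa>) * ((p - 1) * (y * y powr (- p - 1))))"
        using p d by (simp add: field_simps)
      then show ?thesis unfolding 1 2 3 f'_def y_def[symmetric] .
    qed
    ultimately show ?thesis by simp
  qed
  have gcont: "continuous_on {0<..<R} (\<lambda>s. g (\<kappa> * s))"
  proof (intro continuous_at_imp_continuous_on ballI)
    fix s assume "s \<in> {0<..<R}"
    then have 1: "isCont g (\<kappa> * s)" using DERIV_isCont[OF g(3)[of "\<kappa> * s"]] dom[of s] by auto
    have "isCont (\<lambda>s. \<kappa> * s) s" by (intro continuous_intros)
    from isCont_o2[OF this 1] show "isCont (\<lambda>s. g (\<kappa> * s)) s" .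
  qed
  have "continuous_on {0<..<R} f'"
    unfolding f'_def using g(1) dom
    by (intro continuous_intros gcont) (auto simp: less_imp_neq[symmetric])
  moreover have "0 < f s \<and> f' s \<le> 0 \<and> - f' s - (p - 1) * (f s) powr (p / (p - 1)) = \<kappa> powr p" if s: "0 < s" "s < R" for s
  proof (intro conjI)
    show "0 < f s" using hpos[OF s] \<kappa> by (simp add: f_def)
    show "f' s \<le> 0" using p by (simp add: f'_def)
    have "(f s) powr (p / (p - 1)) = (\<kappa> powr (p - 1)) powr (p / (p - 1)) * ((h s) powr ((p - 1) / p)) powr (p / (p - 1))"
      unfolding f_def by (rule powr_mult)
    also have "\<dots> = \<kappa> powr p * h s" using p hpos[OF s] by (simp add: powr_powr)
    finally have fs: "(f s) powr (p / (p - 1)) = \<kappa> powr p * h s" .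
    have "(p - 1) * h s = (p - 1) * (g (\<kappa> * s)) powr (- p) - 1"
      using p by (simp add: h_def right_diff_distrib)
    then have "(p - 1) * (\<kappa> powr p * h s) = \<kappa> powr p * ((p - 1) * (g (\<kappa> * s)) powr (- p)) - \<kappa> powr p"
      by (simp add: mult.left_commute[of "p - 1"] right_diff_distrib)
    then show "- f' s - (p - 1) * (f s) powr (p / (p - 1)) = \<kappa> powr p"
      unfolding fs f'_def by simp
  qed
  ultimately show ?thesis using D by blast
qed

section \<open>The Rayleigh quotient\<close>

text \<open>Writing the derivative with the positive parts of s and -s gives continuity across 0 for
  every exponent p > 1.\<close>

lemma has_real_derivative_abs_powr:
  assumes p: "1 < (p::real)"
  defines "q' \<equiv> \<lambda>s. p * (max 0 s) powr (p - 1) - p * (max 0 (- s)) powr (p - 1)"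
  shows "((\<lambda>s. \<bar>s\<bar> powr p) has_real_derivative q' s) (at s)"
    and "continuous_on A q'" and "\<bar>q' s\<bar> = p * \<bar>s\<bar> powr (p - 1)"
proof -
  have "((\<lambda>s. - s) has_real_derivative - 1) (at s)" by (auto intro!: derivative_eq_intros)
  from DERIV_add[OF has_real_derivative_max_powr[OF p] DERIV_chain2[OF has_real_derivative_max_powr[OF p] this]]
  have "((\<lambda>s. (max 0 s) powr p + (max 0 (- s)) powr p) has_real_derivative q' s) (at s)"
    by (simp add: q'_def)
  moreover have "(\<lambda>s. (max 0 s) powr p + (max 0 (- s)) powr p) = (\<lambda>s. \<bar>s\<bar> powr p)"
    by (auto simp: max_def abs_if)
  ultimately show "((\<lambda>s. \<bar>s\<bar> powr p) has_real_derivative q' s) (at s)" by simp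
  show "continuous_on A q'" unfolding q'_def
    by (intro continuous_intros continuous_on_powr') (use p in auto)
  show "\<bar>q' s\<bar> = p * \<bar>s\<bar> powr (p - 1)" unfolding q'_def using p by (auto simp: max_def abs_if)
qed

text \<open>Young's inequality with the exponents p and p/(p-1), multiplied by p. The factor p - 1
  in the Riccati equation originates here.\<close>

lemma Youngs_inequality_weighted:
  fixes p A B f :: real
  assumes "1 < p" "A \<ge> 0" "B \<ge> 0" "f \<ge> 0"
  shows "p * A powr (p - 1) * (f * B) \<le> B powr p + (p - 1) * f powr (p / (p - 1)) * A powr p"
proof -
  define q where "q = p / (p - 1)"
  have q: "q > 1" "1 / p + 1 / q = 1" using assms(1) by (auto simp: q_def field_simps)
  have "B * (f * A powr (p - 1)) \<le> B powr p / p + (f * A powr (p - 1)) powr q / q"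
    using Youngs_inequality[OF assms(1) q(1) q(2), of B "f * A powr (p - 1)"] assms by simp
  also have "(f * A powr (p - 1)) powr q = f powr q * A powr p"
    using assms by (simp add: powr_mult powr_powr q_def)
  finally have "p * (B * (f * A powr (p - 1))) \<le> p * (B powr p / p + f powr q * A powr p / q)"
    using assms by (intro mult_left_mono) auto
  also have "\<dots> = B powr p + (p - 1) * f powr q * A powr p"
    using assms by (simp add: q_def field_simps)
  finally show ?thesis by (simp add: q_def mult_ac)
qed

context C2_norm
begin

text \<open>A Barta-type argument: the field |u|^p V, extended by zero, has a divergence with
  integral zero, and adding this divergence turns the claim into a pointwise inequality.\<close>

lemma rayleigh_bound_C1:
  assumes op: "open \<Omega>" and nU: "\<Omega> \<noteq> UNIV" and bd: "Ck_boundary 2 \<Omega>"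
    and curv: "\<And>y. y \<in> frontier \<Omega> \<Longrightarrow> mean_curvature_F F \<Omega> y \<ge> 0"
    and R: "\<And>z. dist_F \<Omega> z \<le> R" "0 < R" and p: "1 < p" "0 < pi_p p"
    and u: "Ck_on 1 UNIV u" "compact (supp u)" "supp u \<subseteq> \<Omega>"
  shows "(pi_p p / (2 * R)) powr p * (\<integral>x. \<bar>u x\<bar> powr p \<partial>lborel) \<le> (\<integral>x. F (grad u x) powr p \<partial>lborel)"
proof -
  obtain r where r: "\<And>x. r \<le> norm x \<Longrightarrow> u x = 0" "r > 0" using supp_vanishing_outside[OF u(2)] by blast
  have gr: "grad u x = 0" if "r + 1 \<le> norm x" for x
    by (rule grad_zero_of_locally_const[of "- cball 0 r" _ u 0]) (use that r in auto)
  have ui: "integrable lborel (\<lambda>x. \<bar>u x\<bar> powr p)"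
  proof (rule integrable_vanishing_outside[where r = r])
    show "continuous_on UNIV (\<lambda>x. \<bar>u x\<bar> powr p)"
      by (intro continuous_on_powr' continuous_on_rabs Ck1D(3)[OF u(1)] continuous_on_const) (use p in auto)
  qed (use r p in auto)
  have Fi: "integrable lborel (\<lambda>x. F (grad u x) powr p)"
  proof (rule integrable_vanishing_outside[where r = "r + 1"])
    show "continuous_on UNIV (\<lambda>x. F (grad u x) powr p)"
      by (intro continuous_on_powr' continuous_on_compose2[OF F_continuous[of UNIV] continuous_on_grad[OF u(1)]]
          continuous_on_const) (use p F_nonneg in auto)
  qed (use gr p F_zero in auto)
  have key: "((pi_p p / (2 * R')) powr p - \<epsilon>) * (\<integral>x. \<bar>u x\<bar> powr p \<partial>lborel) \<le> (\<integral>x. F (grad u x) powr p \<partial>lborel)"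
    if R': "R < R'" and \<epsilon>: "0 < \<epsilon>" for R' \<epsilon>
  proof -
    define \<kappa> where "\<kappa> = pi_p p / (2 * R')"
    \<comment> \<open>Strictly between the two radii: R < R1 is the room that the field needs, and
      R1 < R' makes \<open>\<kappa> * R1\<close> smaller than \<open>pi_p p / 2\<close>.\<close>
    define R1 where "R1 = (R + R') / 2"
    have R1: "R < R1" "R1 < R'" using R' by (auto simp: R1_def)
    have \<kappa>: "0 < \<kappa>" using p R R' by (simp add: \<kappa>_def)
    have "\<kappa> * R1 < \<kappa> * R'" using \<kappa> R1 by simp
    also have "\<dots> = pi_p p / 2" using R R' by (simp add: \<kappa>_def)
    finally have "\<exists>f f'. (\<forall>s. 0 < s \<and> s < R1 \<longrightarrow> (f has_real_derivative f' s) (at s)) \<and> continuous_on {0<..<R1} f' \<and>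
      (\<forall>s. 0 < s \<and> s < R1 \<longrightarrow> 0 < f s \<and> f' s \<le> 0 \<and> - f' s - (p - 1) * (f s) powr (p / (p - 1)) = \<kappa> powr p)"
      using R R1 \<kappa> p by (intro riccati_solution_exists) auto
    then obtain f f' where f: "\<And>s. 0 < s \<Longrightarrow> s < R1 \<Longrightarrow> (f has_real_derivative f' s) (at s)" "continuous_on {0<..<R1} f'"
      "\<And>s. 0 < s \<Longrightarrow> s < R1 \<Longrightarrow> 0 < f s" "\<And>s. 0 < s \<Longrightarrow> s < R1 \<Longrightarrow> f' s \<le> 0"
      and ric: "\<And>s. 0 < s \<Longrightarrow> s < R1 \<Longrightarrow> - f' s - (p - 1) * (f s) powr (p / (p - 1)) = \<kappa> powr p"
      by blast
    obtain U V D where U: "open U" "supp u \<subseteq> U" and V: "Ck_on 1 U V" and D: "\<And>z. z \<in> U \<Longrightarrow> 0 < D z \<and> D z < R1"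
      and dV: "\<And>z. z \<in> U \<Longrightarrow> divergence V z \<le> f' (D z) + \<epsilon>"
      and VF: "\<And>z \<xi>. z \<in> U \<Longrightarrow> \<bar>V z \<bullet> \<xi>\<bar> \<le> f (D z) * F \<xi>"
      using barta_field_exists[OF op nU bd curv u(2,3) R(1) R1(1) f \<epsilon>] by blast
    define q' where "q' s = p * (max 0 s) powr (p - 1) - p * (max 0 (- s)) powr (p - 1)" for s
    note q = has_real_derivative_abs_powr[OF p(1), folded q'_def]
    have upC: "Ck_on 1 UNIV (\<lambda>x. \<bar>u x\<bar> powr p)"
      by (rule Ck1_real_comp[OF u(1) UNIV_I q(1,2)])
    define O2 where "O2 = - supp u"
    have u0: "u z = 0" if "z \<in> O2" for z
      using that closure_subset[of "{x. u x \<noteq> 0}"] by (auto simp: O2_def supp_def)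
    have O2: "open O2" using u(2) by (simp add: O2_def open_Compl compact_imp_closed)
    \<comment> \<open>\<open>V\<close> is known on \<open>U\<close> only; since the support of
      \<open>u\<close> lies inside \<open>U\<close>, the extension by zero is C^1.\<close>
    define Y where "Y z = (if z \<in> U then \<bar>u z\<bar> powr p *\<^sub>R V z else 0)" for z
    have Y0: "Y z = 0" if "z \<in> O2" for z using u0[OF that] p by (simp add: Y_def)
    have "Ck_on 1 (\<Union>{U, O2}) Y"
    proof (rule Ck1_open_Union)
      fix W assume "W \<in> {U, O2}"
      then consider "W = U" | "W = O2" by blast
      then show "Ck_on 1 W Y"
      proof cases
        case 1
        show ?thesis unfolding 1
          by (rule Ck1_cong[OF Ck1_scaleR[OF Ck1_subset[OF upC subset_UNIV] V] U(1)]) (simp add: Y_def)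
      next
        case 2
        show ?thesis unfolding 2 by (rule Ck1_cong[OF Ck1_const[where c = 0] O2]) (simp add: Y0)
      qed
    qed (use U O2 in auto)
    moreover have "\<Union>{U, O2} = UNIV" using U(2) by (auto simp: O2_def)
    ultimately have YC: "Ck_on 1 UNIV Y" by simp
    have Yr: "Y x = 0" if "r \<le> norm x" for x using r(1)[OF that] p by (simp add: Y_def)
    have divY: "has_bochner_integral lborel (divergence Y) 0"
      by (rule divergence_integral_zero[OF YC Yr])
    have pw: "(\<kappa> powr p - \<epsilon>) * \<bar>u z\<bar> powr p + divergence Y z \<le> F (grad u z) powr p" for z
    proof (cases "z \<in> U")
      case True
      have "divergence Y z = divergence (\<lambda>z. \<bar>u z\<bar> powr p *\<^sub>R V z) z"
      proof -
        have d: "((\<lambda>z. \<bar>u z\<bar> powr p *\<^sub>R V z) has_derivative frechet_derivative (\<lambda>z. \<bar>u z\<bar> powr p *\<^sub>R V z) (at z)) (at z)"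
          by (rule Ck1D(1)[OF Ck1_scaleR[OF Ck1_subset[OF upC subset_UNIV] V] True])
        have "(Y has_derivative frechet_derivative (\<lambda>z. \<bar>u z\<bar> powr p *\<^sub>R V z) (at z)) (at z)"
          by (rule has_derivative_transform_within_open[OF d U(1) True]) (simp add: Y_def)
        from divergence_eq[OF this] divergence_eq[OF d] show ?thesis by simp
      qed
      also have "\<dots> = (q' (u z) *\<^sub>R grad u z) \<bullet> V z + \<bar>u z\<bar> powr p * divergence V z"
      proof (rule divergence_scaleR[OF _ Ck1_differentiable[OF V True]])
        show "((\<lambda>z. \<bar>u z\<bar> powr p) has_derivative (\<lambda>h. (q' (u z) *\<^sub>R grad u z) \<bullet> h)) (at z)"
          using has_derivative_compose[OF grad_derivative[OF Ck1_differentiable[OF u(1) UNIV_I]] q(1)[unfolded has_field_derivative_def]]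
          by simp
      qed
      also have "(q' (u z) *\<^sub>R grad u z) \<bullet> V z \<le> p * \<bar>u z\<bar> powr (p - 1) * (f (D z) * F (grad u z))"
      proof -
        have "(q' (u z) *\<^sub>R grad u z) \<bullet> V z \<le> \<bar>q' (u z)\<bar> * \<bar>V z \<bullet> grad u z\<bar>"
          by (simp add: inner_commute[of "grad u z"] abs_mult[symmetric])
        also have "\<dots> \<le> \<bar>q' (u z)\<bar> * (f (D z) * F (grad u z))"
          by (intro mult_left_mono VF True) auto
        finally show ?thesis by (simp add: q(3))
      qed
      also have "p * \<bar>u z\<bar> powr (p - 1) * (f (D z) * F (grad u z))
          \<le> F (grad u z) powr p + (p - 1) * (f (D z)) powr (p / (p - 1)) * \<bar>u z\<bar> powr p"
        using f(3) D[OF True] F_nonneg by (intro Youngs_inequality_weighted p) (auto intro: less_imp_le)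
      also have "\<bar>u z\<bar> powr p * divergence V z \<le> \<bar>u z\<bar> powr p * (f' (D z) + \<epsilon>)"
        by (intro mult_left_mono dV True) auto
      finally have "divergence Y z \<le> F (grad u z) powr p + ((p - 1) * (f (D z)) powr (p / (p - 1)) + f' (D z) + \<epsilon>) * \<bar>u z\<bar> powr p"
        by (simp add: algebra_simps)
      \<comment> \<open>The Riccati equation, taken at the value \<open>D z\<close>, removes all
        dependence on \<open>f\<close>.\<close>
      also have "(p - 1) * (f (D z)) powr (p / (p - 1)) + f' (D z) + \<epsilon> = - (\<kappa> powr p - \<epsilon>)"
        using ric[of "D z"] D[OF True] by simp
      finally show ?thesis by (simp add: algebra_simps)
    next
      case False
      then have z: "z \<in> O2" using U(2) by (auto simp: O2_def)
      have "(Y has_derivative (\<lambda>h. 0)) (at z)"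
        by (rule has_derivative_transform_within_open[OF has_derivative_const O2 z]) (simp add: Y0)
      from divergence_eq[OF this] show ?thesis using u0[OF z] p by simp
    qed
    have "(\<integral>x. (\<kappa> powr p - \<epsilon>) * \<bar>u x\<bar> powr p + divergence Y x \<partial>lborel) \<le> (\<integral>x. F (grad u x) powr p \<partial>lborel)"
      using divY ui Fi pw by (intro integral_mono) (auto simp: has_bochner_integral_iff)
    then show ?thesis using divY ui by (simp add: has_bochner_integral_iff \<kappa>_def)
  qed
  \<comment> \<open>Both reserves are given up at once, with R' = R + \<epsilon>.\<close>
  have lim: "((\<lambda>\<epsilon>. ((pi_p p / (2 * (R + \<epsilon>))) powr p - \<epsilon>) * (\<integral>x. \<bar>u x\<bar> powr p \<partial>lborel)) \<longlongrightarrow>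
      ((pi_p p / (2 * (R + 0))) powr p - 0) * (\<integral>x. \<bar>u x\<bar> powr p \<partial>lborel)) (at_right 0)"
    using R p by (intro tendsto_intros) auto
  have "\<forall>\<^sub>F \<epsilon> in at_right 0. ((pi_p p / (2 * (R + \<epsilon>))) powr p - \<epsilon>) * (\<integral>x. \<bar>u x\<bar> powr p \<partial>lborel)
      \<le> (\<integral>x. F (grad u x) powr p \<partial>lborel)"
    by (rule eventually_at_rightI[of 0 1], rule key) auto
  from tendsto_upperbound[OF lim this] show ?thesis by simp
qed

end

text \<open>Convexity of the power, with x + y written as (1 - \<theta>)(x/(1 - \<theta>)) +
  \<theta>(y/\<theta>). The factor of \<open>x powr p\<close> tends to 1 as \<theta> tends to 0, so
  a perturbation \<open>y\<close> that vanishes in L^p leaves no loss in the limit.\<close>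

lemma powr_add_le:
  fixes p \<theta> x y :: real
  assumes p: "1 < p" and \<theta>: "0 < \<theta>" "\<theta> < 1" and xy: "0 \<le> x" "0 \<le> y"
  shows "(x + y) powr p \<le> (1 - \<theta>) powr (1 - p) * x powr p + \<theta> powr (1 - p) * y powr p"
proof -
  have ge1: "1 \<le> t powr (1 - p)" if "0 < t" "t < 1" for t :: real
  proof -
    have "1 powr (p - 1) \<ge> t powr (p - 1)" using that p by (intro powr_mono2) auto
    then have "t powr (p - 1) \<le> 1" by simp
    moreover have "t powr (1 - p) = inverse (t powr (p - 1))"
      using powr_minus[of t "p - 1"] by simp
    moreover have "t powr (p - 1) > 0" using that by simp
    ultimately show ?thesis by (simp add: one_le_inverse_iff)
  qed
  consider "x = 0" | "y = 0" | "x > 0" "y > 0" using xy by linarith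
  then show ?thesis
  proof cases
    case 1
    then show ?thesis using mult_right_mono[OF ge1[OF \<theta>], of "y powr p"] p by simp
  next
    case 2
    then show ?thesis using mult_right_mono[OF ge1[of "1 - \<theta>"], of "x powr p"] \<theta> p by simp
  next
    case 3
    have "((1 - \<theta>) *\<^sub>R (x / (1 - \<theta>)) + \<theta> *\<^sub>R (y / \<theta>)) powr p
        \<le> (1 - \<theta>) * (x / (1 - \<theta>)) powr p + \<theta> * (y / \<theta>) powr p"
      by (rule convex_onD[OF powr_convex]) (use p \<theta> 3 in auto)
    moreover have "t * (z / t) powr p = t powr (1 - p) * z powr p" if "t > 0" "z > 0" for t z :: real
      using that by (simp add: powr_divide powr_diff)
    ultimately show ?thesis using \<theta> 3 by simp
  qed
qed

lemma integral_lebesgue_on_vanishing: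
  fixes f :: "'a::euclidean_space \<Rightarrow> real"
  assumes "f \<in> borel_measurable borel" "\<Omega> \<in> sets borel" "\<And>x. x \<notin> \<Omega> \<Longrightarrow> f x = 0"
  shows "integral\<^sup>L (lebesgue_on \<Omega>) f = integral\<^sup>L lborel f"
    and "integrable lborel f \<Longrightarrow> integrable (lebesgue_on \<Omega>) f"
proof -
  have f: "(\<lambda>x. indicator \<Omega> x *\<^sub>R f x) = f" using assms(3) by (auto simp: fun_eq_iff indicator_def)
  have fm: "f \<in> borel_measurable lborel" using assms(1) by simp
  have \<Omega>: "\<Omega> \<inter> space lebesgue \<in> sets lebesgue" using assms(2) by simp
  show "integral\<^sup>L (lebesgue_on \<Omega>) f = integral\<^sup>L lborel f"
    unfolding integral_restrict_space[OF \<Omega>] f by (rule integral_completion[OF fm])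
  show "integrable (lebesgue_on \<Omega>) f" if "integrable lborel f"
    unfolding integrable_restrict_space[OF \<Omega>] f using that integrable_completion[OF fm] by simp
qed

lemma integrable_norm_diff_powr:
  fixes f g :: "'a \<Rightarrow> 'b::euclidean_space"
  assumes p: "1 < p" and fm: "f \<in> borel_measurable M" "g \<in> borel_measurable M"
    and int: "integrable M (\<lambda>x. norm (f x) powr p)" "integrable M (\<lambda>x. norm (g x) powr p)"
  shows "integrable M (\<lambda>x. norm (f x - g x) powr p)"
proof (rule Bochner_Integration.integrable_bound)
  let ?c = "(1/2) powr (1 - p)"
  show "integrable M (\<lambda>x. ?c * norm (f x) powr p + ?c * norm (g x) powr p)" using int by auto
  show "(\<lambda>x. norm (f x - g x) powr p) \<in> borel_measurable M" using fm by measurable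
  have "norm (f x - g x) powr p \<le> ?c * norm (f x) powr p + ?c * norm (g x) powr p" for x
  proof -
    have "norm (f x - g x) powr p \<le> (norm (f x) + norm (g x)) powr p"
      using p by (intro powr_mono2 norm_triangle_ineq4) auto
    also have "\<dots> \<le> ?c * norm (f x) powr p + ?c * norm (g x) powr p"
      using powr_add_le[OF p, of "1/2" "norm (f x)" "norm (g x)"] by simp
    finally show ?thesis .
  qed
  then show "AE x in M. norm (norm (f x - g x) powr p) \<le> norm (?c * norm (f x) powr p + ?c * norm (g x) powr p)"
    by (intro AE_I2) (metis abs_ge_self abs_of_nonneg order_trans powr_ge_zero real_norm_def)
qed

text \<open>Without integrability the gauge integral is 0 by convention, so the bound holds in
  either case.\<close>

lemma pi_p_nonneg: "0 \<le> pi_p p"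
proof -
  let ?f = "\<lambda>t::real. 1 / (1 - t powr p / (p - 1)) powr (1/p)"
  have "0 \<le> integral {0..(p - 1) powr (1/p)} ?f"
  proof (cases "?f integrable_on {0..(p - 1) powr (1/p)}")
    case True
    then show ?thesis by (rule Henstock_Kurzweil_Integration.integral_nonneg) simp
  qed (simp add: not_integrable_integral)
  then show ?thesis by (simp add: pi_p_def)
qed

context C2_norm
begin

text \<open>Approximation by test functions: \<open>powr_add_le\<close> is used once for the values
  and once for the gradients, which is why the factor \<open>(1 - \<theta>) powr (1 - p)\<close>
  occurs twice. The approximation index goes to infinity before \<theta> goes to 0.\<close>

lemma W01p_rayleigh_bound:
  assumes p: "1 < p" and \<Omega>: "open \<Omega>" and W: "W01p p \<Omega> u G" and c: "0 \<le> c"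
    and test: "\<And>\<phi>. test_function \<Omega> \<phi> \<Longrightarrow> c * (\<integral>x. \<bar>\<phi> x\<bar> powr p \<partial>lborel) \<le> (\<integral>x. F (grad \<phi> x) powr p \<partial>lborel)"
  shows "c * (\<integral>x. \<bar>u x\<bar> powr p \<partial>lebesgue_on \<Omega>) \<le> (\<integral>x. F (G x) powr p \<partial>lebesgue_on \<Omega>)"
proof -
  define M where "M = lebesgue_on \<Omega>"
  have um: "u \<in> borel_measurable M" and ui: "integrable M (\<lambda>x. \<bar>u x\<bar> powr p)"
    and Gm: "G \<in> borel_measurable M" and Gi: "integrable M (\<lambda>x. norm (G x) powr p)"
    using W by (auto simp: W01p_def W1p_def in_Lp_def M_def)
  obtain \<phi> where \<phi>: "\<And>k. test_function \<Omega> (\<phi> k)"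
    and \<phi>u: "(\<lambda>k. \<integral>x. \<bar>\<phi> k x - u x\<bar> powr p \<partial>M) \<longlonglongrightarrow> 0"
    and \<phi>G: "(\<lambda>k. \<integral>x. norm (grad (\<phi> k) x - G x) powr p \<partial>M) \<longlonglongrightarrow> 0"
    using W by (auto simp: W01p_def M_def)
  have FGm: "(\<lambda>x. F (G x)) \<in> borel_measurable M"
    using measurable_compose[OF Gm borel_measurable_continuous_onI[OF F_continuous]] by simp
  have FGi: "integrable M (\<lambda>x. F (G x) powr p)"
  proof (rule Bochner_Integration.integrable_bound)
    show "integrable M (\<lambda>x. bnd powr p * norm (G x) powr p)" using Gi by simp
    show "(\<lambda>x. F (G x) powr p) \<in> borel_measurable M" using FGm by measurable
    show "AE x in M. norm (F (G x) powr p) \<le> norm (bnd powr p * norm (G x) powr p)"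
    proof (rule AE_I2)
      fix x
      have "F (G x) powr p \<le> (bnd * norm (G x)) powr p" using p F_nonneg upper by (intro powr_mono2) auto
      then show "norm (F (G x) powr p) \<le> norm (bnd powr p * norm (G x) powr p)"
        using bnd_pos by (simp add: powr_mult)
    qed
  qed
  have tf: "(\<phi> k) \<in> borel_measurable M" "grad (\<phi> k) \<in> borel_measurable M"
    "integrable M (\<lambda>x. \<bar>\<phi> k x\<bar> powr p)" "integrable M (\<lambda>x. norm (grad (\<phi> k) x) powr p)"
    "integrable M (\<lambda>x. F (grad (\<phi> k) x) powr p)"
    "c * (\<integral>x. \<bar>\<phi> k x\<bar> powr p \<partial>M) \<le> (\<integral>x. F (grad (\<phi> k) x) powr p \<partial>M)" for k
  proof -
    have C1: "Ck_on 1 UNIV (\<phi> k)" and supp: "compact (supp (\<phi> k))" "supp (\<phi> k) \<subseteq> \<Omega>"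
      using \<phi>[of k] unfolding test_function_def by blast+
    have cont: "continuous_on UNIV (\<phi> k)" "continuous_on UNIV (grad (\<phi> k))"
      using Ck1D(3)[OF C1] continuous_on_grad[OF C1] .
    obtain r where r: "\<And>x. r \<le> norm x \<Longrightarrow> \<phi> k x = 0" using supp_vanishing_outside[OF supp(1)] by blast
    have z: "\<phi> k x = 0" if "x \<notin> supp (\<phi> k)" for x
      using that closure_subset[of "{x. \<phi> k x \<noteq> 0}"] by (auto simp: supp_def)
    have gz: "grad (\<phi> k) x = 0" if "x \<notin> supp (\<phi> k)" for x
      by (rule grad_zero_of_locally_const[of "- supp (\<phi> k)" _ _ 0])
        (use that z supp(1) in \<open>auto simp: open_Compl compact_imp_closed\<close>)
    obtain r' where r': "\<And>x. x \<in> supp (\<phi> k) \<Longrightarrow> norm x < r'"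
      using compact_imp_bounded[OF supp(1)] by (metis bounded_pos_less)
    have out: "x \<notin> supp (\<phi> k)" if "r' \<le> norm x" for x using r' that by force
    have out': "x \<notin> supp (\<phi> k)" if "x \<notin> \<Omega>" for x using supp(2) that by blast
    have cl: "continuous_on UNIV (\<lambda>x. \<bar>\<phi> k x\<bar> powr p)" "continuous_on UNIV (\<lambda>x. norm (grad (\<phi> k) x) powr p)"
      "continuous_on UNIV (\<lambda>x. F (grad (\<phi> k) x) powr p)"
      by (intro continuous_on_powr' continuous_on_rabs continuous_on_norm cont continuous_on_const
          continuous_on_compose2[OF F_continuous[of UNIV] cont(2)]; use p F_nonneg in auto)+
    have il: "integrable lborel (\<lambda>x. \<bar>\<phi> k x\<bar> powr p)" "integrable lborel (\<lambda>x. norm (grad (\<phi> k) x) powr p)"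
      "integrable lborel (\<lambda>x. F (grad (\<phi> k) x) powr p)"
      by (rule integrable_vanishing_outside[where r = r'], rule cl, use out z gz p F_zero in force)+
    have \<Omega>b: "\<Omega> \<in> sets borel" using \<Omega> by simp
    have bm: "(\<lambda>x. \<bar>\<phi> k x\<bar> powr p) \<in> borel_measurable borel" "(\<lambda>x. norm (grad (\<phi> k) x) powr p) \<in> borel_measurable borel"
      "(\<lambda>x. F (grad (\<phi> k) x) powr p) \<in> borel_measurable borel"
      using cl borel_measurable_continuous_onI by blast+
    note conv = integral_lebesgue_on_vanishing[OF bm(1) \<Omega>b] integral_lebesgue_on_vanishing[OF bm(2) \<Omega>b]
      integral_lebesgue_on_vanishing[OF bm(3) \<Omega>b]
    show "integrable M (\<lambda>x. \<bar>\<phi> k x\<bar> powr p)" "integrable M (\<lambda>x. norm (grad (\<phi> k) x) powr p)"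
      "integrable M (\<lambda>x. F (grad (\<phi> k) x) powr p)"
      unfolding M_def using out' z gz F_zero p il by (auto intro!: conv(2,4,6))
    have "(\<integral>x. \<bar>\<phi> k x\<bar> powr p \<partial>M) = (\<integral>x. \<bar>\<phi> k x\<bar> powr p \<partial>lborel)"
      "(\<integral>x. F (grad (\<phi> k) x) powr p \<partial>M) = (\<integral>x. F (grad (\<phi> k) x) powr p \<partial>lborel)"
      unfolding M_def using out' z gz F_zero p by (auto intro!: conv(1,5))
    then show "c * (\<integral>x. \<bar>\<phi> k x\<bar> powr p \<partial>M) \<le> (\<integral>x. F (grad (\<phi> k) x) powr p \<partial>M)"
      using test[OF \<phi>[of k]] by simp
    show "\<phi> k \<in> borel_measurable M" "grad (\<phi> k) \<in> borel_measurable M"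
      unfolding M_def
      using borel_measurable_continuous_onI[OF cont(1)] borel_measurable_continuous_onI[OF cont(2)]
      by (auto intro!: measurable_restrict_space1 measurable_completion)
  qed
  have di: "integrable M (\<lambda>x. \<bar>\<phi> k x - u x\<bar> powr p)" "integrable M (\<lambda>x. norm (grad (\<phi> k) x - G x) powr p)" for k
    using integrable_norm_diff_powr[OF p tf(1) um] integrable_norm_diff_powr[OF p tf(2) Gm] tf(3,4) ui Gi by auto
  define Iu where "Iu = (\<integral>x. \<bar>u x\<bar> powr p \<partial>M)"
  define IG where "IG = (\<integral>x. F (G x) powr p \<partial>M)"
  have bound: "c * Iu \<le> (1 - \<theta>) powr (1 - p) * ((1 - \<theta>) powr (1 - p) * IG)" if \<theta>: "0 < \<theta>" "\<theta> < 1" for \<theta>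
  proof -
    define A B where "A = (1 - \<theta>) powr (1 - p)" and "B = \<theta> powr (1 - p)"
    have AB: "A \<ge> 0" "B \<ge> 0" by (auto simp: A_def B_def)
    have "c * Iu \<le> A * (A * IG + B * bnd powr p * (\<integral>x. norm (grad (\<phi> k) x - G x) powr p \<partial>M))
        + c * (B * (\<integral>x. \<bar>\<phi> k x - u x\<bar> powr p \<partial>M))" for k
    proof -
      have "Iu \<le> (\<integral>x. A * \<bar>\<phi> k x\<bar> powr p + B * \<bar>\<phi> k x - u x\<bar> powr p \<partial>M)"
        unfolding Iu_def
      proof (rule integral_mono)
        fix x
        have "\<bar>u x\<bar> powr p \<le> (\<bar>\<phi> k x\<bar> + \<bar>\<phi> k x - u x\<bar>) powr p" using p by (intro powr_mono2) auto
        also have "\<dots> \<le> A * \<bar>\<phi> k x\<bar> powr p + B * \<bar>\<phi> k x - u x\<bar> powr p"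
          unfolding A_def B_def by (rule powr_add_le[OF p \<theta>]) auto
        finally show "\<bar>u x\<bar> powr p \<le> A * \<bar>\<phi> k x\<bar> powr p + B * \<bar>\<phi> k x - u x\<bar> powr p" .
      qed (use ui tf(3) di(1) in auto)
      also have "\<dots> = A * (\<integral>x. \<bar>\<phi> k x\<bar> powr p \<partial>M) + B * (\<integral>x. \<bar>\<phi> k x - u x\<bar> powr p \<partial>M)"
        using tf(3) di(1) by simp
      finally have "c * Iu \<le> c * (A * (\<integral>x. \<bar>\<phi> k x\<bar> powr p \<partial>M) + B * (\<integral>x. \<bar>\<phi> k x - u x\<bar> powr p \<partial>M))"
        using c by (intro mult_left_mono)
      also have "\<dots> = A * (c * (\<integral>x. \<bar>\<phi> k x\<bar> powr p \<partial>M)) + c * (B * (\<integral>x. \<bar>\<phi> k x - u x\<bar> powr p \<partial>M))"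
        by (simp add: algebra_simps)
      also have "c * (\<integral>x. \<bar>\<phi> k x\<bar> powr p \<partial>M) \<le> (\<integral>x. F (grad (\<phi> k) x) powr p \<partial>M)" by (rule tf(6))
      also have "\<dots> \<le> (\<integral>x. A * F (G x) powr p + B * (bnd powr p * norm (grad (\<phi> k) x - G x) powr p) \<partial>M)"
      proof (rule integral_mono)
        fix x
        have "F (grad (\<phi> k) x) \<le> F (G x) + bnd * norm (grad (\<phi> k) x - G x)"
          using F_diff_le[of "grad (\<phi> k) x" "G x"] by simp
        then have "F (grad (\<phi> k) x) powr p \<le> (F (G x) + bnd * norm (grad (\<phi> k) x - G x)) powr p"
          using p F_nonneg by (intro powr_mono2) auto
        also have "\<dots> \<le> A * F (G x) powr p + B * (bnd * norm (grad (\<phi> k) x - G x)) powr p"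
          unfolding A_def B_def using F_nonneg bnd_pos by (intro powr_add_le[OF p \<theta>]) auto
        also have "(bnd * norm (grad (\<phi> k) x - G x)) powr p = bnd powr p * norm (grad (\<phi> k) x - G x) powr p"
          using bnd_pos by (simp add: powr_mult)
        finally show "F (grad (\<phi> k) x) powr p \<le> A * F (G x) powr p + B * (bnd powr p * norm (grad (\<phi> k) x - G x) powr p)" .
      qed (use tf(5) FGi di(2) in auto)
      also have "\<dots> = A * IG + B * bnd powr p * (\<integral>x. norm (grad (\<phi> k) x - G x) powr p \<partial>M)"
        using FGi di(2) by (simp add: IG_def)
      finally show ?thesis using AB by (simp add: mult_left_mono)
    qed
    moreover have "(\<lambda>k. A * (A * IG + B * bnd powr p * (\<integral>x. norm (grad (\<phi> k) x - G x) powr p \<partial>M))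
        + c * (B * (\<integral>x. \<bar>\<phi> k x - u x\<bar> powr p \<partial>M))) \<longlonglongrightarrow> A * (A * IG + B * bnd powr p * 0) + c * (B * 0)"
      by (intro tendsto_intros \<phi>u \<phi>G)
    ultimately have "c * Iu \<le> A * (A * IG + B * bnd powr p * 0) + c * (B * 0)"
      by (intro LIMSEQ_le_const) auto
    then show ?thesis by (simp add: A_def)
  qed
  have "((\<lambda>\<theta>::real. (1 - \<theta>) powr (1 - p) * ((1 - \<theta>) powr (1 - p) * IG)) \<longlongrightarrow> (1 - 0) powr (1 - p) * ((1 - 0) powr (1 - p) * IG)) (at_right 0)"
    by (intro tendsto_intros) auto
  moreover have "\<forall>\<^sub>F \<theta> in at_right 0. c * Iu \<le> (1 - \<theta>) powr (1 - p) * ((1 - \<theta>) powr (1 - p) * IG)"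
    by (rule eventually_at_rightI[of 0 1], rule bound) auto
  ultimately have "c * Iu \<le> (1 - 0) powr (1 - p) * ((1 - 0) powr (1 - p) * IG)"
    by (rule tendsto_lowerbound) simp
  then show ?thesis by (simp add: Iu_def IG_def M_def)
qed

lemma lambda_F_ge:
  assumes "\<And>u G. W01p p \<Omega> u G \<Longrightarrow>
    c * (\<integral>x. \<bar>u x\<bar> powr p \<partial>lebesgue_on \<Omega>) \<le> (\<integral>x. F (G x) powr p \<partial>lebesgue_on \<Omega>)"
  shows "ereal c \<le> lambda_F F p \<Omega>"
  unfolding lambda_F_def
proof (rule Inf_greatest, safe)
  fix u G assume W: "W01p p \<Omega> u G" and nz: "\<not> (AE x in lebesgue_on \<Omega>. u x = 0)"
  \<comment> \<open>Integrability makes a zero integral equivalent to \<open>u = 0\<close> almost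
    everywhere, so the denominator of the quotient is positive.\<close>
  have "integrable (lebesgue_on \<Omega>) (\<lambda>x. \<bar>u x\<bar> powr p)"
    using W by (simp add: W01p_def W1p_def in_Lp_def)
  then have "(\<integral>x. \<bar>u x\<bar> powr p \<partial>lebesgue_on \<Omega>) \<noteq> 0"
    using nz by (subst integral_nonneg_eq_0_iff_AE) auto
  then have "(\<integral>x. \<bar>u x\<bar> powr p \<partial>lebesgue_on \<Omega>) > 0"
    by (simp add: less_le integral_nonneg_AE)
  then show "ereal c \<le> ereal ((\<integral>x. F (G x) powr p \<partial>lebesgue_on \<Omega>) / (\<integral>x. \<bar>u x\<bar> powr p \<partial>lebesgue_on \<Omega>))"
    using assms[OF W] by (simp add: pos_le_divide_eq)
qed

text \<open>The zero field is admissible in the supremum.\<close>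

lemma perimeter_F_nonneg: "0 \<le> perimeter_F F K"
  unfolding perimeter_F_def
proof (rule Sup_upper, rule CollectI, intro exI conjI)
  have "divergence (\<lambda>_::real^'n. 0) = (\<lambda>_. 0)"
    using divergence_eq[OF has_derivative_const] by auto
  then show "0 = ereal (\<integral>x. divergence (\<lambda>_. 0) x \<partial>lebesgue_on K)" by (simp add: zero_ereal_def)
  show "Ck_on 1 UNIV (\<lambda>_::real^'n. 0)" by (rule Ck1_const)
qed (auto simp: supp_def polar_zero)

text \<open>The Wulff shape inside \<open>\<Omega>\<close> is the competitor for the upper bound.
  Together the two bounds make the constant a real number, so that \<open>ereal_powr\<close> becomes
  a real power.\<close>

lemma cheeger_F_bounds:
  assumes R: "R > 0" and sub: "{x. polar F (x - c) < R} \<subseteq> \<Omega>"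
  shows "0 \<le> cheeger_F F \<Omega>" "cheeger_F F \<Omega> \<le> ereal (real CARD('n) / R)"
proof -
  show "0 \<le> cheeger_F F \<Omega>"
    unfolding cheeger_F_def
  proof (rule Inf_greatest, safe)
    fix K :: "(real^'n) set" assume "0 < measure lebesgue K"
    then show "0 \<le> perimeter_F F K / ereal (measure lebesgue K)"
      using perimeter_F_nonneg[of K] by (intro zero_le_divide_ereal) auto
  qed
  define K where "K = {x. polar F (x - c) < R}"
  note w = wulff_perimeter_le[OF R, of c, folded K_def]
  \<comment> \<open>A Euclidean ball inside the Wulff shape shows that its measure is positive, as
    the definition asks of a competitor.\<close>
  obtain e where e: "e > 0" "ball c e \<subseteq> K" using w(2,4) open_contains_ball by blast
  have mK: "K \<in> lmeasurable" using w(2,3) by (simp add: lmeasurable_open)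
  have "0 < measure lebesgue (ball c e)" using content_ball_pos[OF e(1)] by (simp add: measure_completion)
  also have "\<dots> \<le> measure lebesgue K"
    by (rule measure_mono_fmeasurable[OF e(2) _ mK]) auto
  finally have pos: "0 < measure lebesgue K" .
  have "cheeger_F F \<Omega> \<le> perimeter_F F K / ereal (measure lebesgue K)"
    unfolding cheeger_F_def using sub mK pos by (intro Inf_lower) (auto simp: K_def fmeasurableD)
  also have "\<dots> \<le> ereal (real CARD('n) / R * measure lebesgue K) / ereal (measure lebesgue K)"
    using w(1) pos by (intro ereal_divide_right_mono) auto
  also have "\<dots> = ereal (real CARD('n) / R)" using pos by simp
  finally show "cheeger_F F \<Omega> \<le> ereal (real CARD('n) / R)" .
qed

end

theorem proposition5p2:
  fixes F :: "real^'n \<Rightarrow> real" and \<Omega> :: "(real^'n) set" and p a \<beta> :: real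
  assumes "CARD('n) \<ge> 2"
    and "1 < p"
    and "\<And>\<xi>. 0 \<le> F \<xi>"
    and "convex_on UNIV F"
    and "\<And>t \<xi>. F (t *\<^sub>R \<xi>) = \<bar>t\<bar> * F \<xi>"
    and "a > 0" and "\<And>\<xi>. a * norm \<xi> \<le> F \<xi>"
    and "0 < \<beta>" and "\<beta> \<le> 1" and "Ck_Holder_on 3 \<beta> (-{0}) F"
    and "\<And>\<xi>. \<xi> \<noteq> 0 \<Longrightarrow> pos_definite (hessian (\<lambda>\<eta>. F \<eta> powr p) \<xi>)"
    and "bounded_Ck_domain 2 \<Omega>"
    and "\<And>x. x \<in> frontier \<Omega> \<Longrightarrow> mean_curvature_F F \<Omega> x \<ge> 0"
  shows "lambda_F F p \<Omega> \<ge> ereal ((pi_p p / (2 * real CARD('n))) powr p) * ereal_powr (cheeger_F F \<Omega>) p"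
proof -
  have "F differentiable (at \<xi>)" if "\<xi> \<noteq> 0" for \<xi>
    using assms(10) that by (simp add: numeral_3_eq_3)
  then interpret C2_norm F a
    using assms(4-7) Ck_Holder_on_3_imp_Ck1_grad[OF assms(10)] by unfold_locales
  note p = assms(2)
  have op: "open \<Omega>" and bd: "Ck_boundary 2 \<Omega>" and ne: "\<Omega> \<noteq> {}" and bounded: "bounded \<Omega>"
    using assms(12) by (auto simp: bounded_Ck_domain_def)
  have nU: "\<Omega> \<noteq> UNIV" using bounded not_bounded_UNIV by blast
  \<comment> \<open>The maximum is taken on the compact closure; off \<open>\<Omega>\<close> the
    distance is not positive, so its value \<open>R\<close> bounds it on all of space.\<close>
  obtain x0 where x0: "x0 \<in> closure \<Omega>" "\<And>z. z \<in> closure \<Omega> \<Longrightarrow> dist_F \<Omega> z \<le> dist_F \<Omega> x0"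
    using continuous_attains_sup[of "closure \<Omega>" "dist_F \<Omega>"] bounded ne dist_F_continuous[OF op nU] by force
  define R where "R = dist_F \<Omega> x0"
  have R_pos: "0 < R"
  proof -
    obtain x where x: "x \<in> \<Omega>" using ne by blast
    then have "dist_F \<Omega> x \<le> R" using x0(2) closure_subset by (auto simp: R_def)
    then show ?thesis using dist_F_pos[OF op nU x] by simp
  qed
  have R: "dist_F \<Omega> z \<le> R" for z
  proof (cases "z \<in> \<Omega>")
    case True
    then show ?thesis using x0(2) closure_subset by (auto simp: R_def)
  next
    case False
    then show ?thesis using dist_F_le[OF False, of z] R_pos by (simp add: polar_zero)
  qed
  \<comment> \<open>No point of the complement is closer to \<open>x0\<close> than \<open>R\<close>,
    as \<open>R\<close> is the distance of \<open>x0\<close>.\<close>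
  have "{x. polar F (x - x0) < R} \<subseteq> \<Omega>"
    using polar_less_dist_F[of x0 _ \<Omega>] by (auto simp: R_def polar_minus_commute[of _ x0])
  note h = cheeger_F_bounds[OF R_pos this]
  obtain h where h: "cheeger_F F \<Omega> = ereal h" "0 \<le> h" "h \<le> real CARD('n) / R"
    using h by (cases "cheeger_F F \<Omega>") auto
  define c where "c = (pi_p p / (2 * R)) powr p"
  have "c * (\<integral>x. \<bar>u x\<bar> powr p \<partial>lebesgue_on \<Omega>) \<le> (\<integral>x. F (G x) powr p \<partial>lebesgue_on \<Omega>)"
    if W: "W01p p \<Omega> u G" for u G
  proof (rule W01p_rayleigh_bound[OF p op W])
    show "0 \<le> c" by (simp add: c_def)
    fix \<phi> assume \<phi>: "test_function \<Omega> \<phi>"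
    show "c * (\<integral>x. \<bar>\<phi> x\<bar> powr p \<partial>lborel) \<le> (\<integral>x. F (grad \<phi> x) powr p \<partial>lborel)"
    \<comment> \<open>At this point \<open>pi_p p\<close> is only known to be nonnegative; for the
      value 0 the constant \<open>c\<close> is 0 and the bound is trivial.\<close>
    proof (cases "pi_p p = 0")
      case True
      then show ?thesis by (simp add: c_def)
    next
      case False
      then have "0 < pi_p p" using pi_p_nonneg[of p] by simp
      moreover have "Ck_on 1 UNIV \<phi>" "compact (supp \<phi>)" "supp \<phi> \<subseteq> \<Omega>"
        using \<phi> unfolding test_function_def by blast+
      ultimately show ?thesis
        unfolding c_def by (intro rayleigh_bound_C1[OF op nU bd assms(13) R R_pos p])
    qed
  qed
  then have "ereal c \<le> lambda_F F p \<Omega>" by (rule lambda_F_ge)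
  \<comment> \<open>The bound N/R on the Cheeger constant cancels the dimension in the
    denominator.\<close>
  moreover have "(pi_p p / (2 * real CARD('n))) powr p * h powr p \<le> c"
  proof -
    have "(pi_p p / (2 * real CARD('n))) powr p * h powr p = (pi_p p / (2 * real CARD('n)) * h) powr p"
      by (rule powr_mult[symmetric])
    also have "\<dots> \<le> (pi_p p / (2 * real CARD('n)) * (real CARD('n) / R)) powr p"
      using h pi_p_nonneg p by (intro powr_mono2 mult_left_mono mult_nonneg_nonneg divide_nonneg_nonneg) auto
    also have "pi_p p / (2 * real CARD('n)) * (real CARD('n) / R) = pi_p p / (2 * R)" by simp
    finally show ?thesis by (simp add: c_def)
  qed
  then have "ereal ((pi_p p / (2 * real CARD('n))) powr p) * ereal_powr (cheeger_F F \<Omega>) p \<le> ereal c"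
    by (simp add: h(1) ereal_powr_def)
  ultimately show ?thesis by (rule order_trans[rotated])
qed

end
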